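(* Let $\varphi$ be any norm on $\mathbb R^2$. Then there exists a unique minimizing movement of the constrained scheme (S) at regime $\varepsilon/\tau\to0$, and it satisfies $E(t)=B_{4t}^\varphi$ for $t\ge0$. Moreover, for every discrete solution $E_{\varepsilon,\tau}$ of (S) we have, in this regime, $$\chi_{E_{\varepsilon,\tau}(t)}\overset{*}{\rightharpoonup}\tfrac12\,\chi_{B_{4t}^\varphi}\quad\text{for } t\ge0,\ \text{as }\varepsilon\to0$$ (weak$^*$ convergence in $L^\infty(\mathbb R^2)$).
   Context: $B_r^\varphi=\{\mathbf x\in\mathbb R^2:\varphi(\mathbf x)<r\}$ for $r>0$; for $r=0$, $B_0^\varphi$ is understood as $\{(0,0)\}$ (sets are compared through the Hausdorff distance). $\mathcal X$ is the space of subsets of $\mathbb R^2$ of finite perimeter, with the Hausdorff distance. For $\varepsilon>0$, $q_\varepsilon(\mathbf x)=\mathbf x+[-\varepsilon/2,\varepsilon/2]^2$, $q_\varepsilon=q_\varepsilon(0)$; $\mathcal D_\varepsilon$ is the class of sets $\bigcup_{\mathbf i\in\mathcal I}q_\varepsilon(\mathbf i)$ with $\mathcal I\subset\varepsilon\mathbb Z^2$, and $Z_\varepsilon(E)=E\cap\varepsilon\mathbb Z^2$ for $E\in\mathcal D_\varepsilon$. Energies are considered on sets of finite perimeter. For $\mathcal I\subset\varepsilon\mathbb Z^2$ and $\mathbf i\in\varepsilon\mathbb Z^2$ let $d_\varepsilon^\varphi(\mathbf i,\partial\mathcal I)=\inf\{\varphi(\mathbf i-\mathbf j):\mathbf j\in\mathcal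 I\}$ if $\mathbf i\notin\mathcal I$, and $=\inf\{\varphi(\mathbf i-\mathbf j):\mathbf j\in\varepsilon\mathbb Z^2\setminus\mathcal I\}$ if $\mathbf i\in\mathcal I$. For $\varepsilon,\tau>0$ and $E,F\in\mathcal D_\varepsilon$, $$\mathcal F_{\varepsilon,\tau}^\varphi(E,F)=-\varepsilon\,\mathcal H^1(\partial E)+\frac{\varepsilon^2}{\tau}\sum_{\mathbf i\in Z_\varepsilon(E)\triangle Z_\varepsilon(F)}d_\varepsilon^\varphi(\mathbf i,\partial Z_\varepsilon(F)).$$ **Scheme (S).** $E_{\varepsilon,\tau}^0=q_\varepsilon$, and for $k\ge0$, $E_{\varepsilon,\tau}^{k+1}$ is a minimizer of $\mathcal F_{\varepsilon,\tau}^\varphi(\cdot,E_{\varepsilon,\tau}^k)$ among $E\in\mathcal D_\varepsilon$ with $E\supset E_{\varepsilon,\tau}^k$. A discrete solution is $E_{\varepsilon,\tau}(t)=E_{\varepsilon,\tau}^{\lfloor t/\tau\rfloor}$. A minimizing movement at regime $\varepsilon/\tau\to0$ is a curve $E:[0,+\infty)\to\mathcal X$ that is a pointwise (in $t$) limit, in the Hausdorff distance, of discrete solutions $E_{\varepsilon,\tau}$ as $\varepsilon,\tau\to0$ with $\varepsilon/\tau\to0$, up to subsequences. *)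

theory Defs
  imports "HOL-Analysis.Analysis"
begin

section \<open>Norms and their balls\<close>

definition is_norm :: "('a::real_vector \<Rightarrow> real) \<Rightarrow> bool" where
  "is_norm \<phi> \<longleftrightarrow>
     (\<forall>x. 0 \<le> \<phi> x) \<and> (\<forall>x. \<phi> x = 0 \<longleftrightarrow> x = 0) \<and>
     (\<forall>c x. \<phi> (c *\<^sub>R x) = \<bar>c\<bar> * \<phi> x) \<and> (\<forall>x y. \<phi> (x + y) \<le> \<phi> x + \<phi> y)"

definition norm_ball :: "('a::real_vector \<Rightarrow> real) \<Rightarrow> real \<Rightarrow> 'a set" where
  "norm_ball \<phi> r = (if r = 0 then {0} else {x. \<phi> x < r})"

section \<open>Hausdorff distance and one-dimensional Hausdorff measure\<close>

text \<open>The infima are taken in the extended nonnegative reals, so that the distance between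
  a nonempty set and the empty set is infinite. This is a pseudo-distance: it vanishes exactly
  on pairs of sets with the same closure.\<close>

definition hausdorff_distance :: "'a::metric_space set \<Rightarrow> 'a set \<Rightarrow> ennreal" where
  "hausdorff_distance A B =
     max (SUP x\<in>A. INF y\<in>B. ennreal (dist x y)) (SUP y\<in>B. INF x\<in>A. ennreal (dist x y))"

text \<open>Boundedness is required because \<^const>\<open>diameter\<close> is meaningless on unbounded sets.
  Finite covers are included, by padding with empty sets.\<close>

definition hausdorff_pre1 :: "real \<Rightarrow> 'a::metric_space set \<Rightarrow> ennreal" where
  "hausdorff_pre1 \<delta> A =
     (INF U \<in> {U :: nat \<Rightarrow> 'a set. A \<subseteq> (\<Union>n. U n) \<and> (\<forall>n. bounded (U n) \<and> diameter (U n) \<le> \<delta>)}.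
        \<Sum>n. ennreal (diameter (U n)))"

definition hausdorff_measure1 :: "'a::metric_space set \<Rightarrow> ennreal" where
  "hausdorff_measure1 A = (SUP \<delta>\<in>{0<..}. hausdorff_pre1 \<delta> A)"

section \<open>Sets of finite perimeter\<close>

definition divergence :: "('a::euclidean_space \<Rightarrow> 'a) \<Rightarrow> 'a \<Rightarrow> real" where
  "divergence T x = (\<Sum>b\<in>Basis. frechet_derivative T (at x) b \<bullet> b)"

text \<open>Compactly supported \<open>C\<^sup>1\<close> vector fields bounded by one in the Euclidean norm.\<close>

definition perimeter_test_field :: "('a::euclidean_space \<Rightarrow> 'a) \<Rightarrow> bool" where
  "perimeter_test_field T \<longleftrightarrow>
     (\<exists>T'. (\<forall>x. (T has_derivative blinfun_apply (T' x)) (at x)) \<and> continuous_on UNIV T') \<and>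
     compact (closure {x. T x \<noteq> 0}) \<and> (\<forall>x. norm (T x) \<le> 1)"

definition perimeter :: "'a::euclidean_space set \<Rightarrow> ereal" where
  "perimeter E = (SUP T\<in>Collect perimeter_test_field. ereal (LINT x:E|lebesgue. divergence T x))"

definition finite_perimeter :: "'a::euclidean_space set \<Rightarrow> bool" where
  "finite_perimeter E \<longleftrightarrow> E \<in> sets lebesgue \<and> perimeter E < \<infinity>"

section \<open>Weak* convergence of bounded functions\<close>

definition in_Linfty :: "('a::euclidean_space \<Rightarrow> real) \<Rightarrow> bool" where
  "in_Linfty f \<longleftrightarrow> f \<in> borel_measurable lebesgue \<and> (\<exists>C. AE x in lebesgue. \<bar>f x\<bar> \<le> C)"

definition weak_star_tendsto ::
    "(nat \<Rightarrow> 'a::euclidean_space \<Rightarrow> real) \<Rightarrow> ('a \<Rightarrow> real) \<Rightarrow> bool" where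
  "weak_star_tendsto u v \<longleftrightarrow>
     (\<forall>n. in_Linfty (u n)) \<and> in_Linfty v \<and>
     (\<forall>g. integrable lebesgue g \<longrightarrow>
        (\<lambda>n. LINT x|lebesgue. u n x * g x) \<longlonglongrightarrow> (LINT x|lebesgue. v x * g x))"

section \<open>The discrete scheme\<close>

type_synonym plane = "real \<times> real"

definition lattice :: "real \<Rightarrow> plane set" where
  "lattice \<epsilon> = {(\<epsilon> * of_int a, \<epsilon> * of_int b) | a b :: int. True}"

definition cell :: "real \<Rightarrow> plane \<Rightarrow> plane set" where
  "cell \<epsilon> x = (+) x ` ({- \<epsilon> / 2 .. \<epsilon> / 2} \<times> {- \<epsilon> / 2 .. \<epsilon> / 2})"

definition discrete_sets :: "real \<Rightarrow> plane set set" where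
  "discrete_sets \<epsilon> = {\<Union>i\<in>I. cell \<epsilon> i | I. I \<subseteq> lattice \<epsilon>}"

definition lattice_points :: "real \<Rightarrow> plane set \<Rightarrow> plane set" where
  "lattice_points \<epsilon> E = E \<inter> lattice \<epsilon>"

text \<open>Distance to the discrete boundary of \<open>I\<close>; it is infinite if the infimum is over the empty set.\<close>

definition boundary_distance :: "(plane \<Rightarrow> real) \<Rightarrow> real \<Rightarrow> plane \<Rightarrow> plane set \<Rightarrow> ennreal" where
  "boundary_distance \<phi> \<epsilon> i I =
     (if i \<in> I then INF j\<in>lattice \<epsilon> - I. ennreal (\<phi> (i - j))
      else INF j\<in>I. ennreal (\<phi> (i - j)))"

text \<open>The dissipation is infinite when infinitely many cells are added to a nonempty
  finite union of cells. On sets of finite perimeter the boundary term is finite, so the sum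
  below is never of the form \<open>-\<infinity> + \<infinity>\<close> there.\<close>

definition energy ::
    "(plane \<Rightarrow> real) \<Rightarrow> real \<Rightarrow> real \<Rightarrow> plane set \<Rightarrow> plane set \<Rightarrow> ereal" where
  "energy \<phi> \<epsilon> \<tau> E F =
     - (ereal \<epsilon> * enn2ereal (hausdorff_measure1 (frontier E))) +
     ereal (\<epsilon>\<^sup>2 / \<tau>) *
       enn2ereal (\<Sum>\<^sub>\<infinity>i\<in>sym_diff (lattice_points \<epsilon> E) (lattice_points \<epsilon> F).
         boundary_distance \<phi> \<epsilon> i (lattice_points \<epsilon> F))"

definition admissible :: "real \<Rightarrow> plane set \<Rightarrow> plane set set" where
  "admissible \<epsilon> F = {E \<in> discrete_sets \<epsilon>. finite_perimeter E \<and> F \<subseteq> E}"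

definition scheme :: "(plane \<Rightarrow> real) \<Rightarrow> real \<Rightarrow> real \<Rightarrow> (nat \<Rightarrow> plane set) \<Rightarrow> bool" where
  "scheme \<phi> \<epsilon> \<tau> S \<longleftrightarrow>
     S 0 = cell \<epsilon> 0 \<and>
     (\<forall>k. S (Suc k) \<in> admissible \<epsilon> (S k) \<and>
          (\<forall>E\<in>admissible \<epsilon> (S k). energy \<phi> \<epsilon> \<tau> (S (Suc k)) (S k) \<le> energy \<phi> \<epsilon> \<tau> E (S k)))"

definition discrete_solution ::
    "(plane \<Rightarrow> real) \<Rightarrow> real \<Rightarrow> real \<Rightarrow> (real \<Rightarrow> plane set) \<Rightarrow> bool" where
  "discrete_solution \<phi> \<epsilon> \<tau> E \<longleftrightarrow>
     (\<exists>S. scheme \<phi> \<epsilon> \<tau> S \<and> (\<forall>t\<ge>0. E t = S (nat \<lfloor>t / \<tau>\<rfloor>)))"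

text \<open>Sequences of parameters with \<open>\<epsilon>, \<tau> \<rightarrow> 0\<close> and \<open>\<epsilon>/\<tau> \<rightarrow> 0\<close>.\<close>

definition regime :: "(nat \<Rightarrow> real) \<Rightarrow> (nat \<Rightarrow> real) \<Rightarrow> bool" where
  "regime \<epsilon> \<tau> \<longleftrightarrow>
     (\<forall>n. 0 < \<epsilon> n) \<and> (\<forall>n. 0 < \<tau> n) \<and> \<epsilon> \<longlonglongrightarrow> 0 \<and> \<tau> \<longlonglongrightarrow> 0 \<and> (\<lambda>n. \<epsilon> n / \<tau> n) \<longlonglongrightarrow> 0"

text \<open>Curves are defined on \<open>[0, \<infinity>)\<close>: only the values at nonnegative times matter.\<close>

definition minimizing_movement :: "(plane \<Rightarrow> real) \<Rightarrow> (real \<Rightarrow> plane set) \<Rightarrow> bool" where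
  "minimizing_movement \<phi> E \<longleftrightarrow>
     (\<forall>t\<ge>0. finite_perimeter (E t)) \<and>
     (\<exists>\<epsilon> \<tau> D. regime \<epsilon> \<tau> \<and> (\<forall>n. discrete_solution \<phi> (\<epsilon> n) (\<tau> n) (D n)) \<and>
        (\<forall>t\<ge>0. (\<lambda>n. hausdorff_distance (D n t) (E t)) \<longlonglongrightarrow> 0))"

end

theory Submission
  imports Defs
begin

text \<open>
  A union of cells is encoded by its set \<open>I\<close> of integer index pairs. The frontier of a finite
  union consists of \<open>card (bdry I)\<close> sides of length \<open>\<epsilon>\<close>, so that, up to the factor \<open>\<epsilon>\<^sup>2\<close>, one
  step of the scheme from \<open>F\<close> minimizes \<open>(\<Sum>i\<in>I - F. gap i) / \<tau> - card (bdry I)\<close> among finite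
  \<open>I \<supseteq> F\<close>, where \<open>gap\<close> is the \<open>\<phi>\<close>-distance to \<open>F\<close>. Infinite unions have infinite energy.

  \<^emph>\<open>Hausdorff limit.\<close> One isolated cell gains four sides. Adding or removing a single cell
  therefore shows that a minimizer contains no point with \<open>gap > 4 \<tau>\<close>, and that each lattice
  point with \<open>gap < 4 \<tau>\<close> belongs to it or has a neighbour in it. Hence each step moves the front
  by \<open>4 \<tau>\<close> with an error of order \<open>\<epsilon>\<close>. After \<open>t / \<tau>\<close> steps the error is of order \<open>\<epsilon> / \<tau>\<close>, and
  the sets converge to the ball of radius \<open>4 t\<close>. Since this holds for every sequence of discrete
  solutions, the minimizing movement is unique.

  \<^emph>\<open>Density one half.\<close> Count the sides through the \<open>2 \<times> 2\<close> squares of lattice points: each side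
  lies in two squares, and a square has four sides on the boundary exactly if its occupied
  points form a diagonal; otherwise it has at most two. If a box of \<open>L \<times> L\<close> points lies at
  distances between \<open>0\<close> and \<open>4 \<tau> / s\<close> from the current set, \<open>s > 1\<close>, replacing the content of
  the box by a checkerboard shows that all but \<open>O(L)\<close> of its squares are diagonal, up to a term
  that accounts for the oscillation of the distance in the box, small compared with \<open>\<tau>\<close>
  (\<open>box_not_diag_count\<close>). A diagonal square is never changed afterwards.

  It remains to see that most points of the ball are, at some step, at such a distance. Apart
  from small neighbourhoods of the origin and of the bounding sphere, the exceptions have at
  some step a distance between \<open>4 \<tau> / s\<close> and \<open>4 \<tau> s\<close>. Contracting towards the nearest point of a
  finite set maps a distance shell into the shell of proportionally smaller distances and is
  injective with constant Jacobian on each Voronoi cell. Comparing the exceptional shell with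
  \<open>M\<close> disjoint contracted copies shows that its area is at most \<open>16 / M\<close> times that of the
  region conquered at this step (\<open>measure_shell_small\<close>), and these regions are disjoint in time.
  So the area that is not covered by diagonal squares tends to zero. On such squares exactly
  half of the cells are filled, which gives the limit of integrals over open sets and, by
  approximation, against all integrable functions.
\<close>

section \<open>Finite perimeter of convex sets and of almost disjoint unions\<close>

text \<open>The left-hand side is a difference of two values of \<open>F\<close>, because a bounded convex set of
  reals is an interval up to its end points.\<close>

lemma convex_slice_integral_bound:
  fixes S :: "real set"
  assumes "convex S" "bounded S"
    and F: "\<And>x. (F has_real_derivative f x) (at x)" and f: "continuous_on UNIV f"
    and F1: "\<And>x. \<bar>F x\<bar> \<le> 1"
  shows "\<bar>LBINT x. indicat_real S x * f x\<bar> \<le> 2"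
proof (cases "S = {}")
  case True
  then show ?thesis by simp
next
  case False
  define a b where "a = Inf S" and "b = Sup S"
  have bb: "bdd_below S" "bdd_above S"
    using assms(2) by (auto simp: bounded_imp_bdd_below bounded_imp_bdd_above)
  have sub: "S \<subseteq> {a..b}"
    using bb by (auto simp: a_def b_def cInf_lower cSup_upper)
  have sup: "{a<..<b} \<subseteq> S"
  proof
    fix x assume x: "x \<in> {a<..<b}"
    obtain u where u: "u \<in> S" "u < x"
      using x False bb by (auto simp: a_def cInf_less_iff)
    obtain v where v: "v \<in> S" "x < v"
      using x False bb by (auto simp: b_def less_cSup_iff)
    from u v show "x \<in> S"
      using assms(1) by (metis is_interval_convex_1 mem_is_interval_1_I less_imp_le)
  qed
  have ab: "a \<le> b" using False sub by fastforce
  have S_eq: "S = {a<..<b} \<union> (S \<inter> {a, b})" using sub sup by fastforce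
  have Sb: "S \<in> sets borel"
    by (subst S_eq) (intro sets.Un borel_open open_greaterThanLessThan borel_closed
        finite_imp_closed, auto)
  have fm: "f \<in> borel_measurable borel"
    using f by (rule borel_measurable_continuous_onI)
  have fin: "AE x in lborel. x \<notin> {a, b}"
    by (intro AE_not_in finite_imp_null_set_lborel) auto
  have "(LBINT x. indicat_real S x * f x) = (LBINT x. f x * indicat_real {a..b} x)"
  proof (rule integral_cong_AE)
    show "AE x in lborel. indicat_real S x * f x = f x * indicat_real {a..b} x"
      using fin
    proof eventually_elim
      case (elim x)
      have "x \<in> S \<longleftrightarrow> x \<in> {a..b}" using elim sub sup by auto
      then show ?case by (simp add: indicator_def)
    qed
  qed (use Sb fm in measurable)
  also have "\<dots> = F b - F a"
    using ab F f by (intro integral_FTC_Icc_real) (auto simp: continuous_on_eq_continuous_at)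
  finally show ?thesis using F1[of a] F1[of b] by simp
qed

text \<open>Slicing a convex set by lines parallel to the axes gives intervals, on which the integral
  of a partial derivative of the field is a difference of two of its values.\<close>

lemma divergence_integral_bound:
  fixes E :: "plane set"
  assumes E: "E \<in> sets borel" "convex E" "E \<subseteq> {-R..R} \<times> {-R..R}" and R: "0 \<le> R"
    and T: "perimeter_test_field T"
  shows "set_integrable lebesgue E (divergence T)"
    and "(LINT x:E|lebesgue. divergence T x) \<le> 8 * R"
proof -
  obtain T' where T': "\<And>x. (T has_derivative blinfun_apply (T' x)) (at x)" "continuous_on UNIV T'"
    and T1: "\<And>x. norm (T x) \<le> 1"
    using T unfolding perimeter_test_field_def by blast
  define f1 where "f1 p = fst (T' p (1, 0))" for p
  define f2 where "f2 p = snd (T' p (0, 1))" for p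
  have f_cont: "continuous_on UNIV f1" "continuous_on UNIV f2"
    unfolding f1_def f2_def by (intro continuous_intros T')+
  have div: "divergence T p = f1 p + f2 p" for p
    unfolding divergence_def f1_def f2_def frechet_derivative_at[OF T'(1), symmetric]
    by (simp add: Basis_prod_def sum.union_disjoint inner_prod_def)
  have bT: "\<bar>fst (T p)\<bar> \<le> 1" "\<bar>snd (T p)\<bar> \<le> 1" for p
    using T1[of p] norm_fst_le[of "fst (T p)" "snd (T p)"] norm_snd_le[of "snd (T p)" "fst (T p)"]
        by simp_all
  have d1: "((\<lambda>x. fst (T (x, y))) has_real_derivative f1 (x, y)) (at x)" for x y
  proof -
    have "((\<lambda>x. fst (T (x, y))) has_derivative (\<lambda>h. fst (T' (x, y) (h, 0)))) (at x)"
    proof (rule has_derivative_fst)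
      have "((\<lambda>x. (x, y)) has_derivative (\<lambda>h. (h, 0))) (at x)"
        by (auto intro!: derivative_eq_intros)
      from has_derivative_compose[OF this T'(1)]
      show "((\<lambda>x. T (x, y)) has_derivative (\<lambda>h. T' (x, y) (h, 0))) (at x)" .
    qed
    moreover have "(\<lambda>h. fst (T' (x, y) (h, 0))) = (\<lambda>h. f1 (x, y) * h)"
    proof
      fix h :: real
      have "T' (x, y) (h *\<^sub>R (1, 0)) = h *\<^sub>R T' (x, y) (1, 0)" by (rule blinfun.scaleR_right)
      then show "fst (T' (x, y) (h, 0)) = f1 (x, y) * h" by (simp add: f1_def)
    qed
    ultimately show ?thesis by (simp add: has_field_derivative_def)
  qed
  have d2: "((\<lambda>y. snd (T (x, y))) has_real_derivative f2 (x, y)) (at y)" for x y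
  proof -
    have "((\<lambda>y. snd (T (x, y))) has_derivative (\<lambda>h. snd (T' (x, y) (0, h)))) (at y)"
    proof (rule has_derivative_snd)
      have "((\<lambda>y. (x, y)) has_derivative (\<lambda>h. (0, h))) (at y)"
        by (auto intro!: derivative_eq_intros)
      from has_derivative_compose[OF this T'(1)]
      show "((\<lambda>y. T (x, y)) has_derivative (\<lambda>h. T' (x, y) (0, h))) (at y)" .
    qed
    moreover have "(\<lambda>h. snd (T' (x, y) (0, h))) = (\<lambda>h. f2 (x, y) * h)"
    proof
      fix h :: real
      have "T' (x, y) (h *\<^sub>R (0, 1)) = h *\<^sub>R T' (x, y) (0, 1)" by (rule blinfun.scaleR_right)
      then show "snd (T' (x, y) (0, h)) = f2 (x, y) * h" by (simp add: f2_def)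
    qed
    ultimately show ?thesis by (simp add: has_field_derivative_def)
  qed
  define C where "C = {-R..R} \<times> {-R..R}"
  have C: "compact C" unfolding C_def by (intro compact_Times compact_Icc)
  have int: "integrable lborel (\<lambda>p. indicat_real E p * f p)" if "continuous_on UNIV f" for f
  proof -
    have "integrable lborel (\<lambda>p. indicat_real C p *\<^sub>R f p)"
      by (rule borel_integrable_compact[OF C continuous_on_subset[OF that]]) simp
    then have "integrable lborel (\<lambda>p. indicat_real E p *\<^sub>R (indicat_real C p *\<^sub>R f p))"
      by (rule integrable_mult_indicator[rotated]) (use E(1) in simp)
    moreover have "(\<lambda>p. indicat_real E p *\<^sub>R (indicat_real C p *\<^sub>R f p)) = (\<lambda>p. indicat_real E p * f p)"
      using E(3) by (intro ext) (auto simp: indicator_def C_def)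
    ultimately show ?thesis by (simp only:)
  qed
  have bound: "\<bar>LBINT x. G x\<bar> \<le> 4 * R"
    if "integrable lborel G" "\<And>x. \<bar>G x\<bar> \<le> 2" "\<And>x. x \<notin> {-R..R} \<Longrightarrow> G x = 0" for G :: "real \<Rightarrow> real"
  proof -
    have "norm (LBINT x. G x) \<le> (LBINT x. 2 * indicat_real {-R..R} x)"
    proof (rule Bochner_Integration.integral_norm_bound_integral)
      show "integrable lborel (\<lambda>x. 2 * indicat_real {-R..R} x)"
        by (intro integrable_mult_right integrable_real_indicator) (auto simp: emeasure_lborel_Icc_eq)
    qed (use that in \<open>auto simp: indicator_def\<close>)
    then show ?thesis using R by simp
  qed
  have cc: "continuous_on UNIV (\<lambda>x. f1 (x, y))" "continuous_on UNIV (\<lambda>y. f2 (x, y))" for x y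
    by (intro continuous_on_compose2[OF f_cont(1)] continuous_on_compose2[OF f_cont(2)]
      continuous_intros; simp)+
  have sl: "convex {x. (x, y) \<in> E}" "bounded {x. (x, y) \<in> E}"
      "convex {y. (x, y) \<in> E}" "bounded {y. (x, y) \<in> E}" for x y
  proof -
    show "convex {x. (x, y) \<in> E}"
    proof (rule convexI, clarify)
      fix u v a b :: real assume "(u, y) \<in> E" "(v, y) \<in> E" "0 \<le> a" "0 \<le> b" "a + b = 1"
      then have "a *\<^sub>R (u, y) + b *\<^sub>R (v, y) \<in> E" using E(2) unfolding convex_def by blast
      moreover have "a *\<^sub>R (u, y) + b *\<^sub>R (v, y) = (a *\<^sub>R u + b *\<^sub>R v, y)"
        using \<open>a + b = 1\<close> by (simp flip: distrib_right)
      ultimately show "(a *\<^sub>R u + b *\<^sub>R v, y) \<in> E" by simp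
    qed
    show "convex {y. (x, y) \<in> E}"
    proof (rule convexI, clarify)
      fix u v a b :: real assume "(x, u) \<in> E" "(x, v) \<in> E" "0 \<le> a" "0 \<le> b" "a + b = 1"
      then have "a *\<^sub>R (x, u) + b *\<^sub>R (x, v) \<in> E" using E(2) unfolding convex_def by blast
      moreover have "a *\<^sub>R (x, u) + b *\<^sub>R (x, v) = (x, a *\<^sub>R u + b *\<^sub>R v)"
        using \<open>a + b = 1\<close> by (simp flip: distrib_right)
      ultimately show "(x, a *\<^sub>R u + b *\<^sub>R v) \<in> E" by simp
    qed
    show "bounded {x. (x, y) \<in> E}" "bounded {y. (x, y) \<in> E}"
      using E(3) by (auto intro: bounded_subset[OF bounded_closed_interval[of "-R" R]])
  qed
  have I1: "\<bar>LBINT p. indicat_real E p * f1 p\<bar> \<le> 4 * R"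
  proof -
    let ?G = "\<lambda>y. LBINT x. indicat_real E (x, y) * f1 (x, y)"
    have ip: "integrable (lborel \<Otimes>\<^sub>M lborel) (\<lambda>(x, y). indicat_real E (x, y) * f1 (x, y))"
      using int[OF f_cont(1)] by (simp add: lborel_prod case_prod_unfold)
    have "(LBINT p. indicat_real E p * f1 p) = (LBINT y. ?G y)"
      using lborel_pair.integral_snd[OF ip] by (simp add: lborel_prod case_prod_unfold)
    moreover have "\<bar>LBINT y. ?G y\<bar> \<le> 4 * R"
    proof (rule bound)
      show "integrable lborel ?G" using lborel_pair.integrable_snd[OF ip] by simp
      fix y
      show "\<bar>?G y\<bar> \<le> 2"
        using convex_slice_integral_bound[OF sl(1,2) d1 cc(1) bT(1), of y]
        by (simp add: indicator_def)
      assume "y \<notin> {-R..R}"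
      then have "indicat_real E (x, y) = 0" for x using E(3) by (auto simp: indicator_def)
      then show "?G y = 0" by simp
    qed
    ultimately show ?thesis by simp
  qed
  have I2: "\<bar>LBINT p. indicat_real E p * f2 p\<bar> \<le> 4 * R"
  proof -
    let ?G = "\<lambda>x. LBINT y. indicat_real E (x, y) * f2 (x, y)"
    have ip: "integrable (lborel \<Otimes>\<^sub>M lborel) (\<lambda>(x, y). indicat_real E (x, y) * f2 (x, y))"
      using int[OF f_cont(2)] by (simp add: lborel_prod case_prod_unfold)
    have "(LBINT p. indicat_real E p * f2 p) = (LBINT y. ?G y)"
      using lborel_pair.integral_fst[OF ip] by (simp add: lborel_prod case_prod_unfold)
    moreover have "\<bar>LBINT y. ?G y\<bar> \<le> 4 * R"
    proof (rule bound)
      show "integrable lborel ?G" using lborel_pair.integrable_fst[OF ip] by simp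
      fix x
      show "\<bar>?G x\<bar> \<le> 2"
        using convex_slice_integral_bound[OF sl(3,4) d2 cc(2) bT(2), of x]
        by (simp add: indicator_def)
      assume "x \<notin> {-R..R}"
      then have "indicat_real E (x, y) = 0" for y using E(3) by (auto simp: indicator_def)
      then show "?G x = 0" by simp
    qed
    ultimately show ?thesis by simp
  qed
  have eq: "indicat_real E p *\<^sub>R divergence T p = indicat_real E p * f1 p + indicat_real E p * f2
      p" for p
    by (simp add: div distrib_left)
  have intdiv: "integrable lborel (\<lambda>p. indicat_real E p *\<^sub>R divergence T p)"
    unfolding eq by (intro Bochner_Integration.integrable_add int f_cont)
  from integrable_completion[THEN iffD2, OF borel_measurable_integrable[OF this] this] show
      "set_integrable lebesgue E (divergence T)"
    unfolding set_integrable_def .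
  have "(LINT x:E|lebesgue. divergence T x) = (LBINT p. indicat_real E p *\<^sub>R divergence T p)"
    unfolding set_lebesgue_integral_def
    by (rule integral_completion[OF borel_measurable_integrable[OF intdiv]])
  also have "\<dots> = (LBINT p. indicat_real E p * f1 p) + (LBINT p. indicat_real E p * f2 p)"
    unfolding eq by (intro Bochner_Integration.integral_add int f_cont)
  finally show "(LINT x:E|lebesgue. divergence T x) \<le> 8 * R" using I1 I2 by simp
qed

lemma subset_square:
  fixes E :: "plane set"
  assumes "\<And>x. x \<in> E \<Longrightarrow> norm x \<le> R"
  shows "E \<subseteq> {-R..R} \<times> {-R..R}"
proof
  fix p assume "p \<in> E"
  then have "norm (fst p) \<le> R" "norm (snd p) \<le> R"
    using assms[of p] norm_fst_le[of "fst p" "snd p"] norm_snd_le[of "snd p" "fst p"] by simp_all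
  then show "p \<in> {-R..R} \<times> {-R..R}" by (auto simp: mem_Times_iff)
qed

lemma finite_perimeter_convex:
  fixes E :: "plane set"
  assumes "E \<in> sets borel" "convex E" "bounded E"
  shows "finite_perimeter E"
proof -
  obtain R where R: "0 < R" "\<And>x. x \<in> E \<Longrightarrow> norm x \<le> R"
    using assms(3) by (auto simp: bounded_pos)
  have sub: "E \<subseteq> {-R..R} \<times> {-R..R}" by (rule subset_square) (rule R(2))
  have "perimeter E \<le> ereal (8 * R)"
    unfolding perimeter_def
    by (rule SUP_least) (use divergence_integral_bound(2)[OF assms(1,2) sub] R(1) in auto)
  then show ?thesis unfolding finite_perimeter_def using assms(1) by auto
qed

lemma finite_perimeter_finite_UN:
  fixes E :: "'i \<Rightarrow> plane set"
  assumes "finite I" and E: "\<And>i. i \<in> I \<Longrightarrow> E i \<in> sets borel \<and> convex (E i) \<and> bounded (E i)"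
    and disj: "\<And>i j. i \<in> I \<Longrightarrow> j \<in> I \<Longrightarrow> i \<noteq> j \<Longrightarrow> E i \<inter> E j \<in> null_sets lebesgue"
  shows "finite_perimeter (\<Union>i\<in>I. E i)"
proof -
  have "bounded (\<Union>i\<in>I. E i)" using assms(1) E by (intro bounded_UN) auto
  then obtain R where R: "0 < R" "\<And>x. x \<in> (\<Union>i\<in>I. E i) \<Longrightarrow> norm x \<le> R"
    by (auto simp: bounded_pos)
  have sub: "E i \<subseteq> {-R..R} \<times> {-R..R}" if "i \<in> I" for i
    by (rule subset_square) (rule R(2), use that in blast)
  have le: "(LINT x:(\<Union>i\<in>I. E i)|lebesgue. divergence T x) \<le> card I * (8 * R)"
    if T: "perimeter_test_field T" for T
  proof -
    have b: "set_integrable lebesgue (E i) (divergence T)" "(LINT x:E i|lebesgue. divergence T x)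
        \<le> 8 * R"
      if "i \<in> I" for i
      using divergence_integral_bound[OF _ _ sub[OF that] _ T] E[OF that] R(1) by auto
    have "set_integrable lebesgue (\<Union>i\<in>J. E i) (divergence T) \<and>
        (LINT x:(\<Union>i\<in>J. E i)|lebesgue. divergence T x) = (\<Sum>i\<in>J. LINT x:E i|lebesgue. divergence T x)"
      if "J \<subseteq> I" for J
      using finite_subset[OF that assms(1)] that
    proof (induction J rule: finite_induct)
      case (insert i J)
      have i: "i \<in> I" "E i \<in> sets lebesgue" using insert E by auto
      have J: "(\<Union>i\<in>J. E i) \<in> sets lebesgue"
        using insert E by (intro sets.finite_UN) auto
      have "(\<Union>j\<in>J. E i \<inter> E j) \<in> null_sets lebesgue"
        using insert by (intro null_sets.finite_UN disj) auto
      then have "AE x in lebesgue. x \<notin> (\<Union>j\<in>J. E i \<inter> E j)" by (rule AE_not_in)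
      then have "AE x in lebesgue. \<not> (x \<in> E i \<and> x \<in> (\<Union>i\<in>J. E i))"
        by eventually_elim auto
      then show ?case
        using insert b(1)[OF i(1)] i(2) J
        by (auto simp: set_integral_Un_AE intro!: set_integrable_Un)
    qed (simp add: set_lebesgue_integral_def)
    from this[of I] have "(LINT x:(\<Union>i\<in>I. E i)|lebesgue. divergence T x) = (\<Sum>i\<in>I. LINT x:E
        i|lebesgue. divergence T x)"
      by simp
    also have "\<dots> \<le> card I * (8 * R)"
      using sum_mono[of I _ "\<lambda>_. 8 * R", OF b(2)] by simp
    finally show ?thesis .
  qed
  have "perimeter (\<Union>i\<in>I. E i) \<le> ereal (card I * (8 * R))"
    unfolding perimeter_def by (rule SUP_least) (use le in auto)
  moreover have "(\<Union>i\<in>I. E i) \<in> sets lebesgue"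
    using assms(1) E by (intro sets.finite_UN) auto
  ultimately show ?thesis unfolding finite_perimeter_def by auto
qed

section \<open>Lattice cells and the length of their boundary\<close>

type_synonym index = "int \<times> int"

text \<open>The lattice point, and centre of a cell, with a given pair of integer indices.\<close>

definition pt :: "real \<Rightarrow> index \<Rightarrow> plane" where
  "pt \<epsilon> i = (\<epsilon> * of_int (fst i), \<epsilon> * of_int (snd i))"

text \<open>The union of the cells with indices in \<open>I\<close>.\<close>

definition cells :: "real \<Rightarrow> index set \<Rightarrow> plane set" where
  "cells \<epsilon> I = (\<Union>i\<in>I. cell \<epsilon> (pt \<epsilon> i))"

text \<open>Adjacency of cells: they share a side.\<close>

definition adj :: "index \<Rightarrow> index \<Rightarrow> bool" where
  "adj i j \<longleftrightarrow> \<bar>fst i - fst j\<bar> + \<bar>snd i - snd j\<bar> = 1"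

text \<open>The sides on the boundary, each encoded once, as the pair of the cell inside and the cell
  outside.\<close>

definition bdry :: "index set \<Rightarrow> (index \<times> index) set" where
  "bdry I = {(i, j). i \<in> I \<and> j \<notin> I \<and> adj i j}"

text \<open>Arc length parametrization, from the midpoint, of the common side of two adjacent cells.\<close>

definition edge_pt :: "real \<Rightarrow> index \<times> index \<Rightarrow> real \<Rightarrow> plane" where
  "edge_pt \<epsilon> e s =
     (\<epsilon> / 2 * of_int (fst (fst e) + fst (snd e)) + s * of_int \<bar>snd (fst e) - snd (snd e)\<bar>,
      \<epsilon> / 2 * of_int (snd (fst e) + snd (snd e)) + s * of_int \<bar>fst (fst e) - fst (snd e)\<bar>)"

lemma mem_cell_pt:
  "x \<in> cell \<epsilon> (pt \<epsilon> i) \<longleftrightarrow>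
     \<bar>fst x - \<epsilon> * of_int (fst i)\<bar> \<le> \<epsilon> / 2 \<and> \<bar>snd x - \<epsilon> * of_int (snd i)\<bar> \<le> \<epsilon> / 2"
proof -
  have "x \<in> cell \<epsilon> (pt \<epsilon> i) \<longleftrightarrow> x - pt \<epsilon> i \<in> {- \<epsilon> / 2 .. \<epsilon> / 2} \<times> {- \<epsilon> / 2 .. \<epsilon> / 2}"
  proof
    assume "x - pt \<epsilon> i \<in> {- \<epsilon> / 2 .. \<epsilon> / 2} \<times> {- \<epsilon> / 2 .. \<epsilon> / 2}"
    then have "pt \<epsilon> i + (x - pt \<epsilon> i) \<in> cell \<epsilon> (pt \<epsilon> i)" unfolding cell_def by (rule imageI)
    then show "x \<in> cell \<epsilon> (pt \<epsilon> i)" by simp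
  qed (auto simp: cell_def)
  also have "\<dots> \<longleftrightarrow> \<bar>fst x - \<epsilon> * of_int (fst i)\<bar> \<le> \<epsilon> / 2 \<and> \<bar>snd x - \<epsilon> * of_int (snd i)\<bar> \<le> \<epsilon> / 2"
    by (simp only: mem_Times_iff pt_def fst_diff snd_diff fst_conv snd_conv atLeastAtMost_iff, linarith)
  finally show ?thesis .
qed

lemma cell_eq_Times: "cell \<epsilon> (pt \<epsilon> i) =
    {\<epsilon> * of_int (fst i) - \<epsilon> / 2 .. \<epsilon> * of_int (fst i) + \<epsilon> / 2} \<times>
    {\<epsilon> * of_int (snd i) - \<epsilon> / 2 .. \<epsilon> * of_int (snd i) + \<epsilon> / 2}"
  by (rule set_eqI, simp only: mem_cell_pt mem_Times_iff atLeastAtMost_iff fst_conv snd_conv, linarith)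

lemma compact_cell: "compact (cell \<epsilon> (pt \<epsilon> i))"
  unfolding cell_eq_Times by (intro compact_Times compact_Icc)

lemma convex_cell: "convex (cell \<epsilon> (pt \<epsilon> i))"
  unfolding cell_eq_Times by (intro convex_Times convex_real_interval)

lemma compact_cells: "finite I \<Longrightarrow> compact (cells \<epsilon> I)"
  unfolding cells_def by (intro compact_UN compact_cell)

lemma finite_adj: "finite {j. adj i j}"
proof (rule finite_subset)
  show "{j. adj i j} \<subseteq> {fst i - 1..fst i + 1} \<times> {snd i - 1..snd i + 1}"
    by (auto simp: adj_def)
qed auto

lemma adj_iff: "adj i j \<longleftrightarrow> j \<in> {(fst i + 1, snd i), (fst i - 1, snd i), (fst i, snd i + 1), (fst i,
    snd i - 1)}"
  unfolding adj_def by (cases i; cases j) (simp, presburger)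

lemma adj_sym: "adj i j \<longleftrightarrow> adj j i"
  by (auto simp: adj_def abs_minus_commute)

lemma card_adj: "card {j. adj i j} = 4"
proof -
  have "{j. adj i j} = {(fst i + 1, snd i), (fst i - 1, snd i), (fst i, snd i + 1), (fst i, snd i - 1)}"
    using adj_iff by blast
  then show ?thesis by simp
qed

lemma finite_bdry: "finite I \<Longrightarrow> finite (bdry I)"
proof (rule finite_subset)
  show "bdry I \<subseteq> (SIGMA i:I. {j. adj i j})" by (auto simp: bdry_def)
qed (auto intro: finite_SigmaI finite_adj)

text \<open>The cells that contain a point near \<open>x\<close> contain \<open>x\<close> too. This is the one-dimensional
  version.\<close>

lemma integers_near:
  fixes u :: real
  obtains r where "0 < r" "\<And>v (a::int). \<bar>v - u\<bar> < r \<Longrightarrow> \<bar>v - of_int a\<bar> \<le> 1 / 2 \<Longrightarrow> \<bar>u - of_int a\<bar> \<le> 1 / 2"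
proof
  define p q where "p = \<lceil>u - 1/2\<rceil> - 1" and "q = \<lfloor>u + 1/2\<rfloor> + 1"
  define r where "r = min (u - 1/2 - of_int p) (of_int q - u - 1/2)"
  show "0 < r" unfolding r_def p_def q_def by linarith
  fix v and a :: int assume v: "\<bar>v - u\<bar> < r" "\<bar>v - of_int a\<bar> \<le> 1 / 2"
  show "\<bar>u - of_int a\<bar> \<le> 1 / 2"
  proof (rule ccontr)
    assume "\<not> \<bar>u - of_int a\<bar> \<le> 1 / 2"
    then consider "of_int a < u - 1/2" | "u + 1/2 < of_int a" by linarith
    then show False
    proof cases
      case 1
      then have "a \<le> p" unfolding p_def by linarith
      then have "real_of_int a \<le> of_int p" by simp
      then show False using v unfolding r_def by linarith
    next
      case 2
      then have "q \<le> a" unfolding q_def by linarith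
      then have "real_of_int q \<le> of_int a" by simp
      then show False using v unfolding r_def by linarith
    qed
  qed
qed

lemma mem_cell_scaled:
  assumes "0 < \<epsilon>"
  shows "x \<in> cell \<epsilon> (pt \<epsilon> i) \<longleftrightarrow>
    \<bar>fst x / \<epsilon> - of_int (fst i)\<bar> \<le> 1 / 2 \<and> \<bar>snd x / \<epsilon> - of_int (snd i)\<bar> \<le> 1 / 2"
proof -
  have "\<bar>u - \<epsilon> * a\<bar> \<le> \<epsilon> / 2 \<longleftrightarrow> \<bar>u / \<epsilon> - a\<bar> \<le> 1 / 2" for u a :: real
  proof -
    have "\<bar>u - \<epsilon> * a\<bar> = \<epsilon> * \<bar>u / \<epsilon> - a\<bar>"
      using assms by (simp add: abs_mult_pos' right_diff_distrib)
    then show ?thesis using assms by (simp add: field_simps)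
  qed
  then show ?thesis by (simp add: mem_cell_pt)
qed

lemma frontier_cells:
  assumes e: "0 < \<epsilon>" and fin: "finite I"
  shows "frontier (cells \<epsilon> I) = (\<Union>(i, j)\<in>bdry I. cell \<epsilon> (pt \<epsilon> i) \<inter> cell \<epsilon> (pt \<epsilon> j))"
proof -
  have cl: "closed (cells \<epsilon> I)" using compact_cells[OF fin] compact_imp_closed by blast
  have front: "frontier (cells \<epsilon> I) = cells \<epsilon> I - interior (cells \<epsilon> I)"
    using cl by (simp add: frontier_def closure_closed)
  show ?thesis
  proof (intro equalityI subsetI)
    fix x assume x: "x \<in> frontier (cells \<epsilon> I)"
    then have "x \<in> cells \<epsilon> I" by (simp add: front)
    then obtain i where i: "i \<in> I" "x \<in> cell \<epsilon> (pt \<epsilon> i)" unfolding cells_def by blast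
    have "\<exists>j. j \<notin> I \<and> x \<in> cell \<epsilon> (pt \<epsilon> j)"
    proof (rule ccontr)
      assume "\<not> ?thesis"
      then have all: "\<And>j. x \<in> cell \<epsilon> (pt \<epsilon> j) \<Longrightarrow> j \<in> I" by blast
      obtain r1 where r1: "0 < r1" "\<And>v (a::int). \<bar>v - fst x / \<epsilon>\<bar> < r1 \<Longrightarrow> \<bar>v - of_int a\<bar> \<le> 1 / 2 \<Longrightarrow>
          \<bar>fst x / \<epsilon> - of_int a\<bar> \<le> 1 / 2"
        using integers_near by blast
      obtain r2 where r2: "0 < r2" "\<And>v (a::int). \<bar>v - snd x / \<epsilon>\<bar> < r2 \<Longrightarrow> \<bar>v - of_int a\<bar> \<le> 1 / 2 \<Longrightarrow>
          \<bar>snd x / \<epsilon> - of_int a\<bar> \<le> 1 / 2"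
        using integers_near by blast
      define r where "r = \<epsilon> * min r1 r2"
      have "ball x r \<subseteq> cells \<epsilon> I"
      proof
        fix y assume "y \<in> ball x r"
        then have "dist (fst y) (fst x) < r" "dist (snd y) (snd x) < r"
          using dist_fst_le[of y x] dist_snd_le[of y x] by (auto simp: dist_commute)
        then have "\<bar>fst y - fst x\<bar> / \<epsilon> < min r1 r2" "\<bar>snd y - snd x\<bar> / \<epsilon> < min r1 r2"
          unfolding r_def dist_real_def using e by (simp_all only: pos_divide_less_eq mult.commute)
        then have y: "\<bar>fst y / \<epsilon> - fst x / \<epsilon>\<bar> < r1" "\<bar>snd y / \<epsilon> - snd x / \<epsilon>\<bar> < r2"
          using e by (simp_all add: abs_divide flip: diff_divide_distrib)
        define j where "j = (round (fst y / \<epsilon>), round (snd y / \<epsilon>))"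
        have j: "\<bar>fst y / \<epsilon> - of_int (fst j)\<bar> \<le> 1 / 2" "\<bar>snd y / \<epsilon> - of_int (snd j)\<bar> \<le> 1 / 2"
          using of_int_round_abs_le[of "fst y / \<epsilon>"] of_int_round_abs_le[of "snd y / \<epsilon>"]
          unfolding j_def by (simp_all add: abs_minus_commute)
        have "x \<in> cell \<epsilon> (pt \<epsilon> j)"
          using r1(2)[OF y(1) j(1)] r2(2)[OF y(2) j(2)] by (simp add: mem_cell_scaled[OF e])
        then have "j \<in> I" by (rule all)
        moreover have "y \<in> cell \<epsilon> (pt \<epsilon> j)" using j by (simp add: mem_cell_scaled[OF e])
        ultimately show "y \<in> cells \<epsilon> I" by (auto simp: cells_def)
      qed
      moreover have "0 < r" using e r1 r2 by (simp add: r_def)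
      ultimately have "x \<in> interior (cells \<epsilon> I)" by (auto simp: mem_interior)
      then show False using x by (simp add: front)
    qed
    then obtain j where j: "j \<notin> I" "x \<in> cell \<epsilon> (pt \<epsilon> j)" by blast
    \<comment> \<open>if \<open>i\<close> and \<open>j\<close> meet in a corner only, the cell \<open>l\<close>, which contains \<open>x\<close> too, is adjacent
        to both\<close>
    have "\<bar>fst i - fst j\<bar> \<le> 1" "\<bar>snd i - snd j\<bar> \<le> 1"
      using i(2) j(2) unfolding mem_cell_scaled[OF e] by linarith+
    define l where "l = (fst i, snd j)"
    have l: "x \<in> cell \<epsilon> (pt \<epsilon> l)" using i(2) j(2) by (simp add: mem_cell_pt l_def)
    show "x \<in> (\<Union>(i, j)\<in>bdry I. cell \<epsilon> (pt \<epsilon> i) \<inter> cell \<epsilon> (pt \<epsilon> j))"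
    proof (cases "l \<in> I")
      case True
      then have "l \<noteq> j" using j by blast
      then have "adj l j" using \<open>\<bar>fst i - fst j\<bar> \<le> 1\<close> by (auto simp: l_def adj_def prod_eq_iff)
      then have "(l, j) \<in> bdry I" using True j by (simp add: bdry_def)
      then show ?thesis using j l by blast
    next
      case False
      then have "l \<noteq> i" using i by blast
      then have "adj i l" using \<open>\<bar>snd i - snd j\<bar> \<le> 1\<close> by (auto simp: l_def adj_def prod_eq_iff)
      then have "(i, l) \<in> bdry I" using False i by (simp add: bdry_def)
      then show ?thesis using i l by blast
    qed
  next
    fix x assume "x \<in> (\<Union>(i, j)\<in>bdry I. cell \<epsilon> (pt \<epsilon> i) \<inter> cell \<epsilon> (pt \<epsilon> j))"
    then obtain i j where ij: "i \<in> I" "j \<notin> I" "x \<in> cell \<epsilon> (pt \<epsilon> i)" "x \<in> cell \<epsilon> (pt \<epsilon> j)"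
      by (auto simp: bdry_def)
    have "x \<notin> interior (cells \<epsilon> I)"
    proof
      assume "x \<in> interior (cells \<epsilon> I)"
      then obtain r where r: "0 < r" "ball x r \<subseteq> cells \<epsilon> I" by (auto simp: mem_interior)
      define D where "D = norm (pt \<epsilon> j - x) + 1"
      have D: "0 < D" "norm (pt \<epsilon> j - x) < D" by (auto simp: D_def add_nonneg_pos)
      define s where "s = min 1 (r / D)"
      have s: "0 < s" "s \<le> 1" using r D by (auto simp: s_def)
      define y where "y = x + s *\<^sub>R (pt \<epsilon> j - x)"
      have "norm (s *\<^sub>R (pt \<epsilon> j - x)) < r"
      proof -
        have "s * norm (pt \<epsilon> j - x) < s * D" using s D by simp
        also have "\<dots> \<le> r" using D by (simp add: s_def min_def field_simps)
        finally show ?thesis using s by simp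
      qed
      then have "y \<in> ball x r" by (simp add: y_def dist_norm)
      then obtain l where l: "l \<in> I" "y \<in> cell \<epsilon> (pt \<epsilon> l)" using r by (auto simp: cells_def)
      have "fst y / \<epsilon> - of_int (fst j) = (1 - s) * (fst x / \<epsilon> - of_int (fst j))"
        "snd y / \<epsilon> - of_int (snd j) = (1 - s) * (snd x / \<epsilon> - of_int (snd j))"
        using e by (auto simp: y_def pt_def field_simps)
      then have "\<bar>fst y / \<epsilon> - of_int (fst j)\<bar> = (1 - s) * \<bar>fst x / \<epsilon> - of_int (fst j)\<bar>"
        "\<bar>snd y / \<epsilon> - of_int (snd j)\<bar> = (1 - s) * \<bar>snd x / \<epsilon> - of_int (snd j)\<bar>"
        using s by (simp_all add: abs_mult)
      moreover have "(1 - s) * \<bar>fst x / \<epsilon> - of_int (fst j)\<bar> \<le> (1 - s) * (1 / 2)"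
          "(1 - s) * \<bar>snd x / \<epsilon> - of_int (snd j)\<bar> \<le> (1 - s) * (1 / 2)"
        using s ij(4) by (intro mult_left_mono; simp add: mem_cell_scaled[OF e])+
      ultimately have "\<bar>fst y / \<epsilon> - of_int (fst j)\<bar> < 1 / 2" "\<bar>snd y / \<epsilon> - of_int (snd j)\<bar> < 1 / 2"
        using s by auto
      then have "fst l = fst j" "snd l = snd j"
        using l(2) unfolding mem_cell_scaled[OF e] by linarith+
      then show False using l(1) ij(2) by (metis prod_eqI)
    qed
    moreover have "x \<in> cells \<epsilon> I" using ij(1,3) unfolding cells_def by blast
    ultimately show "x \<in> frontier (cells \<epsilon> I)" by (simp add: front)
  qed
qed

lemma dist_edge_pt:
  assumes "adj (fst e) (snd e)"
  shows "dist (edge_pt \<epsilon> e s) (edge_pt \<epsilon> e t) = \<bar>s - t\<bar>"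
proof -
  have "(\<bar>snd (fst e) - snd (snd e)\<bar> = 1 \<and> \<bar>fst (fst e) - fst (snd e)\<bar> = 0) \<or>
        (\<bar>snd (fst e) - snd (snd e)\<bar> = 0 \<and> \<bar>fst (fst e) - fst (snd e)\<bar> = 1)"
    using assms unfolding adj_def by linarith
  then show ?thesis
    by (elim disjE conjE) (simp_all only: edge_pt_def dist_Pair_Pair of_int_1 of_int_0
        mult_zero_right mult_1_right
      add_0_right dist_self dist_add_cancel, simp_all add: dist_real_def)
qed

lemma edge_pt_simps:
  "edge_pt \<epsilon> ((a, b), (a + 1, b)) s = (\<epsilon> * of_int a + \<epsilon> / 2, \<epsilon> * of_int b + s)"
  "edge_pt \<epsilon> ((a, b), (a - 1, b)) s = (\<epsilon> * of_int a - \<epsilon> / 2, \<epsilon> * of_int b + s)"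
  "edge_pt \<epsilon> ((a, b), (a, b + 1)) s = (\<epsilon> * of_int a + s, \<epsilon> * of_int b + \<epsilon> / 2)"
  "edge_pt \<epsilon> ((a, b), (a, b - 1)) s = (\<epsilon> * of_int a + s, \<epsilon> * of_int b - \<epsilon> / 2)"
  by (simp_all add: edge_pt_def algebra_simps)

lemma edge_pt_image:
  fixes \<epsilon> :: real
  assumes e: "0 < \<epsilon>" and ij: "adj i j"
  shows "cell \<epsilon> (pt \<epsilon> i) \<inter> cell \<epsilon> (pt \<epsilon> j) = edge_pt \<epsilon> (i, j) ` {-\<epsilon>/2..\<epsilon>/2}"
proof (rule set_eqI)
  fix x
  obtain a b where i: "i = (a, b)" by (cases i)
  obtain u v :: real where x: "x = (u, v)" by (cases x)
  define k l where "k = \<epsilon> * of_int a" and "l = \<epsilon> * of_int b"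
  have kl: "\<epsilon> * of_int (a + 1) = k + \<epsilon>" "\<epsilon> * of_int (a - 1) = k - \<epsilon>"
      "\<epsilon> * of_int (b + 1) = l + \<epsilon>" "\<epsilon> * of_int (b - 1) = l - \<epsilon>"
    by (simp_all add: k_def l_def algebra_simps)
  have horiz: "(u, v) \<in> (\<lambda>s. (c, l + s)) ` {-\<epsilon>/2..\<epsilon>/2} \<longleftrightarrow> u = c \<and> \<bar>v - l\<bar> \<le> \<epsilon> / 2" for c :: real
  proof
    assume "u = c \<and> \<bar>v - l\<bar> \<le> \<epsilon> / 2"
    then show "(u, v) \<in> (\<lambda>s. (c, l + s)) ` {-\<epsilon>/2..\<epsilon>/2}"
      by (intro image_eqI[of _ _ "v - l"]) (simp, simp only: atLeastAtMost_iff, linarith)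
  qed (clarsimp, linarith)
  have vert: "(u, v) \<in> (\<lambda>s. (k + s, c)) ` {-\<epsilon>/2..\<epsilon>/2} \<longleftrightarrow> v = c \<and> \<bar>u - k\<bar> \<le> \<epsilon> / 2" for c :: real
  proof
    assume "v = c \<and> \<bar>u - k\<bar> \<le> \<epsilon> / 2"
    then show "(u, v) \<in> (\<lambda>s. (k + s, c)) ` {-\<epsilon>/2..\<epsilon>/2}"
      by (intro image_eqI[of _ _ "u - k"]) (simp, simp only: atLeastAtMost_iff, linarith)
  qed (clarsimp, linarith)
  consider "j = (a + 1, b)" | "j = (a - 1, b)" | "j = (a, b + 1)" | "j = (a, b - 1)"
    using ij unfolding adj_iff i by auto
  then show "x \<in> cell \<epsilon> (pt \<epsilon> i) \<inter> cell \<epsilon> (pt \<epsilon> j) \<longleftrightarrow> x \<in> edge_pt \<epsilon> (i, j) ` {-\<epsilon>/2..\<epsilon>/2}"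
  proof cases
    case 1
    show ?thesis
      unfolding x Int_iff mem_cell_pt 1 i edge_pt_simps fst_conv snd_conv kl horiz[unfolded l_def]
      unfolding k_def[symmetric] l_def[symmetric] using e by linarith
  next
    case 2
    show ?thesis
      unfolding x Int_iff mem_cell_pt 2 i edge_pt_simps fst_conv snd_conv kl horiz[unfolded l_def]
      unfolding k_def[symmetric] l_def[symmetric] using e by linarith
  next
    case 3
    show ?thesis
      unfolding x Int_iff mem_cell_pt 3 i edge_pt_simps fst_conv snd_conv kl vert[unfolded k_def]
      unfolding k_def[symmetric] l_def[symmetric] using e by linarith
  next
    case 4
    show ?thesis
      unfolding x Int_iff mem_cell_pt 4 i edge_pt_simps fst_conv snd_conv kl vert[unfolded k_def]
      unfolding k_def[symmetric] l_def[symmetric] using e by linarith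
  qed
qed

text \<open>Two distinct sides of the same direction have distinct midpoints. In coordinates divided
  by \<open>\<epsilon> / 2\<close>, the midpoint of a side is the sum of its two indices, and distinct midpoints
  differ by at least 2.\<close>

lemma same_axis_edges:
  fixes a b c d a' b' c' d' :: int
  assumes "\<bar>a - c\<bar> = 1" "b = d" "\<bar>a' - c'\<bar> = 1" "b' = d'"
    and "\<not> (a = c' \<and> b = d' \<and> c = a' \<and> d = b')" "\<not> (a = a' \<and> b = b' \<and> c = c' \<and> d = d')"
  shows "2 \<le> \<bar>a + c - (a' + c')\<bar> \<or> 2 \<le> \<bar>b + d - (b' + d')\<bar>"
proof (cases "b = b'")
  case True
  have "c = a + 1 \<or> c = a - 1" "c' = a' + 1 \<or> c' = a' - 1" using assms(1,3) by linarith+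
  then show ?thesis
  proof (elim disjE)
    assume c: "c = a + 1" "c' = a' + 1"
    then have "a \<noteq> a'" using assms True by auto
    then show ?thesis unfolding c by linarith
  next
    assume c: "c = a + 1" "c' = a' - 1"
    then have "a + 1 \<noteq> a'" using assms True by auto
    then show ?thesis unfolding c by linarith
  next
    assume c: "c = a - 1" "c' = a' + 1"
    then have "a \<noteq> a' + 1" using assms True by auto
    then show ?thesis unfolding c by linarith
  next
    assume c: "c = a - 1" "c' = a' - 1"
    then have "a \<noteq> a'" using assms True by auto
    then show ?thesis unfolding c by linarith
  qed
next
  case False
  then show ?thesis unfolding assms(2)[symmetric] assms(4)[symmetric] by linarith
qed

text \<open>Distinct sides, shortened by \<open>h\<close> at both ends, have distance at least \<open>h\<close>.\<close>

lemma edge_pt_separated: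
  fixes \<epsilon> h s t :: real
  assumes e: "0 < \<epsilon>" and h: "0 < h" "h \<le> \<epsilon> / 2"
    and ij: "e \<in> bdry I" and ij': "e' \<in> bdry I" and ne: "e \<noteq> e'"
    and s: "\<bar>s\<bar> \<le> \<epsilon> / 2 - h" "\<bar>t\<bar> \<le> \<epsilon> / 2 - h"
  shows "h \<le> dist (edge_pt \<epsilon> e s) (edge_pt \<epsilon> e' t)"
proof -
  obtain a b c d where e1: "e = ((a, b), (c, d))" by (metis prod.exhaust)
  obtain a' b' c' d' where e2: "e' = ((a', b'), (c', d'))" by (metis prod.exhaust)
  have A: "\<bar>a - c\<bar> + \<bar>b - d\<bar> = 1" "\<bar>a' - c'\<bar> + \<bar>b' - d'\<bar> = 1" "\<not> (a = c' \<and> b = d' \<and> c = a' \<and> d = b')"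
    using ij ij' by (auto simp: e1 e2 bdry_def adj_def)
  have B: "\<not> (a = a' \<and> b = b' \<and> c = c' \<and> d = d')" using ne by (simp add: e1 e2)
  define M1 M2 where "M1 = a + c - (a' + c')" and "M2 = b + d - (b' + d')"
  have f: "fst (edge_pt \<epsilon> e s) - fst (edge_pt \<epsilon> e' t)
      = \<epsilon> / 2 * of_int M1 + (s * of_int \<bar>b - d\<bar> - t * of_int \<bar>b' - d'\<bar>)"
    "snd (edge_pt \<epsilon> e s) - snd (edge_pt \<epsilon> e' t)
      = \<epsilon> / 2 * of_int M2 + (s * of_int \<bar>a - c\<bar> - t * of_int \<bar>a' - c'\<bar>)"
    by (simp_all add: e1 e2 edge_pt_def M1_def M2_def algebra_simps)
  have big: "k * (\<epsilon> / 2) \<le> \<bar>\<epsilon> / 2 * of_int M\<bar>" if "k \<le> \<bar>of_int M\<bar>" for k and M :: int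
    using that e by (simp add: abs_mult)
  have st: "\<bar>s - t\<bar> \<le> \<epsilon> - 2 * h" using s by linarith
  have "h \<le> \<bar>fst (edge_pt \<epsilon> e s) - fst (edge_pt \<epsilon> e' t)\<bar> \<or> h \<le> \<bar>snd (edge_pt \<epsilon> e s) - snd (edge_pt
      \<epsilon> e' t)\<bar>"
  proof -
    consider "\<bar>a - c\<bar> = 1" "b = d" "\<bar>a' - c'\<bar> = 1" "b' = d'" | "a = c" "\<bar>b - d\<bar> = 1" "a' = c'"
        "\<bar>b' - d'\<bar> = 1"
      | "\<bar>a - c\<bar> = 1" "b = d" "a' = c'" "\<bar>b' - d'\<bar> = 1" | "a = c" "\<bar>b - d\<bar> = 1" "\<bar>a' - c'\<bar> = 1"
          "b' = d'"
    proof -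
      have "(\<bar>a - c\<bar> = 1 \<and> b = d) \<or> (a = c \<and> \<bar>b - d\<bar> = 1)" using A(1) by linarith
      moreover have "(\<bar>a' - c'\<bar> = 1 \<and> b' = d') \<or> (a' = c' \<and> \<bar>b' - d'\<bar> = 1)" using A(2) by linarith
      ultimately show thesis using that by blast
    qed
    then show ?thesis
    proof cases
      case 1
      have "2 \<le> \<bar>M1\<bar> \<or> 2 \<le> \<bar>M2\<bar>"
        unfolding M1_def M2_def using same_axis_edges[OF 1 A(3) B] .
      then have "2 \<le> \<bar>real_of_int M1\<bar> \<or> 2 \<le> \<bar>real_of_int M2\<bar>" by linarith
      then show ?thesis using big[of 2 M1] big[of 2 M2] 1 st h unfolding f by auto
    next
      case 2
      have "2 \<le> \<bar>M1\<bar> \<or> 2 \<le> \<bar>M2\<bar>"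
        unfolding M1_def M2_def using same_axis_edges[of b d a c b' d' a' c'] 2 A(3) B by blast
      then have "2 \<le> \<bar>real_of_int M1\<bar> \<or> 2 \<le> \<bar>real_of_int M2\<bar>" by linarith
      then show ?thesis using big[of 2 M1] big[of 2 M2] 2 st h unfolding f by auto
    next
      case 3
      have "c = a + 1 \<or> c = a - 1" using 3 by linarith
      then have "1 \<le> \<bar>M1\<bar>" using 3(3) unfolding M1_def by (elim disjE; presburger)
      then have "1 \<le> \<bar>real_of_int M1\<bar>" by linarith
      then show ?thesis using big[of 1 M1] 3 s h unfolding f by auto
    next
      case 4
      have "c' = a' + 1 \<or> c' = a' - 1" using 4 by linarith
      then have "1 \<le> \<bar>M1\<bar>" using 4(1) unfolding M1_def by (elim disjE; presburger)
      then have "1 \<le> \<bar>real_of_int M1\<bar>" by linarith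
      then show ?thesis using big[of 1 M1] 4 s h unfolding f by auto
    qed
  qed
  then show ?thesis
    using dist_fst_le[of "edge_pt \<epsilon> e s" "edge_pt \<epsilon> e' t"] dist_snd_le[of "edge_pt \<epsilon> e s" "edge_pt
        \<epsilon> e' t"]
    unfolding dist_real_def by linarith
qed

lemma hausdorff_pre1_le_sum:
  assumes "finite T" "A \<subseteq> (\<Union>t\<in>T. U t)" "0 \<le> \<delta>"
    and "\<And>t. t \<in> T \<Longrightarrow> bounded (U t) \<and> diameter (U t) \<le> \<delta>"
  shows "hausdorff_pre1 \<delta> A \<le> (\<Sum>t\<in>T. ennreal (diameter (U t)))"
proof -
  obtain h where h: "bij_betw h {0..<card T} T" using ex_bij_betw_nat_finite[OF assms(1)] by blast
  define V where "V n = (if n < card T then U (h n) else {})" for n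
  have hT: "h n \<in> T" if "n < card T" for n using bij_betwE[OF h] that by simp
  have cov: "A \<subseteq> (\<Union>n. V n)"
  proof
    fix x assume "x \<in> A"
    then obtain t where t: "t \<in> T" "x \<in> U t" using assms(2) by blast
    then obtain n where "n < card T" "t = h n"
      using bij_betw_imp_surj_on[OF h] by (metis atLeastLessThan_iff imageE)
    then show "x \<in> (\<Union>n. V n)" using t by (auto simp: V_def)
  qed
  have "hausdorff_pre1 \<delta> A \<le> (\<Sum>n. ennreal (diameter (V n)))"
    unfolding hausdorff_pre1_def
    by (rule INF_lower) (use cov assms(3,4) hT in \<open>auto simp: V_def diameter_empty\<close>)
  also have "\<dots> = (\<Sum>n\<in>{0..<card T}. ennreal (diameter (V n)))"
    by (rule suminf_finite) (auto simp: V_def diameter_empty)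
  also have "\<dots> = (\<Sum>n\<in>{0..<card T}. ennreal (diameter (U (h n))))"
    by (rule sum.cong) (auto simp: V_def)
  also have "\<dots> = (\<Sum>t\<in>T. ennreal (diameter (U t)))"
    by (rule sum.reindex_bij_betw[OF h])
  finally show ?thesis .
qed

lemma hausdorff_pre1_frontier_cells_le:
  assumes e: "0 < \<epsilon>" and fin: "finite I" and d: "0 < \<delta>"
  shows "hausdorff_pre1 \<delta> (frontier (cells \<epsilon> I)) \<le> ennreal (\<epsilon> * card (bdry I))"
proof -
  obtain m :: nat where m: "\<epsilon> / \<delta> < m" using reals_Archimedean2 by blast
  have m0: "0 < real m" using m e d by (meson divide_pos_pos less_trans)
  then have md: "\<epsilon> / m \<le> \<delta>" using m d by (simp add: field_simps)
  define U where "U = (\<lambda>(e, k::nat). edge_pt \<epsilon> e ` {-\<epsilon>/2 + \<epsilon> / m * k .. -\<epsilon>/2 + \<epsilon> / m * (k + 1)})"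
  have U: "bounded (U t) \<and> diameter (U t) \<le> \<epsilon> / m" if t: "t \<in> bdry I \<times> {..<m}" for t
  proof -
    obtain e k where t_eq: "t = (e, k)" and e_in: "e \<in> bdry I" using t by auto
    have le: "dist x y \<le> \<epsilon> / m" if xy: "x \<in> U t" "y \<in> U t" for x y
    proof -
      obtain s s' where *: "x = edge_pt \<epsilon> e s" "y = edge_pt \<epsilon> e s'"
        "s \<in> {-\<epsilon>/2 + \<epsilon> / m * k .. -\<epsilon>/2 + \<epsilon> / m * (k + 1)}"
        "s' \<in> {-\<epsilon>/2 + \<epsilon> / m * k .. -\<epsilon>/2 + \<epsilon> / m * (k + 1)}"
        using xy unfolding U_def t_eq prod.case of_nat_add of_nat_1 by blast
      have "dist x y = \<bar>s - s'\<bar>" unfolding * by (rule dist_edge_pt) (use e_in in \<open>auto simp: bdry_def\<close>)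
      also have "\<dots> \<le> \<epsilon> / m" using *(3,4) by (simp add: distrib_left abs_le_iff)
      finally show ?thesis .
    qed
    have "diameter (U t) \<le> \<epsilon> / m"
      using le m0 e by (intro diameter_le) (auto simp: dist_norm)
    moreover have "bounded (U t)"
      unfolding bounded_two_points using le by blast
    ultimately show ?thesis by simp
  qed
  have cov: "frontier (cells \<epsilon> I) \<subseteq> (\<Union>t\<in>bdry I \<times> {..<m}. U t)"
  proof
    fix x assume "x \<in> frontier (cells \<epsilon> I)"
    then obtain i j where ij: "(i, j) \<in> bdry I" "x \<in> cell \<epsilon> (pt \<epsilon> i) \<inter> cell \<epsilon> (pt \<epsilon> j)"
      using frontier_cells[OF e fin] by auto
    then obtain s where s: "s \<in> {-\<epsilon>/2..\<epsilon>/2}" "x = edge_pt \<epsilon> (i, j) s"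
      using edge_pt_image[OF e, of i j] by (auto simp: bdry_def)
    define w where "w = (s + \<epsilon> / 2) * m / \<epsilon>"
    have "0 \<le> (s + \<epsilon> / 2) * m" "(s + \<epsilon> / 2) * m \<le> \<epsilon> * m"
      using s m0 by (auto intro!: mult_nonneg_nonneg mult_right_mono)
    then have w: "0 \<le> w" "w \<le> m" using e by (auto simp: w_def divide_le_eq mult.commute)
    have s_eq: "s = -\<epsilon>/2 + \<epsilon> / m * w" using m0 e by (simp add: w_def field_simps)
    have "\<exists>k<m. real k \<le> w \<and> w \<le> k + 1"
    proof (cases "w = m")
      case True
      then show ?thesis using m0 by (intro exI[of _ "m - 1"]) (auto simp: of_nat_diff)
    next
      case False
      then show ?thesis using w by (intro exI[of _ "nat \<lfloor>w\<rfloor>"]) (auto, linarith+)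
    qed
    then obtain k where k: "k < m" "real k \<le> w" "w \<le> k + 1" by blast
    have "\<epsilon> / m * k \<le> \<epsilon> / m * w" "\<epsilon> / m * w \<le> \<epsilon> / m * (k + 1)"
      using k e m0 by (intro mult_left_mono; simp)+
    then have "s \<in> {-\<epsilon>/2 + \<epsilon> / m * k .. -\<epsilon>/2 + \<epsilon> / m * (k + 1)}"
      unfolding s_eq atLeastAtMost_iff by linarith
    then have "x \<in> U ((i, j), k)" unfolding U_def s(2) prod.case of_nat_add of_nat_1 by (rule imageI)
    then show "x \<in> (\<Union>t\<in>bdry I \<times> {..<m}. U t)" using ij k by auto
  qed
  have "hausdorff_pre1 \<delta> (frontier (cells \<epsilon> I)) \<le> (\<Sum>t\<in>bdry I \<times> {..<m}. ennreal (diameter (U t)))"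
  proof (rule hausdorff_pre1_le_sum[OF _ cov])
    show "finite (bdry I \<times> {..<m})" using finite_bdry[OF fin] by simp
    show "bounded (U t) \<and> diameter (U t) \<le> \<delta>" if "t \<in> bdry I \<times> {..<m}" for t
      using U[OF that] md by auto
  qed (use d in simp)
  also have "\<dots> \<le> (\<Sum>t\<in>bdry I \<times> {..<m}. ennreal (\<epsilon> / m))"
    by (intro sum_mono ennreal_leI) (use U in blast)
  also have "\<dots> = ennreal (\<epsilon> * card (bdry I))"
    using m0 e by (simp add: card_cartesian_product ennreal_of_nat_eq_real_of_nat flip: ennreal_mult)
  finally show ?thesis .
qed

lemma emeasure_le_of_dist_le:
  fixes S :: "real set"
  assumes "\<And>s t. s \<in> S \<Longrightarrow> t \<in> S \<Longrightarrow> \<bar>s - t\<bar> \<le> D" "0 \<le> D" "bounded S"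
  shows "emeasure lborel S \<le> ennreal D"
proof (cases "S = {}")
  case False
  have bb: "bdd_below S" using assms(3) by (rule bounded_imp_bdd_below)
  have "S \<subseteq> {Inf S .. Inf S + D}"
  proof
    fix s assume s: "s \<in> S"
    have "s - D \<le> Inf S"
      using False assms(1)[OF s] by (intro cInf_greatest) (auto simp: abs_le_iff algebra_simps)
    then show "s \<in> {Inf S .. Inf S + D}" using s bb by (auto simp: cInf_lower)
  qed
  then have "emeasure lborel S \<le> emeasure lborel {Inf S .. Inf S + D}"
    by (intro emeasure_mono) auto
  then show ?thesis using assms(2) by simp
qed simp

text \<open>A set of diameter at most \<open>h / 2\<close> meets at most one of the shortened sides, in a set of
  length at most its diameter. Summing over a cover gives the total length of the shortened
  sides.\<close>

lemma hausdorff_pre1_frontier_cells_ge: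
  fixes \<epsilon> h :: real
  assumes e: "0 < \<epsilon>" and fin: "finite I" and h: "0 < h" "h \<le> \<epsilon> / 2"
  shows "ennreal ((\<epsilon> - 2 * h) * card (bdry I)) \<le> hausdorff_pre1 (h / 2) (frontier (cells \<epsilon> I))"
  unfolding hausdorff_pre1_def
proof (rule INF_greatest, clarify)
  fix V :: "nat \<Rightarrow> plane set"
  assume cov: "frontier (cells \<epsilon> I) \<subseteq> (\<Union>n. V n)"
    and V: "\<forall>n. bounded (V n) \<and> diameter (V n) \<le> h / 2"
  define S where "S x n = {s. \<bar>s\<bar> \<le> \<epsilon> / 2 - h \<and> edge_pt \<epsilon> x s \<in> closure (V n)}" for x n
  have S_borel: "S x n \<in> sets borel" for x n
  proof -
    have "continuous_on UNIV (edge_pt \<epsilon> x)"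
      unfolding edge_pt_def by (intro continuous_intros)
    then have "closed (edge_pt \<epsilon> x -` closure (V n))"
      by (intro closed_vimage) auto
    moreover have "closed {s::real. \<bar>s\<bar> \<le> \<epsilon> / 2 - h}"
      by (intro closed_Collect_le continuous_intros)
    ultimately have "closed ({s. \<bar>s\<bar> \<le> \<epsilon> / 2 - h} \<inter> edge_pt \<epsilon> x -` closure (V n))"
      by (intro closed_Int)
    moreover have "S x n = {s. \<bar>s\<bar> \<le> \<epsilon> / 2 - h} \<inter> edge_pt \<epsilon> x -` closure (V n)"
      by (auto simp: S_def)
    ultimately show ?thesis by simp
  qed
  have lower: "ennreal (\<epsilon> - 2 * h) \<le> (\<Sum>n. emeasure lborel (S x n))" if x: "x \<in> bdry I" for x
  proof -
    have "{-(\<epsilon> / 2 - h)..\<epsilon> / 2 - h} \<subseteq> (\<Union>n. S x n)"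
    proof
      fix s assume s: "s \<in> {-(\<epsilon> / 2 - h)..\<epsilon> / 2 - h}"
      obtain i j where ij: "x = (i, j)" "adj i j" using x by (auto simp: bdry_def)
      have "edge_pt \<epsilon> x s \<in> frontier (cells \<epsilon> I)"
        unfolding frontier_cells[OF e fin] using x s h edge_pt_image[OF e ij(2)] by (auto simp:
            ij(1) intro!: bexI[of _ "(i,j)"])
      then obtain n where "edge_pt \<epsilon> x s \<in> V n" using cov by blast
      then show "s \<in> (\<Union>n. S x n)" using s closure_subset[of "V n"] by (auto simp: S_def abs_le_iff)
    qed
    then have "emeasure lborel {-(\<epsilon> / 2 - h)..\<epsilon> / 2 - h} \<le> emeasure lborel (\<Union>n. S x n)"
      using S_borel[of x] by (intro emeasure_mono) auto
    also have "\<dots> \<le> (\<Sum>n. emeasure lborel (S x n))"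
      using S_borel[of x] by (intro emeasure_subadditive_countably) auto
    finally show ?thesis using h by (simp add: algebra_simps)
  qed
  have upper: "(\<Sum>x\<in>bdry I. emeasure lborel (S x n)) \<le> ennreal (diameter (V n))" for n
  proof (cases "\<forall>x\<in>bdry I. S x n = {}")
    case True
    then show ?thesis by simp
  next
    case False
    then obtain x where x: "x \<in> bdry I" "S x n \<noteq> {}" by blast
    have dist_le: "dist p q \<le> diameter (V n)" if "p \<in> closure (V n)" "q \<in> closure (V n)" for p q
      using diameter_bounded_bound[of "closure (V n)" p q] that V diameter_closure[of "V n"] by auto
    have other: "S y n = {}" if y: "y \<in> bdry I" "y \<noteq> x" for y
    proof (rule ccontr)
      assume "S y n \<noteq> {}"
      then obtain s t where st: "s \<in> S x n" "t \<in> S y n" using x by blast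
      have "h \<le> dist (edge_pt \<epsilon> x s) (edge_pt \<epsilon> y t)"
        by (rule edge_pt_separated[OF e h x(1) y(1)]) (use st y in \<open>auto simp: S_def\<close>)
      also have "\<dots> \<le> diameter (V n)" using st by (intro dist_le) (auto simp: S_def)
      also have "\<dots> \<le> h / 2" using V by blast
      finally show False using h by simp
    qed
    have "(\<Sum>y\<in>bdry I. emeasure lborel (S y n)) = (\<Sum>y\<in>{x}. emeasure lborel (S y n))"
      using x other finite_bdry[OF fin] by (intro sum.mono_neutral_right) auto
    also have "\<dots> = emeasure lborel (S x n)" by simp
    also have "\<dots> \<le> ennreal (diameter (V n))"
    proof (rule emeasure_le_of_dist_le)
      fix s t assume "s \<in> S x n" "t \<in> S x n"
      moreover have "dist (edge_pt \<epsilon> x s) (edge_pt \<epsilon> x t) = \<bar>s - t\<bar>"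
        by (rule dist_edge_pt) (use x in \<open>auto simp: bdry_def\<close>)
      ultimately show "\<bar>s - t\<bar> \<le> diameter (V n)"
        using dist_le[of "edge_pt \<epsilon> x s" "edge_pt \<epsilon> x t"] by (simp add: S_def)
    next
      show "0 \<le> diameter (V n)" using V by (simp add: diameter_ge_0)
      show "bounded (S x n)"
        by (rule bounded_subset[of "{-(\<epsilon> / 2 - h)..\<epsilon> / 2 - h}"]) (auto simp: S_def)
    qed
    finally show ?thesis .
  qed
  have "ennreal ((\<epsilon> - 2 * h) * card (bdry I)) = (\<Sum>x\<in>bdry I. ennreal (\<epsilon> - 2 * h))"
    using h by (simp add: ennreal_mult ennreal_of_nat_eq_real_of_nat mult.commute)
  also have "\<dots> \<le> (\<Sum>x\<in>bdry I. \<Sum>n. emeasure lborel (S x n))"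
    by (rule sum_mono[OF lower])
  also have "\<dots> = (\<Sum>n. \<Sum>x\<in>bdry I. emeasure lborel (S x n))"
    by (rule suminf_sum[symmetric]) simp
  also have "\<dots> \<le> (\<Sum>n. ennreal (diameter (V n)))"
    by (rule suminf_le) (use upper in auto)
  finally show "ennreal ((\<epsilon> - 2 * h) * card (bdry I)) \<le> (\<Sum>n. ennreal (diameter (V n)))" .
qed

lemma hausdorff_measure1_frontier_cells:
  assumes e: "0 < \<epsilon>" and fin: "finite I"
  shows "hausdorff_measure1 (frontier (cells \<epsilon> I)) = ennreal (\<epsilon> * card (bdry I))"
proof (rule antisym)
  show "hausdorff_measure1 (frontier (cells \<epsilon> I)) \<le> ennreal (\<epsilon> * card (bdry I))"
    unfolding hausdorff_measure1_def
    by (rule SUP_least) (use hausdorff_pre1_frontier_cells_le[OF e fin] in auto)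
  have le: "ennreal ((\<epsilon> - 2 * (\<epsilon> / 2 * inverse (Suc n))) * card (bdry I)) \<le> hausdorff_measure1
      (frontier (cells \<epsilon> I))" for n
  proof -
    have h: "0 < \<epsilon> / 2 * inverse (Suc n)" "\<epsilon> / 2 * inverse (Suc n) \<le> \<epsilon> / 2"
      using e by (auto simp: field_simps)
    show ?thesis
      unfolding hausdorff_measure1_def
      by (rule order_trans[OF hausdorff_pre1_frontier_cells_ge[OF e fin h]], rule SUP_upper) (use
          h in auto)
  qed
  have "(\<lambda>n. ennreal ((\<epsilon> - 2 * (\<epsilon> / 2 * inverse (Suc n))) * card (bdry I)))
      \<longlonglongrightarrow> ennreal ((\<epsilon> - 2 * (\<epsilon> / 2 * 0)) * card (bdry I))"
    by (intro tendsto_ennrealI tendsto_intros LIMSEQ_inverse_real_of_nat)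
  then show "ennreal (\<epsilon> * card (bdry I)) \<le> hausdorff_measure1 (frontier (cells \<epsilon> I))"
    using le by (intro LIMSEQ_le_const2[where X = "\<lambda>n. ennreal ((\<epsilon> - 2 * (\<epsilon> / 2 * inverse (Suc
        n))) * card (bdry I))"]) auto
qed

section \<open>The reduced energy and its minimizers\<close>

subsection \<open>Counting boundary sides\<close>

lemma card_bdry_restrict:
  assumes "finite I"
  shows "card (bdry I) \<le> card (bdry (I \<inter> H)) + 4 * card (I - H)"
proof -
  have "bdry I \<subseteq> bdry (I \<inter> H) \<union> (SIGMA i:I - H. {j. adj i j})"
    by (auto simp: bdry_def)
  then have "card (bdry I) \<le> card (bdry (I \<inter> H) \<union> (SIGMA i:I - H. {j. adj i j}))"
    using assms by (intro card_mono finite_UnI finite_bdry finite_SigmaI finite_adj) auto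
  also have "\<dots> \<le> card (bdry (I \<inter> H)) + card (SIGMA i:I - H. {j. adj i j})"
    by (rule card_Un_le)
  also have "card (SIGMA i:I - H. {j. adj i j}) = 4 * card (I - H)"
    using assms by (subst card_SigmaI) (auto simp: finite_adj card_adj)
  finally show ?thesis .
qed

lemma card_bdry_insert:
  assumes "finite I" "i \<notin> I" "\<And>j. adj i j \<Longrightarrow> j \<notin> I"
  shows "card (bdry (insert i I)) = card (bdry I) + 4"
proof -
  have "bdry (insert i I) = bdry I \<union> Pair i ` {j. adj i j}"
    using assms adj_sym by (auto simp: bdry_def adj_def)
  moreover have "bdry I \<inter> Pair i ` {j. adj i j} = {}"
    using assms by (auto simp: bdry_def)
  moreover have "card (Pair i ` {j. adj i j}) = 4"
    by (subst card_image) (auto simp: inj_on_def card_adj)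
  ultimately show ?thesis
    using assms finite_bdry finite_adj by (simp add: card_Un_disjoint)
qed

lemma card_bdry_remove:
  assumes "finite I" "i \<in> I" "adj i j" "adj i l" "j \<noteq> l" "j \<in> I" "l \<in> I"
  shows "card (bdry I) \<le> card (bdry (I - {i}))"
proof -
  let ?A = "{p \<in> bdry I. fst p \<noteq> i}" and ?B = "{j'. adj i j'} - {j, l}"
  have ji: "j \<noteq> i" "l \<noteq> i" using assms by (auto simp: adj_def)
  have fA: "finite ?A" using finite_bdry[OF assms(1)] by simp
  have "card (bdry I) \<le> card (?A \<union> Pair i ` ?B)"
    using assms finite_adj fA by (intro card_mono) (auto simp: bdry_def)
  also have "\<dots> \<le> card ?A + card (Pair i ` ?B)" by (rule card_Un_le)
  also have "card (Pair i ` ?B) = card ?B" by (rule card_image) (auto simp: inj_on_def)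
  also have "card ?B = 2"
    using assms finite_adj[of i] by (subst card_Diff_subset) (auto simp: card_adj)
  also have "card ?A + 2 = card (?A \<union> {(j, i), (l, i)})"
    using assms fA by (subst card_Un_disjoint) (auto simp: bdry_def)
  also have "\<dots> \<le> card (bdry (I - {i}))"
    using assms ji finite_bdry[of "I - {i}"] adj_sym by (intro card_mono) (auto simp: bdry_def)
  finally show ?thesis .
qed

subsection \<open>Unions of cells as index sets\<close>

lemma pt_inj: "0 < \<epsilon> \<Longrightarrow> pt \<epsilon> i = pt \<epsilon> j \<longleftrightarrow> i = j"
  by (auto simp: pt_def prod_eq_iff)

lemma inj_pt: "0 < \<epsilon> \<Longrightarrow> inj_on (pt \<epsilon>) A"
  by (auto simp: inj_on_def pt_inj)

lemma pt_mem_image: "0 < \<epsilon> \<Longrightarrow> pt \<epsilon> i \<in> pt \<epsilon> ` F \<longleftrightarrow> i \<in> F"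
  by (rule inj_image_mem_iff[OF inj_pt])

lemma abs_fst_le_norm: "\<bar>fst x\<bar> \<le> norm (x :: plane)" and abs_snd_le_norm: "\<bar>snd x\<bar> \<le> norm (x :: plane)"
  using norm_fst_le[of "fst x" "snd x"] norm_snd_le[of "snd x" "fst x"] by simp_all

lemma lattice_eq: "lattice \<epsilon> = range (pt \<epsilon>)"
proof (rule set_eqI)
  fix x
  have "x \<in> lattice \<epsilon> \<longleftrightarrow> (\<exists>a b. x = pt \<epsilon> (a, b))" by (simp add: lattice_def pt_def)
  also have "\<dots> \<longleftrightarrow> (\<exists>i. x = pt \<epsilon> i)" by (simp add: split_paired_Ex)
  also have "\<dots> \<longleftrightarrow> x \<in> range (pt \<epsilon>)" by (simp only: image_iff UNIV_I bex_simps simp_thms)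
  finally show "x \<in> lattice \<epsilon> \<longleftrightarrow> x \<in> range (pt \<epsilon>)" .
qed

lemma pt_mem_cell: "0 < \<epsilon> \<Longrightarrow> pt \<epsilon> i \<in> cell \<epsilon> (pt \<epsilon> j) \<longleftrightarrow> i = j"
proof -
  assume e: "0 < \<epsilon>"
  have "pt \<epsilon> i \<in> cell \<epsilon> (pt \<epsilon> j) \<longleftrightarrow> \<bar>real_of_int (fst i) - of_int (fst j)\<bar> \<le> 1 / 2 \<and> \<bar>real_of_int
      (snd i) - of_int (snd j)\<bar> \<le> 1 / 2"
    unfolding mem_cell_scaled[OF e] using e by (simp add: pt_def)
  also have "\<dots> \<longleftrightarrow> fst i = fst j \<and> snd i = snd j" by linarith
  finally show ?thesis by (simp add: prod_eq_iff)
qed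

lemma pt_mem_cells: "0 < \<epsilon> \<Longrightarrow> pt \<epsilon> i \<in> cells \<epsilon> I \<longleftrightarrow> i \<in> I"
  by (simp add: cells_def pt_mem_cell)

lemma lattice_points_cells: "0 < \<epsilon> \<Longrightarrow> lattice_points \<epsilon> (cells \<epsilon> I) = pt \<epsilon> ` I"
  by (auto simp: lattice_points_def lattice_eq pt_mem_cells)

lemma cells_mono_iff: "0 < \<epsilon> \<Longrightarrow> cells \<epsilon> I \<subseteq> cells \<epsilon> J \<longleftrightarrow> I \<subseteq> J"
  by (metis UN_mono cells_def order_refl pt_mem_cells subset_iff)

lemma discrete_sets_eq: "discrete_sets \<epsilon> = range (cells \<epsilon>)"
proof
  show "discrete_sets \<epsilon> \<subseteq> range (cells \<epsilon>)"
  proof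
    fix E assume "E \<in> discrete_sets \<epsilon>"
    then obtain I where I: "I \<subseteq> range (pt \<epsilon>)" "E = (\<Union>i\<in>I. cell \<epsilon> i)"
      unfolding discrete_sets_def lattice_eq by auto
    have "I = pt \<epsilon> ` (pt \<epsilon> -` I)"
      using I(1) unfolding image_vimage_eq by (rule Int_absorb2[symmetric])
    then have "(\<Union>i\<in>I. cell \<epsilon> i) = (\<Union>i\<in>pt \<epsilon> ` (pt \<epsilon> -` I). cell \<epsilon> i)" by (rule arg_cong)
    then have "E = cells \<epsilon> (pt \<epsilon> -` I)" unfolding I(2) cells_def image_image .
    then show "E \<in> range (cells \<epsilon>)" by (rule range_eqI)
  qed
  show "range (cells \<epsilon>) \<subseteq> discrete_sets \<epsilon>"
  proof (rule image_subsetI)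
    fix I
    have "cells \<epsilon> I = (\<Union>i\<in>pt \<epsilon> ` I. cell \<epsilon> i) \<and> pt \<epsilon> ` I \<subseteq> lattice \<epsilon>"
      unfolding cells_def image_image lattice_eq by (intro conjI refl image_mono subset_UNIV)
    then show "cells \<epsilon> I \<in> discrete_sets \<epsilon>"
      unfolding discrete_sets_def mem_Collect_eq by (rule exI)
  qed
qed

lemma cell_Int_null:
  assumes "0 < \<epsilon>" "i \<noteq> j"
  shows "cell \<epsilon> (pt \<epsilon> i) \<inter> cell \<epsilon> (pt \<epsilon> j) \<in> null_sets lebesgue"
proof -
  have mid: "w = (a + b) / 2" if "\<bar>w - of_int a\<bar> \<le> 1 / 2" "\<bar>w - of_int b\<bar> \<le> 1 / 2" "a \<noteq> b"
    for w :: real and a b :: int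
  proof -
    have w: "w \<le> real_of_int a + 1 / 2" "real_of_int a - 1 / 2 \<le> w"
      "w \<le> real_of_int b + 1 / 2" "real_of_int b - 1 / 2 \<le> w"
      using abs_le_D1[OF that(1)] abs_le_D2[OF that(1)] abs_le_D1[OF that(2)] abs_le_D2[OF
          that(2)] by linarith+
    have "real_of_int a + 1 \<le> of_int b \<or> real_of_int b + 1 \<le> of_int a" using that(3) by linarith
    then have "w \<le> (real_of_int a + real_of_int b) / 2" "(real_of_int a + real_of_int b) / 2 \<le> w"
      using w by auto
    then show ?thesis by simp
  qed
  have "negligible (cell \<epsilon> (pt \<epsilon> i) \<inter> cell \<epsilon> (pt \<epsilon> j))"
  proof (cases "fst i = fst j")
    case False
    have "negligible {x::plane. x \<bullet> (1, 0) = \<epsilon> * ((fst i + fst j) / 2)}"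
      by (rule negligible_standard_hyperplane) (auto simp: Basis_prod_def)
    moreover have "cell \<epsilon> (pt \<epsilon> i) \<inter> cell \<epsilon> (pt \<epsilon> j) \<subseteq> {x::plane. x \<bullet> (1, 0) = \<epsilon> * ((fst i + fst
        j) / 2)}"
    proof
      fix x assume "x \<in> cell \<epsilon> (pt \<epsilon> i) \<inter> cell \<epsilon> (pt \<epsilon> j)"
      then have "fst x / \<epsilon> = (fst i + fst j) / 2"
        using False by (intro mid) (auto simp: mem_cell_scaled[OF assms(1)])
      then show "x \<in> {x. x \<bullet> (1, 0) = \<epsilon> * ((fst i + fst j) / 2)}"
        using assms(1) by (simp add: inner_prod_def field_simps)
    qed
    ultimately show ?thesis by (rule negligible_subset)
  next
    case True
    then have ne: "snd i \<noteq> snd j" using assms(2) by (simp add: prod_eq_iff)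
    have "negligible {x::plane. x \<bullet> (0, 1) = \<epsilon> * ((snd i + snd j) / 2)}"
      by (rule negligible_standard_hyperplane) (auto simp: Basis_prod_def)
    moreover have "cell \<epsilon> (pt \<epsilon> i) \<inter> cell \<epsilon> (pt \<epsilon> j) \<subseteq> {x::plane. x \<bullet> (0, 1) = \<epsilon> * ((snd i + snd
        j) / 2)}"
    proof
      fix x assume "x \<in> cell \<epsilon> (pt \<epsilon> i) \<inter> cell \<epsilon> (pt \<epsilon> j)"
      then have "snd x / \<epsilon> = (snd i + snd j) / 2"
        using ne by (intro mid) (auto simp: mem_cell_scaled[OF assms(1)])
      then show "x \<in> {x. x \<bullet> (0, 1) = \<epsilon> * ((snd i + snd j) / 2)}"
        using assms(1) by (simp add: inner_prod_def field_simps)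
    qed
    ultimately show ?thesis by (rule negligible_subset)
  qed
  then show ?thesis by (simp add: negligible_iff_null_sets)
qed

lemma finite_perimeter_cells:
  assumes "0 < \<epsilon>" "finite I"
  shows "finite_perimeter (cells \<epsilon> I)"
  unfolding cells_def
proof (rule finite_perimeter_finite_UN[OF assms(2)])
  show "cell \<epsilon> (pt \<epsilon> i) \<in> sets borel \<and> convex (cell \<epsilon> (pt \<epsilon> i)) \<and> bounded (cell \<epsilon> (pt \<epsilon> i))" for i
    using compact_cell convex_cell compact_imp_bounded compact_imp_closed borel_closed by blast
qed (use cell_Int_null[OF assms(1)] in auto)

subsection \<open>Distance to a finite set in a norm\<close>

text \<open>The \<open>\<phi>\<close>-distance of \<open>x\<close> to \<open>P\<close>; it is only used for finite nonempty \<open>P\<close>, where it is a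
  minimum.\<close>

definition gap :: "(plane \<Rightarrow> real) \<Rightarrow> plane set \<Rightarrow> plane \<Rightarrow> real" where
  "gap \<phi> P x = (INF p\<in>P. \<phi> (x - p))"

locale plane_norm =
  fixes \<phi> :: "plane \<Rightarrow> real"
  assumes is_norm: "is_norm \<phi>"
begin

lemma nonneg: "0 \<le> \<phi> x" and zero_iff: "\<phi> x = 0 \<longleftrightarrow> x = 0"
  and scale: "\<phi> (c *\<^sub>R x) = \<bar>c\<bar> * \<phi> x" and triangle: "\<phi> (x + y) \<le> \<phi> x + \<phi> y"
  using is_norm unfolding is_norm_def by blast+

lemma zero [simp]: "\<phi> 0 = 0" by (simp add: zero_iff)

lemma minus [simp]: "\<phi> (- x) = \<phi> x" using scale[of "-1" x] by simp

lemma sym: "\<phi> (x - y) = \<phi> (y - x)" using minus[of "x - y"] by simp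

lemma triangle_diff: "\<phi> (x - z) \<le> \<phi> (x - y) + \<phi> (y - z)"
  using triangle[of "x - y" "y - z"] by simp

lemma le_norm: "\<exists>C. \<forall>x. \<phi> x \<le> C * norm x"
proof (intro exI allI)
  fix x :: plane
  have x: "x = fst x *\<^sub>R (1, 0) + snd x *\<^sub>R (0, 1)" by (simp add: prod_eq_iff)
  have "\<phi> x \<le> \<bar>fst x\<bar> * \<phi> (1, 0) + \<bar>snd x\<bar> * \<phi> (0, 1)"
    using triangle[of "fst x *\<^sub>R (1, 0)" "snd x *\<^sub>R (0, 1)"] unfolding scale x[symmetric] .
  also have "\<dots> \<le> norm x * \<phi> (1, 0) + norm x * \<phi> (0, 1)"
    using norm_fst_le[of "fst x" "snd x"] norm_snd_le[of "snd x" "fst x"]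
    by (intro add_mono mult_right_mono nonneg) simp_all
  finally show "\<phi> x \<le> (\<phi> (1, 0) + \<phi> (0, 1)) * norm x" by (simp add: algebra_simps)
qed

lemma lipschitz: "\<bar>\<phi> x - \<phi> y\<bar> \<le> \<phi> (x - y)"
  using triangle[of "x - y" y] triangle[of "y - x" x] sym[of x y] by simp

lemma continuous: "continuous_on UNIV \<phi>"
proof -
  obtain C where C: "\<And>x. \<phi> x \<le> C * norm x" using le_norm by blast
  have "\<phi> (1, 0) > 0" using nonneg[of "(1,0)"] zero_iff[of "(1, 0)"] by (simp add: zero_prod_def
      less_le)
  moreover have "\<phi> (1, 0) \<le> C" using C[of "(1,0)"] by (simp add: norm_Pair)
  ultimately have "0 < C" by simp
  show ?thesis
  proof (rule continuous_onI)
    fix x e :: real and x0 :: plane assume "0 < e"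
    show "\<exists>d>0. \<forall>x'\<in>UNIV. dist x' x0 < d \<longrightarrow> dist (\<phi> x') (\<phi> x0) \<le> e"
    proof (intro exI[of _ "e / C"] conjI ballI impI)
      fix x' assume "dist x' x0 < e / C"
      then have "C * norm (x' - x0) < e" using \<open>0 < C\<close> by (simp add: dist_norm field_simps)
      then show "dist (\<phi> x') (\<phi> x0) \<le> e"
        using lipschitz[of x' x0] C[of "x' - x0"] by (simp add: dist_real_def)
    qed (use \<open>0 < e\<close> \<open>0 < C\<close> in simp)
  qed
qed

lemma norm_equiv: "\<exists>k\<ge>1. \<forall>x. \<phi> x \<le> k * norm x \<and> norm x \<le> k * \<phi> x"
proof -
  obtain C where C: "\<And>x. \<phi> x \<le> C * norm x" using le_norm by blast
  have "sphere (0::plane) 1 \<noteq> {}" by simp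
  then obtain z where z: "z \<in> sphere 0 1" "\<And>x. x \<in> sphere 0 1 \<Longrightarrow> \<phi> z \<le> \<phi> x"
    using continuous_attains_inf[OF compact_sphere _ continuous_on_subset[OF continuous
        subset_UNIV]] by blast
  have m: "0 < \<phi> z" using z(1) nonneg[of z] zero_iff[of z] by (auto simp: less_le)
  define k where "k = Max {1, C, 1 / \<phi> z}"
  have k: "1 \<le> k" "C \<le> k" "1 / \<phi> z \<le> k" by (auto simp: k_def)
  have "norm x \<le> k * \<phi> x" for x
  proof (cases "x = 0")
    case False
    have "\<phi> z \<le> \<phi> ((1 / norm x) *\<^sub>R x)" by (rule z(2)) (use False in simp)
    also have "\<dots> = \<phi> x / norm x" by (simp add: scale)
    finally have "norm x \<le> 1 / \<phi> z * \<phi> x" using m False by (simp add: field_simps)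
    also have "\<dots> \<le> k * \<phi> x" by (intro mult_right_mono k nonneg)
    finally show ?thesis .
  qed simp
  moreover have "\<phi> x \<le> k * norm x" for x
    using C[of x] mult_right_mono[OF k(2), of "norm x"] by simp
  ultimately show ?thesis using k by blast
qed

text \<open>A constant for the equivalence of \<open>\<phi>\<close> with the Euclidean norm, in both directions.\<close>

definition kap :: real where
  "kap = (SOME k. 1 \<le> k \<and> (\<forall>x. \<phi> x \<le> k * norm x \<and> norm x \<le> k * \<phi> x))"

lemma kap_ge1: "1 \<le> kap" and le_kap: "\<phi> x \<le> kap * norm x" and norm_le_kap: "norm x \<le> kap * \<phi> x"
proof -
  have "1 \<le> kap \<and> (\<forall>x. \<phi> x \<le> kap * norm x \<and> norm x \<le> kap * \<phi> x)"
    unfolding kap_def by (rule someI_ex) (use norm_equiv in blast)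
  then show "1 \<le> kap" "\<phi> x \<le> kap * norm x" "norm x \<le> kap * \<phi> x" by blast+
qed

lemma gap_le: "p \<in> P \<Longrightarrow> gap \<phi> P x \<le> \<phi> (x - p)"
  unfolding gap_def by (rule cINF_lower) (auto intro!: bdd_belowI2 nonneg)

lemma gap_attained:
  assumes "finite P" "P \<noteq> {}"
  obtains p where "p \<in> P" "gap \<phi> P x = \<phi> (x - p)"
proof -
  have "Inf ((\<lambda>p. \<phi> (x - p)) ` P) \<in> (\<lambda>p. \<phi> (x - p)) ` P"
    by (subst cInf_eq_Min) (use assms in auto)
  then show thesis using that by (auto simp: gap_def)
qed

lemma gap_nonneg: "P \<noteq> {} \<Longrightarrow> 0 \<le> gap \<phi> P x"
  unfolding gap_def by (rule cINF_greatest) (auto simp: nonneg)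

lemma gap_eq_0_iff: "finite P \<Longrightarrow> P \<noteq> {} \<Longrightarrow> gap \<phi> P x = 0 \<longleftrightarrow> x \<in> P"
proof
  assume P: "finite P" "P \<noteq> {}" "gap \<phi> P x = 0"
  obtain p where "p \<in> P" "gap \<phi> P x = \<phi> (x - p)" using gap_attained[OF P(1,2)] .
  then show "x \<in> P" using P(3) zero_iff[of "x - p"] by simp
next
  assume "P \<noteq> {}" "x \<in> P"
  then show "gap \<phi> P x = 0" using gap_le[of x P x] gap_nonneg[of P x] by simp
qed

lemma gap_lipschitz:
  assumes "finite P" "P \<noteq> {}"
  shows "gap \<phi> P x \<le> gap \<phi> P y + \<phi> (x - y)"
proof -
  obtain p where "p \<in> P" "gap \<phi> P y = \<phi> (y - p)" using gap_attained[OF assms] .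
  then show ?thesis using gap_le[of p P x] triangle_diff[of x p y] by simp
qed

lemma gap_antimono: "P \<noteq> {} \<Longrightarrow> P \<subseteq> Q \<Longrightarrow> finite Q \<Longrightarrow> gap \<phi> Q x \<le> gap \<phi> P x"
proof -
  assume P: "P \<noteq> {}" "P \<subseteq> Q" "finite Q"
  obtain p where "p \<in> P" "gap \<phi> P x = \<phi> (x - p)" using gap_attained[OF finite_subset[OF P(2,3)] P(1)] .
  then show ?thesis using gap_le[of p Q x] P(2) by auto
qed

lemma ennreal_gap:
  assumes "finite P" "P \<noteq> {}"
  shows "(INF p\<in>P. ennreal (\<phi> (x - p))) = ennreal (gap \<phi> P x)"
proof (rule antisym)
  obtain p where "p \<in> P" "gap \<phi> P x = \<phi> (x - p)" using gap_attained[OF assms] .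
  then show "(INF p\<in>P. ennreal (\<phi> (x - p))) \<le> ennreal (gap \<phi> P x)" by (auto intro: INF_lower2)
  show "ennreal (gap \<phi> P x) \<le> (INF p\<in>P. ennreal (\<phi> (x - p)))"
    by (rule INF_greatest) (auto intro!: ennreal_leI gap_le)
qed

lemma finite_gap_le:
  assumes "0 < \<epsilon>" "finite F" "F \<noteq> {}"
  shows "finite {i. gap \<phi> (pt \<epsilon> ` F) (pt \<epsilon> i) \<le> r}"
proof -
  have "finite {i. \<phi> (pt \<epsilon> i - p) \<le> r}" for p
  proof -
    define R where "R = \<lceil>(kap * r + norm p) / \<epsilon>\<rceil>"
    have "{i. \<phi> (pt \<epsilon> i - p) \<le> r} \<subseteq> {-R..R} \<times> {-R..R}"
    proof
      fix i assume "i \<in> {i. \<phi> (pt \<epsilon> i - p) \<le> r}"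
      then have "kap * \<phi> (pt \<epsilon> i - p) \<le> kap * r" using kap_ge1 by (intro mult_left_mono) auto
      then have "norm (pt \<epsilon> i - p) \<le> kap * r" using norm_le_kap[of "pt \<epsilon> i - p"] by linarith
      then have n: "norm (pt \<epsilon> i) \<le> kap * r + norm p" using norm_triangle_sub[of "pt \<epsilon> i" p] by simp
      have "\<bar>\<epsilon> * of_int (fst i)\<bar> \<le> norm (pt \<epsilon> i)" "\<bar>\<epsilon> * of_int (snd i)\<bar> \<le> norm (pt \<epsilon> i)"
        using norm_fst_le[of "fst (pt \<epsilon> i)" "snd (pt \<epsilon> i)"] norm_snd_le[of "snd (pt \<epsilon> i)" "fst (pt
            \<epsilon> i)"]
        by (simp_all add: pt_def)
      with n have "\<epsilon> * \<bar>of_int (fst i)\<bar> \<le> kap * r + norm p" "\<epsilon> * \<bar>of_int (snd i)\<bar> \<le> kap * r + norm p"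
        using assms(1) by (auto simp: abs_mult)
      then have "\<bar>of_int (fst i)\<bar> \<le> (kap * r + norm p) / \<epsilon>" "\<bar>of_int (snd i)\<bar> \<le> (kap * r + norm p) / \<epsilon>"
        using assms(1) by (simp_all add: field_simps)
      then have "\<bar>fst i\<bar> \<le> R" "\<bar>snd i\<bar> \<le> R" unfolding R_def by linarith+
      then show "i \<in> {-R..R} \<times> {-R..R}" by (auto simp: mem_Times_iff)
    qed
    then show ?thesis by (rule finite_subset) auto
  qed
  then have "finite (\<Union>p\<in>pt \<epsilon> ` F. {i. \<phi> (pt \<epsilon> i - p) \<le> r})" using assms(2) by blast
  moreover have "{i. gap \<phi> (pt \<epsilon> ` F) (pt \<epsilon> i) \<le> r} \<subseteq> (\<Union>p\<in>pt \<epsilon> ` F. {i. \<phi> (pt \<epsilon> i - p) \<le> r})"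
  proof
    fix i assume i: "i \<in> {i. gap \<phi> (pt \<epsilon> ` F) (pt \<epsilon> i) \<le> r}"
    have "finite (pt \<epsilon> ` F)" "pt \<epsilon> ` F \<noteq> {}" using assms by auto
    from gap_attained[OF this, of "pt \<epsilon> i"] i
    show "i \<in> (\<Union>p\<in>pt \<epsilon> ` F. {i. \<phi> (pt \<epsilon> i - p) \<le> r})" by (metis UN_I mem_Collect_eq)
  qed
  ultimately show ?thesis by (rule finite_subset[rotated])
qed

subsection \<open>The scheme in terms of index sets\<close>

text \<open>The energy of the cells of \<open>I\<close> relative to those of \<open>F\<close>, divided by \<open>\<epsilon>\<^sup>2\<close>.\<close>

definition reduced_energy :: "real \<Rightarrow> real \<Rightarrow> index set \<Rightarrow> index set \<Rightarrow> real" where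
  "reduced_energy \<epsilon> \<tau> F I = (\<Sum>i\<in>I - F. gap \<phi> (pt \<epsilon> ` F) (pt \<epsilon> i)) / \<tau> - card (bdry I)"

text \<open>\<open>I\<close> is a minimizer among the finite supersets of \<open>F\<close>.\<close>

definition step :: "real \<Rightarrow> real \<Rightarrow> index set \<Rightarrow> index set \<Rightarrow> bool" where
  "step \<epsilon> \<tau> F I \<longleftrightarrow> finite I \<and> F \<subseteq> I \<and> (\<forall>I'. finite I' \<and> F \<subseteq> I' \<longrightarrow> reduced_energy \<epsilon> \<tau> F I \<le>
      reduced_energy \<epsilon> \<tau> F I')"

lemma energy_cells:
  assumes e: "0 < \<epsilon>" "0 < \<tau>" and F: "finite F" "F \<noteq> {}" and I: "finite I" "F \<subseteq> I"
  shows "energy \<phi> \<epsilon> \<tau> (cells \<epsilon> I) (cells \<epsilon> F) = ereal (\<epsilon>\<^sup>2 * reduced_energy \<epsilon> \<tau> F I)"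
proof -
  let ?P = "pt \<epsilon> ` F"
  have P: "finite ?P" "?P \<noteq> {}" using F by auto
  have sd: "sym_diff (pt \<epsilon> ` I) ?P = pt \<epsilon> ` (I - F)"
    using image_set_diff[OF inj_pt[OF e(1)], of I F] image_mono[OF I(2), of "pt \<epsilon>"] by blast
  have "(\<Sum>\<^sub>\<infinity>i\<in>pt \<epsilon> ` (I - F). boundary_distance \<phi> \<epsilon> i ?P) = (\<Sum>i\<in>pt \<epsilon> ` (I - F). boundary_distance
      \<phi> \<epsilon> i ?P)"
    using I(1) by (intro infsum_finite) auto
  also have "\<dots> = (\<Sum>i\<in>I - F. boundary_distance \<phi> \<epsilon> (pt \<epsilon> i) ?P)"
    by (subst sum.reindex[OF inj_pt[OF e(1)]]) simp
  also have "\<dots> = (\<Sum>i\<in>I - F. ennreal (gap \<phi> ?P (pt \<epsilon> i)))"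
  proof (rule sum.cong)
    fix i assume "i \<in> I - F"
    then have "pt \<epsilon> i \<notin> ?P" using pt_mem_image[OF e(1)] by simp
    then show "boundary_distance \<phi> \<epsilon> (pt \<epsilon> i) ?P = ennreal (gap \<phi> ?P (pt \<epsilon> i))"
      unfolding boundary_distance_def by (simp only: if_False ennreal_gap[OF P])
  qed simp
  also have "\<dots> = ennreal (\<Sum>i\<in>I - F. gap \<phi> ?P (pt \<epsilon> i))"
    by (rule sum_ennreal) (use gap_nonneg[OF P(2)] in auto)
  finally have S: "(\<Sum>\<^sub>\<infinity>i\<in>pt \<epsilon> ` (I - F). boundary_distance \<phi> \<epsilon> i ?P) = ennreal (\<Sum>i\<in>I - F. gap \<phi> ?P
      (pt \<epsilon> i))" .
  have S0: "0 \<le> (\<Sum>i\<in>I - F. gap \<phi> ?P (pt \<epsilon> i))" using gap_nonneg[OF P(2)] by (simp add: sum_nonneg)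
  show ?thesis
    unfolding energy_def lattice_points_cells[OF e(1)] sd S hausdorff_measure1_frontier_cells[OF
        e(1) I(1)]
    using e S0 by (simp add: enn2ereal_ennreal reduced_energy_def power2_eq_square algebra_simps)
qed

text \<open>The dissipation is infinite, because each added cell contributes at least \<open>\<epsilon> / kap\<close>; it
  prevails even over an infinite boundary term, as \<open>- \<infinity> + \<infinity> = \<infinity>\<close> in the extended reals.\<close>

lemma energy_infinite:
  assumes e: "0 < \<epsilon>" "0 < \<tau>" and F: "finite F" "F \<noteq> {}" and I: "infinite I" "F \<subseteq> I"
  shows "energy \<phi> \<epsilon> \<tau> (cells \<epsilon> I) (cells \<epsilon> F) = \<infinity>"
proof -
  let ?P = "pt \<epsilon> ` F"
  have sd: "sym_diff (pt \<epsilon> ` I) ?P = pt \<epsilon> ` (I - F)"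
    using image_set_diff[OF inj_pt[OF e(1)], of I F] image_mono[OF I(2), of "pt \<epsilon>"] by blast
  have "(\<Sum>\<^sub>\<infinity>i\<in>pt \<epsilon> ` (I - F). boundary_distance \<phi> \<epsilon> i ?P) = \<infinity>"
  proof (rule infsum_superconst_infinite_ennreal)
    show "infinite (pt \<epsilon> ` (I - F))"
      using I(1) F(1) inj_pt[OF e(1)] by (simp add: finite_image_iff)
    show "0 < ennreal (\<epsilon> / kap)" using e kap_ge1 by simp
    fix x assume "x \<in> pt \<epsilon> ` (I - F)"
    then obtain i where i: "x = pt \<epsilon> i" "i \<in> I" "i \<notin> F" by blast
    have "ennreal (\<epsilon> / kap) \<le> (INF j\<in>?P. ennreal (\<phi> (x - j)))"
    proof (rule INF_greatest)
      fix p assume "p \<in> ?P"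
      then obtain j where j: "p = pt \<epsilon> j" "j \<noteq> i" using i by blast
      then have "1 \<le> \<bar>fst i - fst j\<bar> \<or> 1 \<le> \<bar>snd i - snd j\<bar>" by (auto simp: prod_eq_iff)
      then have "1 \<le> \<bar>real_of_int (fst i) - of_int (fst j)\<bar> \<or> 1 \<le> \<bar>real_of_int (snd i) - of_int
          (snd j)\<bar>" by linarith
      then have "\<epsilon> \<le> \<epsilon> * \<bar>real_of_int (fst i) - of_int (fst j)\<bar> \<or> \<epsilon> \<le> \<epsilon> * \<bar>real_of_int (snd i) -
          of_int (snd j)\<bar>" 
        using e by simp
      moreover have "\<epsilon> * \<bar>real_of_int (fst i) - of_int (fst j)\<bar> = \<bar>fst (x - p)\<bar>"
          "\<epsilon> * \<bar>real_of_int (snd i) - of_int (snd j)\<bar> = \<bar>snd (x - p)\<bar>"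
        using e by (simp_all add: i j pt_def abs_mult_pos' right_diff_distrib)
      ultimately have "\<epsilon> \<le> norm (x - p)"
        using abs_fst_le_norm[of "x - p"] abs_snd_le_norm[of "x - p"] by linarith
      also have "\<dots> \<le> kap * \<phi> (x - p)" by (rule norm_le_kap)
      finally show "ennreal (\<epsilon> / kap) \<le> ennreal (\<phi> (x - p))"
        using kap_ge1 by (intro ennreal_leI) (simp add: field_simps)
    qed
    moreover have "x \<notin> ?P" using i pt_mem_image[OF e(1)] by simp
    ultimately show "ennreal (\<epsilon> / kap) \<le> boundary_distance \<phi> \<epsilon> x ?P"
      unfolding boundary_distance_def by simp
  qed
  then show ?thesis
    unfolding energy_def lattice_points_cells[OF e(1)] sd using e by simp
qed

lemma step_exists:
  assumes e: "0 < \<epsilon>" "0 < \<tau>" and F: "finite F" "F \<noteq> {}"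
  shows "\<exists>I. step \<epsilon> \<tau> F I"
proof -
  let ?g = "\<lambda>i. gap \<phi> (pt \<epsilon> ` F) (pt \<epsilon> i)"
  define H where "H = F \<union> {i. ?g i \<le> 4 * \<tau>}"
  have H: "finite H" using finite_gap_le[OF e(1) F] F by (simp add: H_def)
  have cut: "reduced_energy \<epsilon> \<tau> F (I \<inter> H) \<le> reduced_energy \<epsilon> \<tau> F I" if I: "finite I" for I
  proof -
    have "(\<Sum>i\<in>I - F. ?g i) = (\<Sum>i\<in>I \<inter> H - F. ?g i) + (\<Sum>i\<in>I - H. ?g i)"
      using I by (subst sum.union_disjoint[symmetric]) (auto intro!: sum.cong simp: H_def)
    moreover have "4 * \<tau> * card (I - H) \<le> (\<Sum>i\<in>I - H. ?g i)"
      using sum_mono[of "I - H" "\<lambda>_. 4 * \<tau>" ?g] by (auto simp: H_def mult.commute)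
    ultimately have "(\<Sum>i\<in>I \<inter> H - F. ?g i) + 4 * \<tau> * card (I - H) \<le> (\<Sum>i\<in>I - F. ?g i)" by simp
    then have "((\<Sum>i\<in>I \<inter> H - F. ?g i) + 4 * \<tau> * card (I - H)) / \<tau> \<le> (\<Sum>i\<in>I - F. ?g i) / \<tau>"
      using e by (intro divide_right_mono) auto
    moreover have "((\<Sum>i\<in>I \<inter> H - F. ?g i) + 4 * \<tau> * card (I - H)) / \<tau> = (\<Sum>i\<in>I \<inter> H - F. ?g i) / \<tau> +
        4 * card (I - H)"
      using e by (simp add: add_divide_distrib)
    moreover have "real (card (bdry I)) \<le> card (bdry (I \<inter> H)) + 4 * card (I - H)"
      using card_bdry_restrict[OF I, of H] by linarith
    ultimately show ?thesis unfolding reduced_energy_def by simp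
  qed
  \<comment> \<open>by \<open>cut\<close>, it is enough to minimize over the finitely many subsets of \<open>H\<close>\<close>
  let ?C = "{I. F \<subseteq> I \<and> I \<subseteq> H}"
  have C: "finite ?C" "?C \<noteq> {}" using H by (auto simp: H_def)
  define I where "I = arg_min_on (reduced_energy \<epsilon> \<tau> F) ?C"
  have I: "I \<in> ?C" "\<And>I'. I' \<in> ?C \<Longrightarrow> reduced_energy \<epsilon> \<tau> F I \<le> reduced_energy \<epsilon> \<tau> F I'"
    using arg_min_if_finite[OF C, of "reduced_energy \<epsilon> \<tau> F"] unfolding I_def[symmetric] by (simp,
        meson not_le)
  have "reduced_energy \<epsilon> \<tau> F I \<le> reduced_energy \<epsilon> \<tau> F I'" if "finite I'" "F \<subseteq> I'" for I'
  proof -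
    have "reduced_energy \<epsilon> \<tau> F I \<le> reduced_energy \<epsilon> \<tau> F (I' \<inter> H)" using that by (intro I) (auto
        simp: H_def)
    also have "\<dots> \<le> reduced_energy \<epsilon> \<tau> F I'" by (rule cut) fact
    finally show ?thesis .
  qed
  moreover have "finite I" "F \<subseteq> I" using I(1) H finite_subset by auto
  ultimately have "step \<epsilon> \<tau> F I" unfolding step_def by simp
  then show ?thesis ..
qed

lemma scheme_imp_steps:
  assumes e: "0 < \<epsilon>" "0 < \<tau>" and S: "scheme \<phi> \<epsilon> \<tau> S"
  obtains I where "I 0 = {(0, 0)}" "\<And>k. S k = cells \<epsilon> (I k)" "\<And>k. finite (I k)"
    "\<And>k. step \<epsilon> \<tau> (I k) (I (Suc k))"
proof -
  define I where "I k = {i. pt \<epsilon> i \<in> S k}" for k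
  have I_eq: "I k = J" if "S k = cells \<epsilon> J" for k J
    using that pt_mem_cells[OF e(1)] by (auto simp: I_def)
  have S0: "S 0 = cells \<epsilon> {(0, 0)}"
    using S by (simp add: scheme_def cells_def pt_def zero_prod_def)
  have stp: "S (Suc k) = cells \<epsilon> (I (Suc k)) \<and> finite (I (Suc k)) \<and> (0, 0) \<in> I (Suc k) \<and> step \<epsilon> \<tau>
      (I k) (I (Suc k))"
    if k: "S k = cells \<epsilon> (I k)" "finite (I k)" "(0, 0) \<in> I k" for k
  proof -
    have ne: "I k \<noteq> {}" using k by blast
    have adm: "S (Suc k) \<in> admissible \<epsilon> (S k)"
      and min: "\<And>E. E \<in> admissible \<epsilon> (S k) \<Longrightarrow> energy \<phi> \<epsilon> \<tau> (S (Suc k)) (S k) \<le> energy \<phi> \<epsilon> \<tau> E (S k)"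
      using S by (auto simp: scheme_def)
    have "S (Suc k) \<in> range (cells \<epsilon>)" using adm by (simp add: admissible_def discrete_sets_eq)
    then obtain J where J: "S (Suc k) = cells \<epsilon> J" by (rule rangeE)
    have IJ: "I (Suc k) = J" by (rule I_eq[OF J])
    have sub: "I k \<subseteq> J" using adm unfolding J k(1) admissible_def by (simp add: cells_mono_iff[OF e(1)])
    have test: "energy \<phi> \<epsilon> \<tau> (S (Suc k)) (S k) \<le> ereal (\<epsilon>\<^sup>2 * reduced_energy \<epsilon> \<tau> (I k) I')"
      if "finite I'" "I k \<subseteq> I'" for I'
    proof -
      have "cells \<epsilon> I' \<in> admissible \<epsilon> (S k)"
        using that finite_perimeter_cells[OF e(1)] cells_mono_iff[OF e(1)]
        unfolding k(1) admissible_def discrete_sets_eq by simp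
      from min[OF this] show ?thesis unfolding k(1) energy_cells[OF e k(2) ne that] .
    qed
    have fin: "finite J"
    proof (rule ccontr)
      assume "infinite J"
      then have "energy \<phi> \<epsilon> \<tau> (S (Suc k)) (S k) = \<infinity>"
        unfolding J k(1) by (rule energy_infinite[OF e k(2) ne _ sub])
      then show False using test[OF k(2) subset_refl] by simp
    qed
    have "reduced_energy \<epsilon> \<tau> (I k) J \<le> reduced_energy \<epsilon> \<tau> (I k) I'" if "finite I'" "I k \<subseteq> I'" for I'
      using test[OF that] e unfolding J k(1) energy_cells[OF e k(2) ne fin sub] by simp
    then have "step \<epsilon> \<tau> (I k) J" using fin sub unfolding step_def by blast
    then show ?thesis using J IJ fin sub k(3) by auto
  qed
  have all: "S k = cells \<epsilon> (I k) \<and> finite (I k) \<and> (0, 0) \<in> I k" for k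
  proof (induction k)
    case 0
    have "I 0 = {(0, 0)}" by (rule I_eq[OF S0])
    then show ?case using S0 by simp
  next
    case (Suc k)
    then show ?case using stp by blast
  qed
  show thesis
  proof (rule that[of I])
    show "I 0 = {(0, 0)}" by (rule I_eq[OF S0])
    fix k
    show "S k = cells \<epsilon> (I k)" "finite (I k)" using all[of k] by simp_all
    show "step \<epsilon> \<tau> (I k) (I (Suc k))" using stp[of k] all[of k] by simp
  qed
qed

lemma steps_imp_scheme:
  assumes e: "0 < \<epsilon>" "0 < \<tau>" and I0: "I 0 = {(0, 0)}" and st: "\<And>k. step \<epsilon> \<tau> (I k) (I (Suc k))"
  shows "scheme \<phi> \<epsilon> \<tau> (\<lambda>k. cells \<epsilon> (I k))"
proof -
  have I: "finite (I k) \<and> I k \<noteq> {}" for k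
    using st by (induction k) (auto simp: I0 step_def)
  show ?thesis
    unfolding scheme_def
  proof (intro conjI allI ballI)
    show "cells \<epsilon> (I 0) = cell \<epsilon> 0" by (simp add: I0 cells_def pt_def zero_prod_def)
    fix k
    have "finite (I (Suc k))" "I k \<subseteq> I (Suc k)" using st[of k] by (auto simp: step_def)
    then show "cells \<epsilon> (I (Suc k)) \<in> admissible \<epsilon> (cells \<epsilon> (I k))"
      using finite_perimeter_cells[OF e(1)] cells_mono_iff[OF e(1)]
      unfolding admissible_def discrete_sets_eq by simp
    fix E assume "E \<in> admissible \<epsilon> (cells \<epsilon> (I k))"
    then obtain J where J: "E = cells \<epsilon> J" "I k \<subseteq> J"
    proof -
      assume "E \<in> admissible \<epsilon> (cells \<epsilon> (I k))"
      then have E: "E \<in> range (cells \<epsilon>)" "cells \<epsilon> (I k) \<subseteq> E"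
        unfolding admissible_def discrete_sets_eq by simp_all
      from E(1) obtain J where J: "E = cells \<epsilon> J" by (rule rangeE)
      show thesis using that[OF J] E(2) unfolding J cells_mono_iff[OF e(1)] by simp
    qed
    show "energy \<phi> \<epsilon> \<tau> (cells \<epsilon> (I (Suc k))) (cells \<epsilon> (I k)) \<le> energy \<phi> \<epsilon> \<tau> E (cells \<epsilon> (I k))"
    proof (cases "finite J")
      case True
      have "finite (I (Suc k))" "I k \<subseteq> I (Suc k)" "reduced_energy \<epsilon> \<tau> (I k) (I (Suc k)) \<le>
          reduced_energy \<epsilon> \<tau> (I k) J"
        using st[of k] True J(2) by (auto simp: step_def)
      then show ?thesis
        unfolding J(1) using energy_cells[OF e, of "I k"] I[of k] True J(2) e by simp
    next
      case False
      then show ?thesis unfolding J(1) using energy_infinite[OF e _ _ False J(2)] I[of k] by simp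
    qed
  qed
qed

lemma scheme_exists:
  assumes e: "0 < \<epsilon>" "0 < \<tau>"
  shows "\<exists>S. scheme \<phi> \<epsilon> \<tau> S"
proof -
  define I where "I = rec_nat {(0::int, 0::int)} (\<lambda>_ F. SOME J. step \<epsilon> \<tau> F J)"
  have I0: "I 0 = {(0, 0)}" by (simp add: I_def)
  have IS: "I (Suc k) = (SOME J. step \<epsilon> \<tau> (I k) J)" for k by (simp add: I_def)
  have "finite (I k) \<and> I k \<noteq> {} \<and> step \<epsilon> \<tau> (I k) (I (Suc k))" for k
  proof (induction k)
    case 0
    then show ?case unfolding IS[of 0] using someI_ex[OF step_exists[OF e]] by (simp add: I0)
  next
    case (Suc k)
    then have *: "finite (I (Suc k))" "I (Suc k) \<noteq> {}" by (auto simp: step_def)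
    then show ?case unfolding IS[of "Suc k"] using someI_ex[OF step_exists[OF e *]] by simp
  qed
  then have "scheme \<phi> \<epsilon> \<tau> (\<lambda>k. cells \<epsilon> (I k))" by (intro steps_imp_scheme[OF e, of I] I0) simp
  then show ?thesis by blast
qed

subsection \<open>Local moves\<close>

text \<open>Consequences of minimality under adding or removing a single cell.\<close>

context
  fixes \<epsilon> \<tau> :: real and F I :: "index set"
  assumes e: "0 < \<epsilon>" "0 < \<tau>" and F: "finite F" "F \<noteq> {}" and st: "step \<epsilon> \<tau> F I"
begin

lemma step_finite: "finite I" and step_subset: "F \<subseteq> I"
  using st by (auto simp: step_def)

lemma step_red_le: "finite I' \<Longrightarrow> F \<subseteq> I' \<Longrightarrow> reduced_energy \<epsilon> \<tau> F I \<le> reduced_energy \<epsilon> \<tau> F I'"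
  using st by (auto simp: step_def)

lemma step_gap_le:
  assumes "i \<in> I"
  shows "gap \<phi> (pt \<epsilon> ` F) (pt \<epsilon> i) \<le> 4 * \<tau>"
proof (rule ccontr)
  let ?g = "\<lambda>i. gap \<phi> (pt \<epsilon> ` F) (pt \<epsilon> i)"
  assume far: "\<not> ?g i \<le> 4 * \<tau>"
  have iF: "i \<notin> F" using far e gap_eq_0_iff[of "pt \<epsilon> ` F" "pt \<epsilon> i"] F by auto
  have "reduced_energy \<epsilon> \<tau> F I \<le> reduced_energy \<epsilon> \<tau> F (I - {i})"
    by (rule step_red_le) (use step_finite step_subset iF in auto)
  moreover have "(\<Sum>j\<in>I - F. ?g j) = (\<Sum>j\<in>I - {i} - F. ?g j) + ?g i"
    using step_finite assms iF by (subst sum.remove[of _ i]) (auto intro!: sum.cong)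
  moreover have "real (card (bdry I)) \<le> card (bdry (I - {i})) + 4"
  proof -
    have "I \<inter> - {i} = I - {i}" "I - - {i} = {i}" using assms by auto
    then show ?thesis using card_bdry_restrict[OF step_finite, of "- {i}"] by simp
  qed
  moreover have "4 < ?g i / \<tau>" using far e by (simp add: field_simps)
  ultimately show False unfolding reduced_energy_def by (simp add: add_divide_distrib)
qed

lemma step_neighbour:
  assumes near: "gap \<phi> (pt \<epsilon> ` F) (pt \<epsilon> i) < 4 * \<tau>" and "i \<notin> I"
  shows "\<exists>j\<in>I. adj i j"
proof (rule ccontr)
  let ?g = "\<lambda>i. gap \<phi> (pt \<epsilon> ` F) (pt \<epsilon> i)"
  assume no: "\<not> (\<exists>j\<in>I. adj i j)"
  have "reduced_energy \<epsilon> \<tau> F I \<le> reduced_energy \<epsilon> \<tau> F (insert i I)"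
    by (rule step_red_le) (use step_finite step_subset in auto)
  moreover have "(\<Sum>j\<in>insert i I - F. ?g j) = (\<Sum>j\<in>I - F. ?g j) + ?g i"
  proof -
    have "insert i I - F = insert i (I - F)" using assms step_subset by auto
    then show ?thesis using assms step_finite by simp
  qed
  moreover have "card (bdry (insert i I)) = card (bdry I) + 4"
    using card_bdry_insert[OF step_finite assms(2)] no by blast
  moreover have "?g i / \<tau> < 4" using near e by (simp add: field_simps)
  ultimately show False unfolding reduced_energy_def by (simp add: add_divide_distrib)
qed

text \<open>Adding a cell with two neighbours in the new set gains no side, but costs dissipation.\<close>

lemma step_hole:
  assumes "i \<notin> F" "adj i j" "adj i l" "j \<noteq> l" "j \<in> I" "l \<in> I"
  shows "i \<notin> I"
proof
  let ?g = "\<lambda>i. gap \<phi> (pt \<epsilon> ` F) (pt \<epsilon> i)"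
  assume i: "i \<in> I"
  have "reduced_energy \<epsilon> \<tau> F I \<le> reduced_energy \<epsilon> \<tau> F (I - {i})"
    by (rule step_red_le) (use step_finite step_subset assms in auto)
  moreover have "(\<Sum>j\<in>I - F. ?g j) = (\<Sum>j\<in>I - {i} - F. ?g j) + ?g i"
    using step_finite assms i by (subst sum.remove[of _ i]) (auto intro!: sum.cong)
  moreover have "card (bdry I) \<le> card (bdry (I - {i}))"
    by (rule card_bdry_remove[OF step_finite i]) fact+
  moreover have "0 < ?g i / \<tau>"
  proof -
    have "?g i \<noteq> 0" "0 \<le> ?g i"
      using gap_eq_0_iff[of "pt \<epsilon> ` F" "pt \<epsilon> i"] gap_nonneg[of "pt \<epsilon> ` F"] F assms(1)
          pt_mem_image[OF e(1)] by simp_all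
    then show ?thesis using e by simp
  qed
  ultimately show False unfolding reduced_energy_def by (simp add: add_divide_distrib)
qed

end

end

section \<open>Motion of the front and Hausdorff limit\<close>

lemma hausdorff_distance_le:
  assumes "\<And>x. x \<in> A \<Longrightarrow> \<exists>y\<in>B. dist x y \<le> h" "\<And>y. y \<in> B \<Longrightarrow> \<exists>x\<in>A. dist x y \<le> h"
  shows "hausdorff_distance A B \<le> ennreal h"
  unfolding hausdorff_distance_def
proof (intro max.boundedI SUP_least)
  fix x assume "x \<in> A"
  then obtain y where "y \<in> B" "dist x y \<le> h" using assms(1) by blast
  then show "(INF y\<in>B. ennreal (dist x y)) \<le> ennreal h" by (intro INF_lower2[of y] ennreal_leI)
next
  fix y assume "y \<in> B"
  then obtain x where "x \<in> A" "dist x y \<le> h" using assms(2) by blast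
  then show "(INF x\<in>A. ennreal (dist x y)) \<le> ennreal h" by (intro INF_lower2[of x] ennreal_leI)
qed

lemma hausdorff_distance_lessD:
  assumes "hausdorff_distance A B < ennreal h"
  shows "x \<in> A \<Longrightarrow> \<exists>y\<in>B. dist x y < h" and "y \<in> B \<Longrightarrow> \<exists>x\<in>A. dist x y < h"
proof -
  have A: "(INF y\<in>B. ennreal (dist x y)) < ennreal h" if "x \<in> A"
    using assms that unfolding hausdorff_distance_def by (meson SUP_upper le_less_trans
        max.strict_boundedE)
  show "\<exists>y\<in>B. dist x y < h" if "x \<in> A"
    using A[OF that] by (auto simp: INF_less_iff ennreal_less_iff)
  have B: "(INF x\<in>A. ennreal (dist x y)) < ennreal h" if "y \<in> B"
    using assms that unfolding hausdorff_distance_def by (meson SUP_upper le_less_trans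
        max.strict_boundedE)
  show "\<exists>x\<in>A. dist x y < h" if "y \<in> B"
    using B[OF that] by (auto simp: INF_less_iff ennreal_less_iff)
qed

lemma hausdorff_distance_limits_eq_0:
  assumes "(\<lambda>n. hausdorff_distance (D n) A) \<longlonglongrightarrow> 0" "(\<lambda>n. hausdorff_distance (D n) B) \<longlonglongrightarrow> 0"
  shows "hausdorff_distance A B = 0"
proof -
  have "hausdorff_distance A B \<le> ennreal h" if h: "0 < h" for h
  proof -
    have "\<forall>\<^sub>F n in sequentially. hausdorff_distance (D n) A < ennreal (h / 2)"
      "\<forall>\<^sub>F n in sequentially. hausdorff_distance (D n) B < ennreal (h / 2)"
      using h by (intro order_tendstoD(2)[OF assms(1)] order_tendstoD(2)[OF assms(2)]; simp)+
    then have "\<forall>\<^sub>F n in sequentially. hausdorff_distance (D n) A < ennreal (h / 2) \<and>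
        hausdorff_distance (D n) B < ennreal (h / 2)"
      by (rule eventually_conj)
    then obtain n where n: "hausdorff_distance (D n) A < ennreal (h / 2)" "hausdorff_distance (D
        n) B < ennreal (h / 2)"
      by (auto dest: eventually_happens)
    show ?thesis
    proof (rule hausdorff_distance_le)
      fix x assume "x \<in> A"
      then obtain z where z: "z \<in> D n" "dist z x < h / 2" using hausdorff_distance_lessD(2)[OF
          n(1)] by blast
      then obtain y where "y \<in> B" "dist z y < h / 2" using hausdorff_distance_lessD(1)[OF n(2)] by blast
      then show "\<exists>y\<in>B. dist x y \<le> h" using dist_triangle[of x y z] z(2) by (intro bexI[of _ y])
          (auto simp: dist_commute)
    next
      fix y assume "y \<in> B"
      then obtain z where z: "z \<in> D n" "dist z y < h / 2" using hausdorff_distance_lessD(2)[OF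
          n(2)] by blast
      then obtain x where "x \<in> A" "dist z x < h / 2" using hausdorff_distance_lessD(1)[OF n(1)] by blast
      then show "\<exists>x\<in>A. dist x y \<le> h" using dist_triangle[of x y z] z(2) by (intro bexI[of _ x])
          (auto simp: dist_commute)
    qed
  qed
  then have "hausdorff_distance A B \<le> 0 + ennreal h" if "0 < h" for h using that by simp
  then have "hausdorff_distance A B \<le> 0" by (rule ennreal_le_epsilon)
  then show ?thesis by simp
qed

text \<open>The index of the half-open cell that contains \<open>x\<close>.\<close>

definition idx :: "real \<Rightarrow> plane \<Rightarrow> index" where
  "idx \<epsilon> x = (round (fst x / \<epsilon>), round (snd x / \<epsilon>))"

lemma plane_norm_le: "norm (x :: plane) \<le> \<bar>fst x\<bar> + \<bar>snd x\<bar>"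
  using norm_Pair_le[of "fst x" "snd x"] by simp

lemma norm_pt_diff_le: "0 \<le> \<epsilon> \<Longrightarrow> norm (pt \<epsilon> i - pt \<epsilon> j) \<le> \<epsilon> * of_int (\<bar>fst i - fst j\<bar> + \<bar>snd i - snd j\<bar>)"
proof -
  assume "0 \<le> \<epsilon>"
  then have "\<bar>fst (pt \<epsilon> i - pt \<epsilon> j)\<bar> + \<bar>snd (pt \<epsilon> i - pt \<epsilon> j)\<bar> = \<epsilon> * of_int (\<bar>fst i - fst j\<bar> +
      \<bar>snd i - snd j\<bar>)"
    by (simp add: pt_def distrib_left abs_mult_pos' right_diff_distrib)
  then show ?thesis using plane_norm_le[of "pt \<epsilon> i - pt \<epsilon> j"] by simp
qed

lemma mem_cell_idx: "0 < \<epsilon> \<Longrightarrow> x \<in> cell \<epsilon> (pt \<epsilon> (idx \<epsilon> x))"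
  using of_int_round_abs_le[of "fst x / \<epsilon>"] of_int_round_abs_le[of "snd x / \<epsilon>"]
  by (simp add: mem_cell_scaled idx_def abs_minus_commute)

lemma norm_diff_pt_le: "x \<in> cell \<epsilon> (pt \<epsilon> i) \<Longrightarrow> norm (x - pt \<epsilon> i) \<le> \<epsilon>"
proof -
  assume "x \<in> cell \<epsilon> (pt \<epsilon> i)"
  then have "\<bar>fst (x - pt \<epsilon> i)\<bar> \<le> \<epsilon> / 2" "\<bar>snd (x - pt \<epsilon> i)\<bar> \<le> \<epsilon> / 2"
    unfolding mem_cell_pt by (simp_all add: pt_def)
  then show ?thesis using plane_norm_le[of "x - pt \<epsilon> i"] by linarith
qed

lemma (in plane_norm) shrink:
  assumes "0 \<le> c"
  obtains y where "\<phi> y \<le> c" "\<phi> (x - y) \<le> max 0 (\<phi> x - c)"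
proof (cases "\<phi> x \<le> c")
  case True
  then show ?thesis using that[of x] by simp
next
  case False
  then have p: "0 < \<phi> x" "c < \<phi> x" using assms by auto
  have "\<phi> ((c / \<phi> x) *\<^sub>R x) = c" using p assms by (simp add: scale)
  moreover have "\<phi> (x - (c / \<phi> x) *\<^sub>R x) = \<phi> x - c"
  proof -
    have "x - (c / \<phi> x) *\<^sub>R x = (1 - c / \<phi> x) *\<^sub>R x" by (simp add: algebra_simps)
    then have "\<phi> (x - (c / \<phi> x) *\<^sub>R x) = \<bar>1 - c / \<phi> x\<bar> * \<phi> x" by (simp only: scale)
    also have "\<bar>1 - c / \<phi> x\<bar> = 1 - c / \<phi> x" using p by simp
    also have "(1 - c / \<phi> x) * \<phi> x = \<phi> x - c" using p by (simp add: left_diff_distrib)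
    finally show ?thesis .
  qed
  ultimately show ?thesis using that[of "(c / \<phi> x) *\<^sub>R x"] by simp
qed

text \<open>A run of the scheme, in terms of index sets.\<close>

locale step_sequence = plane_norm +
  fixes \<epsilon> \<tau> :: real and I :: "nat \<Rightarrow> index set"
  assumes eps: "0 < \<epsilon>" and tau: "0 < \<tau>" and I0: "I 0 = {(0, 0)}"
    and step: "\<And>k. step \<epsilon> \<tau> (I k) (I (Suc k))"
begin

text \<open>The \<open>\<phi>\<close>-distance to the centres of the cells of the \<open>k\<close>-th set.\<close>

definition d :: "nat \<Rightarrow> plane \<Rightarrow> real" where
  "d k = gap \<phi> (pt \<epsilon> ` I k)"

lemma I_fin: "finite (I k)" and I_ne: "I k \<noteq> {}"
proof -
  have "finite (I k) \<and> I k \<noteq> {}" using step by (induction k) (auto simp: I0 step_def)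
  then show "finite (I k)" "I k \<noteq> {}" by auto
qed

lemma pts_fin: "finite (pt \<epsilon> ` I k)" and pts_ne: "pt \<epsilon> ` I k \<noteq> {}"
  using I_fin[of k] I_ne[of k] by simp_all

lemma I_mono: "j \<le> k \<Longrightarrow> I j \<subseteq> I k"
  by (rule lift_Suc_mono_le[of I]) (use step step_def in blast)+

lemma d_antimono: "j \<le> k \<Longrightarrow> d k x \<le> d j x"
  unfolding d_def by (intro gap_antimono pts_ne pts_fin image_mono I_mono)

lemma d_nonneg: "0 \<le> d k x"
  unfolding d_def by (rule gap_nonneg[OF pts_ne])

lemma d_lipschitz: "d k x \<le> d k y + \<phi> (x - y)"
  unfolding d_def by (rule gap_lipschitz[OF pts_fin pts_ne])

lemma d_attained: obtains i where "i \<in> I k" "d k x = \<phi> (x - pt \<epsilon> i)"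
proof -
  obtain p where "p \<in> pt \<epsilon> ` I k" "gap \<phi> (pt \<epsilon> ` I k) x = \<phi> (x - p)"
    by (rule gap_attained[OF pts_fin pts_ne])
  then show thesis using that unfolding d_def by auto
qed

lemma d_le: "i \<in> I k \<Longrightarrow> d k x \<le> \<phi> (x - pt \<epsilon> i)"
  unfolding d_def by (intro gap_le imageI)

lemma d_pt_eq_0_iff: "d k (pt \<epsilon> i) = 0 \<longleftrightarrow> i \<in> I k"
  unfolding d_def by (simp only: gap_eq_0_iff[OF pts_fin pts_ne] pt_mem_image[OF eps])

lemma phi_idx: "\<phi> (x - pt \<epsilon> (idx \<epsilon> x)) \<le> kap * \<epsilon>"
proof -
  have "\<phi> (x - pt \<epsilon> (idx \<epsilon> x)) \<le> kap * norm (x - pt \<epsilon> (idx \<epsilon> x))" by (rule le_kap)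
  also have "\<dots> \<le> kap * \<epsilon>"
    using norm_diff_pt_le[OF mem_cell_idx[OF eps]] kap_ge1 by (intro mult_left_mono) auto
  finally show ?thesis .
qed

text \<open>The \<open>k\<close>-th step fills everything closer than about \<open>4 \<tau>\<close>, up to holes of size \<open>O(\<epsilon>)\<close>.\<close>

lemma d_Suc_small:
  assumes "d k x < 4 * \<tau> - kap * \<epsilon>"
  shows "d (Suc k) x \<le> 2 * kap * \<epsilon>"
proof -
  define i where "i = idx \<epsilon> x"
  have xi: "\<phi> (x - pt \<epsilon> i) \<le> kap * \<epsilon>" unfolding i_def by (rule phi_idx)
  have "d k (pt \<epsilon> i) < 4 * \<tau>"
    using d_lipschitz[of k "pt \<epsilon> i" x] sym[of x "pt \<epsilon> i"] xi assms by linarith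
  then have "i \<in> I (Suc k) \<or> (\<exists>j\<in>I (Suc k). adj i j)"
    using step_neighbour[OF eps tau I_fin I_ne step, of k i] unfolding d_def by blast
  then show ?thesis
  proof
    assume "i \<in> I (Suc k)"
    then have "d (Suc k) x \<le> kap * \<epsilon>" using d_le[of i "Suc k" x] xi by simp
    moreover have "0 \<le> kap * \<epsilon>" using kap_ge1 eps by simp
    ultimately show ?thesis by linarith
  next
    assume "\<exists>j\<in>I (Suc k). adj i j"
    then obtain j where j: "j \<in> I (Suc k)" "adj i j" by blast
    have "norm (pt \<epsilon> i - pt \<epsilon> j) \<le> \<epsilon>"
      using norm_pt_diff_le[of \<epsilon> i j] eps j(2) unfolding adj_def by (simp only: of_int_1
          mult_1_right less_imp_le)
    then have "kap * norm (pt \<epsilon> i - pt \<epsilon> j) \<le> kap * \<epsilon>" using kap_ge1 by (intro mult_left_mono) auto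
    then have "\<phi> (pt \<epsilon> i - pt \<epsilon> j) \<le> kap * \<epsilon>" using le_kap[of "pt \<epsilon> i - pt \<epsilon> j"] by linarith
    then show ?thesis using d_le[OF j(1), of x] triangle_diff[of x "pt \<epsilon> j" "pt \<epsilon> i"] xi by linarith
  qed
qed

lemma d_Suc_ge: "d k x \<le> d (Suc k) x + 4 * \<tau>"
proof -
  obtain i where i: "i \<in> I (Suc k)" "d (Suc k) x = \<phi> (x - pt \<epsilon> i)" by (rule d_attained)
  have "d k (pt \<epsilon> i) \<le> 4 * \<tau>"
    using step_gap_le[OF eps tau I_fin I_ne step i(1)] by (simp add: d_def)
  then show ?thesis using d_lipschitz[of k x "pt \<epsilon> i"] i(2) by linarith
qed

lemma d_0: "d 0 x = \<phi> x"
proof -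
  obtain i where "i \<in> I 0" "d 0 x = \<phi> (x - pt \<epsilon> i)" by (rule d_attained)
  moreover have "pt \<epsilon> (0, 0) = 0" by (simp add: pt_def zero_prod_def)
  ultimately show ?thesis by (simp add: I0)
qed

lemma phi_le_d: "\<phi> x \<le> d k x + 4 * \<tau> * k"
proof (induction k)
  case 0
  then show ?case by (simp add: d_0)
next
  case (Suc k)
  then show ?case using d_Suc_ge[of k x] by (simp add: algebra_simps)
qed

lemma phi_pt_le: "i \<in> I k \<Longrightarrow> \<phi> (pt \<epsilon> i) \<le> 4 * \<tau> * k"
  using phi_le_d[of "pt \<epsilon> i" k] d_pt_eq_0_iff[of k i] by simp

text \<open>The front advances by at least \<open>4 \<tau> - 4 kap \<epsilon>\<close> per step: go from the origin towards \<open>x\<close> in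
  pieces of that length.\<close>

lemma d_small:
  assumes small: "kap * \<epsilon> \<le> \<tau>" and x: "\<phi> x \<le> k * (4 * \<tau> - 4 * kap * \<epsilon>)"
  shows "d k x \<le> 2 * kap * \<epsilon>"
  using x
proof (induction k arbitrary: x)
  case 0
  then show ?case using nonneg[of x] kap_ge1 eps by (simp add: d_0)
next
  case (Suc k)
  let ?s = "4 * \<tau> - 4 * kap * \<epsilon>"
  have s0: "0 \<le> ?s" using small by simp
  obtain y where y: "\<phi> y \<le> k * ?s" "\<phi> (x - y) \<le> max 0 (\<phi> x - k * ?s)"
    using shrink[of "k * ?s" x] s0 by auto
  have "\<phi> x - k * ?s \<le> ?s" using Suc.prems by (simp add: algebra_simps)
  then have "\<phi> (x - y) \<le> ?s" using y(2) s0 by simp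
  then have "d k x \<le> 2 * kap * \<epsilon> + ?s" using d_lipschitz[of k x y] Suc.IH[OF y(1)] by linarith
  moreover have "0 < kap * \<epsilon>" using kap_ge1 eps by simp
  ultimately show ?case by (intro d_Suc_small) (simp add: algebra_simps)
qed

lemma hausdorff_cells_ball:
  assumes small: "kap * \<epsilon> \<le> \<tau>" and t: "0 \<le> t" and k: "k = nat \<lfloor>t / \<tau>\<rfloor>"
  shows "hausdorff_distance (cells \<epsilon> (I k)) (norm_ball \<phi> (4 * t))
    \<le> ennreal (\<epsilon> + 4 * kap * t * \<epsilon> + kap * (4 * \<tau> + 4 * kap * t * (\<epsilon> / \<tau>) + 2 * kap * \<epsilon>))"
proof -
  have "0 \<le> t / \<tau>" using t tau by simp
  then have "real k = of_int \<lfloor>t / \<tau>\<rfloor>" unfolding k by simp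
  then have "real k \<le> t / \<tau>" "t / \<tau> < real k + 1" by linarith+
  then have k1: "\<tau> * k \<le> t" and k2: "t < \<tau> * k + \<tau>" using tau by (simp_all add: field_simps)
  show ?thesis
  proof (rule hausdorff_distance_le)
    have nn: "0 \<le> kap * (4 * \<tau> + 4 * kap * t * (\<epsilon> / \<tau>) + 2 * kap * \<epsilon>)" "0 \<le> 4 * kap * t * \<epsilon>"
      using kap_ge1 tau eps t by auto
    fix y assume "y \<in> cells \<epsilon> (I k)"
    then obtain i where i: "i \<in> I k" "y \<in> cell \<epsilon> (pt \<epsilon> i)" unfolding cells_def by blast
    have yi: "norm (y - pt \<epsilon> i) \<le> \<epsilon>" by (rule norm_diff_pt_le[OF i(2)])
    have pi: "\<phi> (pt \<epsilon> i) \<le> 4 * t" using phi_pt_le[OF i(1)] k1 by linarith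
    show "\<exists>x\<in>norm_ball \<phi> (4 * t). dist y x \<le> \<epsilon> + 4 * kap * t * \<epsilon> + kap * (4 * \<tau> + 4 * kap * t * (\<epsilon>
        / \<tau>) + 2 * kap * \<epsilon>)"
    proof (cases "t = 0")
      case True
      then have "pt \<epsilon> i = 0" using pi nonneg[of "pt \<epsilon> i"] zero_iff by simp
      then show ?thesis using yi nn True by (intro bexI[of _ 0]) (auto simp: norm_ball_def dist_norm)
    next
      case False
      then have t0: "0 < t" using t by simp
      define c where "c = min \<epsilon> 1"
      have c: "0 < c" "c \<le> 1" "c \<le> \<epsilon>" using eps by (auto simp: c_def)
      define z where "z = (1 - c) *\<^sub>R pt \<epsilon> i"
      have "\<phi> z = (1 - c) * \<phi> (pt \<epsilon> i)" using c by (simp add: z_def scale)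
      also have "\<dots> \<le> (1 - c) * (4 * t)" using c pi by (intro mult_left_mono) auto
      also have "\<dots> < 4 * t" using c t0 by (simp add: algebra_simps)
      finally have "z \<in> norm_ball \<phi> (4 * t)" using t0 by (simp add: norm_ball_def)
      moreover have "norm (pt \<epsilon> i - z) \<le> 4 * kap * t * \<epsilon>"
      proof -
        have "pt \<epsilon> i - z = c *\<^sub>R pt \<epsilon> i" by (simp add: z_def algebra_simps)
        then have "norm (pt \<epsilon> i - z) = c * norm (pt \<epsilon> i)" using c by simp
        also have "\<dots> \<le> \<epsilon> * (kap * (4 * t))"
        proof (rule mult_mono)
          have "kap * \<phi> (pt \<epsilon> i) \<le> kap * (4 * t)" using pi kap_ge1 by (intro mult_left_mono) auto
          then show "norm (pt \<epsilon> i) \<le> kap * (4 * t)" using norm_le_kap[of "pt \<epsilon> i"] by linarith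
        qed (use c eps in auto)
        finally show ?thesis by (simp add: algebra_simps)
      qed
      moreover have "dist y z \<le> norm (y - pt \<epsilon> i) + norm (pt \<epsilon> i - z)"
        using norm_triangle_ineq[of "y - pt \<epsilon> i" "pt \<epsilon> i - z"] by (simp add: dist_norm)
      ultimately show ?thesis using yi nn by (intro bexI[of _ z]) auto
    qed
  next
    fix x assume "x \<in> norm_ball \<phi> (4 * t)"
    then have x: "\<phi> x \<le> 4 * t" by (auto simp: norm_ball_def split: if_splits)
    let ?s = "4 * \<tau> - 4 * kap * \<epsilon>"
    have s0: "0 \<le> k * ?s" using small by simp
    obtain y where y: "\<phi> y \<le> k * ?s" "\<phi> (x - y) \<le> max 0 (\<phi> x - k * ?s)"
      using shrink[OF s0, of x] by auto
    have "k * (kap * \<epsilon>) \<le> t / \<tau> * (kap * \<epsilon>)"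
      using k1 kap_ge1 eps tau by (intro mult_right_mono) (auto simp: field_simps)
    then have "4 * t - k * ?s \<le> 4 * \<tau> + 4 * kap * t * (\<epsilon> / \<tau>)"
    proof -
      assume "k * (kap * \<epsilon>) \<le> t / \<tau> * (kap * \<epsilon>)"
      moreover have "4 * kap * t * (\<epsilon> / \<tau>) = 4 * (t / \<tau> * (kap * \<epsilon>))" by simp
      moreover have "k * ?s = 4 * (\<tau> * k) - 4 * (k * (kap * \<epsilon>))" by (simp add: algebra_simps)
      ultimately show ?thesis using k2 by linarith
    qed
    moreover have "0 \<le> 4 * \<tau> + 4 * kap * t * (\<epsilon> / \<tau>)" using kap_ge1 tau eps t by simp
    ultimately have xy: "\<phi> (x - y) \<le> 4 * \<tau> + 4 * kap * t * (\<epsilon> / \<tau>)" using y(2) x by simp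
    obtain i where i: "i \<in> I k" "d k y = \<phi> (y - pt \<epsilon> i)" by (rule d_attained)
    have "\<phi> (y - pt \<epsilon> i) \<le> 2 * kap * \<epsilon>" using d_small[OF small y(1)] i(2) by simp
    then have xi: "\<phi> (x - pt \<epsilon> i) \<le> 4 * \<tau> + 4 * kap * t * (\<epsilon> / \<tau>) + 2 * kap * \<epsilon>"
      using xy triangle_diff[of x "pt \<epsilon> i" y] by linarith
    have "norm (x - pt \<epsilon> i) \<le> kap * (4 * \<tau> + 4 * kap * t * (\<epsilon> / \<tau>) + 2 * kap * \<epsilon>)"
      using norm_le_kap[of "x - pt \<epsilon> i"] mult_left_mono[OF xi, of kap] kap_ge1 by linarith
    moreover have "pt \<epsilon> i \<in> cells \<epsilon> (I k)" using i(1) by (simp add: pt_mem_cells[OF eps])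
    moreover have "0 \<le> \<epsilon> + 4 * kap * t * \<epsilon>" using kap_ge1 eps t by simp
    ultimately show "\<exists>y\<in>cells \<epsilon> (I k). dist y x \<le> \<epsilon> + 4 * kap * t * \<epsilon> + kap * (4 * \<tau> + 4 * kap * t
        * (\<epsilon> / \<tau>) + 2 * kap * \<epsilon>)"
      by (intro bexI[of _ "pt \<epsilon> i"]) (auto simp: dist_norm norm_minus_commute)
  qed
qed

end

context plane_norm
begin

lemma discrete_solution_step_sequence:
  assumes "0 < \<epsilon>" "0 < \<tau>" "discrete_solution \<phi> \<epsilon> \<tau> D"
  obtains I where "step_sequence \<phi> \<epsilon> \<tau> I" "\<And>t. 0 \<le> t \<Longrightarrow> D t = cells \<epsilon> (I (nat \<lfloor>t / \<tau>\<rfloor>))"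
proof -
  obtain S where S: "scheme \<phi> \<epsilon> \<tau> S" "\<And>t. 0 \<le> t \<Longrightarrow> D t = S (nat \<lfloor>t / \<tau>\<rfloor>)"
    using assms(3) by (auto simp: discrete_solution_def)
  obtain I where I: "I 0 = {(0, 0)}" "\<And>k. S k = cells \<epsilon> (I k)" "\<And>k. finite (I k)"
    "\<And>k. step \<epsilon> \<tau> (I k) (I (Suc k))"
    using scheme_imp_steps[OF assms(1,2) S(1)] by blast
  show thesis
  proof (rule that[of I])
    show "step_sequence \<phi> \<epsilon> \<tau> I" by unfold_locales (use assms I in auto)
    show "D t = cells \<epsilon> (I (nat \<lfloor>t / \<tau>\<rfloor>))" if "0 \<le> t" for t using S(2)[OF that] I(2) by simp
  qed
qed

lemma hausdorff_discrete_solution_tendsto: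
  assumes reg: "regime \<epsilon> \<tau>" and D: "\<And>n. discrete_solution \<phi> (\<epsilon> n) (\<tau> n) (D n)" and t: "0 \<le> t"
  shows "(\<lambda>n. hausdorff_distance (D n t) (norm_ball \<phi> (4 * t))) \<longlonglongrightarrow> 0"
proof -
  have pos: "0 < \<epsilon> n" "0 < \<tau> n" for n
    using reg by (auto simp: regime_def)
  have lim: "\<epsilon> \<longlonglongrightarrow> 0" "\<tau> \<longlonglongrightarrow> 0" "(\<lambda>n. \<epsilon> n / \<tau> n) \<longlonglongrightarrow> 0"
    using reg by (auto simp: regime_def)
  let ?b = "\<lambda>n. \<epsilon> n + 4 * kap * t * \<epsilon> n + kap * (4 * \<tau> n + 4 * kap * t * (\<epsilon> n / \<tau> n) + 2 * kap * \<epsilon> n)"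
  have "(\<lambda>n. ennreal (?b n)) \<longlonglongrightarrow> ennreal (0 + 4 * kap * t * 0 + kap * (4 * 0 + 4 * kap * t * 0 + 2 *
      kap * 0))"
    by (intro tendsto_ennrealI tendsto_intros lim)
  then have b: "(\<lambda>n. ennreal (?b n)) \<longlonglongrightarrow> 0" by simp
  have "\<forall>\<^sub>F n in sequentially. \<epsilon> n / \<tau> n < 1 / kap"
    using kap_ge1 by (intro order_tendstoD(2)[OF lim(3)]) auto
  then have ev: "\<forall>\<^sub>F n in sequentially. hausdorff_distance (D n t) (norm_ball \<phi> (4 * t)) \<le> ennreal
      (?b n)"
  proof eventually_elim
    case (elim n)
    then have small: "kap * \<epsilon> n \<le> \<tau> n" using kap_ge1 pos[of n] by (simp add: field_simps)
    obtain I where I: "step_sequence \<phi> (\<epsilon> n) (\<tau> n) I" "\<And>t. 0 \<le> t \<Longrightarrow> D n t = cells (\<epsilon> n) (I (nat \<lfloor>t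
        / \<tau> n\<rfloor>))"
      using discrete_solution_step_sequence[OF pos D] by blast
    show ?case unfolding I(2)[OF t] by (rule step_sequence.hausdorff_cells_ball[OF I(1) small t refl])
  qed
  show ?thesis
    by (rule tendsto_sandwich[OF _ ev tendsto_const b]) simp
qed

end

section \<open>Area of distance shells\<close>

context plane_norm
begin

lemma continuous_on_gap:
  assumes "finite P" "P \<noteq> {}"
  shows "continuous_on UNIV (gap \<phi> P)"
proof (rule continuous_onI)
  fix x e :: real and x0 :: plane assume "0 < e"
  show "\<exists>d>0. \<forall>x'\<in>UNIV. dist x' x0 < d \<longrightarrow> dist (gap \<phi> P x') (gap \<phi> P x0) \<le> e"
  proof (intro exI[of _ "e / kap"] conjI ballI impI)
    fix x' assume "dist x' x0 < e / kap"
    then have "kap * norm (x' - x0) < e" using kap_ge1 by (simp add: dist_norm field_simps)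
    then have "\<phi> (x' - x0) < e" using le_kap[of "x' - x0"] by linarith
    then show "dist (gap \<phi> P x') (gap \<phi> P x0) \<le> e"
      using gap_lipschitz[OF assms, of x' x0] gap_lipschitz[OF assms, of x0 x'] sym[of x' x0]
      by (simp add: dist_real_def abs_le_iff)
  qed (use \<open>0 < e\<close> kap_ge1 in simp)
qed

text \<open>The points at distance in \<open>(a, b]\<close> from \<open>P\<close>.\<close>

definition shell :: "plane set \<Rightarrow> real \<Rightarrow> real \<Rightarrow> plane set" where
  "shell P a b = {x. a < gap \<phi> P x \<and> gap \<phi> P x \<le> b}"

lemma shell_borel:
  assumes "finite P" "P \<noteq> {}"
  shows "shell P a b \<in> sets borel"
proof -
  have [measurable]: "gap \<phi> P \<in> borel_measurable borel"
    by (rule borel_measurable_continuous_onI[OF continuous_on_gap[OF assms]])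
  show ?thesis unfolding shell_def by measurable
qed

lemma shell_lmeasurable:
  assumes "finite P" "P \<noteq> {}"
  shows "shell P a b \<in> lmeasurable"
proof (rule bounded_set_imp_lmeasurable)
  obtain R where R: "\<And>p. p \<in> P \<Longrightarrow> norm p \<le> R"
    using finite_imp_bounded[OF assms(1)] by (auto simp: bounded_iff)
  show "bounded (shell P a b)"
    unfolding bounded_iff
  proof (intro exI ballI)
    fix x assume x: "x \<in> shell P a b"
    obtain p where p: "p \<in> P" "gap \<phi> P x = \<phi> (x - p)" using gap_attained[OF assms] .
    have "norm x \<le> norm p + norm (x - p)" using norm_triangle_ineq[of p "x - p"] by simp
    also have "\<dots> \<le> R + kap * b"
    proof (rule add_mono)
      have "norm (x - p) \<le> kap * \<phi> (x - p)" by (rule norm_le_kap)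
      also have "\<dots> \<le> kap * b" using x p kap_ge1 by (intro mult_left_mono) (auto simp: shell_def)
      finally show "norm (x - p) \<le> kap * b" .
    qed (rule R[OF p(1)])
    finally show "norm x \<le> R + kap * b" .
  qed
qed (use shell_borel[OF assms] in simp)

text \<open>On the Voronoi cell of \<open>p\<close>, contraction towards \<open>p\<close> by the factor \<open>k\<close> divides the distance
  to \<open>P\<close> by \<open>k\<close> and does not leave the cell.\<close>

lemma emeasure_shell_scale:
  assumes P: "finite P" "P \<noteq> {}" and l: "1 \<le> k"
  shows "emeasure lebesgue (shell P (k * a) (k * b)) \<le> ennreal (k\<^sup>2) * emeasure lebesgue (shell P a b)"
proof -
  obtain p where p: "bij_betw p {0..<card P} P" using ex_bij_betw_nat_finite[OF P(1)] by blast
  define m where "m = card P"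
  have pP: "p i \<in> P" if "i < m" for i using bij_betwE[OF p] that by (simp add: m_def)
  have Pp: "\<exists>i<m. q = p i" if "q \<in> P" for q
    using bij_betw_imp_surj_on[OF p] that by (metis atLeastLessThan_iff imageE m_def)
  \<comment> \<open>Voronoi cells, made disjoint by choosing the first among the nearest points\<close>
  define V where "V i = {x. gap \<phi> P x = \<phi> (x - p i) \<and> (\<forall>j<i. gap \<phi> P x < \<phi> (x - p j))}" for i
  have V_borel: "V i \<in> sets borel" for i
  proof -
    have [measurable]: "gap \<phi> P \<in> borel_measurable borel"
      by (rule borel_measurable_continuous_onI[OF continuous_on_gap[OF P]])
    have [measurable]: "(\<lambda>x. \<phi> (x - p j)) \<in> borel_measurable borel" for j
      by (intro borel_measurable_continuous_onI continuous_on_compose2[OF continuous]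
          continuous_intros) auto
    show ?thesis unfolding V_def by measurable
  qed
  have V_cover: "\<exists>i<m. x \<in> V i" for x
  proof -
    obtain q where "q \<in> P" "gap \<phi> P x = \<phi> (x - q)" using gap_attained[OF P] .
    then obtain n where n: "n < m" "gap \<phi> P x = \<phi> (x - p n)" using Pp by blast
    define i where "i = (LEAST i. gap \<phi> P x = \<phi> (x - p i))"
    have i: "gap \<phi> P x = \<phi> (x - p i)" unfolding i_def by (rule LeastI) (rule n(2))
    have im: "i \<le> n" unfolding i_def by (rule Least_le) (rule n(2))
    have lt: "gap \<phi> P x < \<phi> (x - p j)" if "j < i" for j
    proof -
      have "gap \<phi> P x \<noteq> \<phi> (x - p j)" using not_less_Least that unfolding i_def by blast
      moreover have "gap \<phi> P x \<le> \<phi> (x - p j)" using that im n(1) by (intro gap_le pP) simp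
      ultimately show ?thesis by simp
    qed
    have "x \<in> V i" unfolding V_def using i lt by blast
    moreover have "i < m" using im n(1) by simp
    ultimately show ?thesis by blast
  qed
  have V_disj: "disjoint_family_on V {..<m}"
    unfolding disjoint_family_on_def
  proof (intro ballI impI equals0I)
    fix i j x assume "i \<noteq> j" "x \<in> V i \<inter> V j"
    then show False by (cases i j rule: linorder_cases) (auto simp: V_def)
  qed
  have split: "emeasure lebesgue (shell P c d) = (\<Sum>i<m. emeasure lebesgue (shell P c d \<inter> V i))" for c d
  proof -
    have "(\<Sum>i<m. emeasure lebesgue (shell P c d \<inter> V i)) = emeasure lebesgue (\<Union>i<m. shell P c d \<inter> V i)"
      by (rule sum_emeasure) (use V_disj V_borel shell_borel[OF P] in \<open>auto simp:
          disjoint_family_on_def\<close>)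
    also have "(\<Union>i<m. shell P c d \<inter> V i) = shell P c d" using V_cover by auto
    finally show ?thesis by simp
  qed
  have piece: "emeasure lebesgue (shell P (k * a) (k * b) \<inter> V i) \<le> ennreal (k\<^sup>2) * emeasure
      lebesgue (shell P a b \<inter> V i)"
    if i: "i < m" for i
  proof -
    define g where "g = (\<lambda>x. (1 / k) *\<^sub>R x + (1 - 1 / k) *\<^sub>R p i)"
    let ?T = "shell P (k * a) (k * b) \<inter> V i"
    have "g ` ?T \<subseteq> shell P a b \<inter> V i"
    proof (rule image_subsetI)
      fix x assume x: "x \<in> ?T"
      then have xg: "gap \<phi> P x = \<phi> (x - p i)" by (simp add: V_def)
      have "g x - p i = (1 / k) *\<^sub>R (x - p i)" by (simp add: g_def algebra_simps)
      then have gp: "\<phi> (g x - p i) = gap \<phi> P x / k" using l by (simp add: scale xg)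
      have "x - g x = (1 - 1 / k) *\<^sub>R (x - p i)" by (simp add: g_def algebra_simps)
      then have xgx: "\<phi> (x - g x) = (1 - 1 / k) * gap \<phi> P x" using l by (simp add: scale xg)
      have far: "\<phi> (x - q) - gap \<phi> P x + gap \<phi> P x / k \<le> \<phi> (g x - q)" for q
        using triangle_diff[of x q "g x"] by (simp add: xgx algebra_simps)
      have "gap \<phi> P x / k \<le> gap \<phi> P (g x)"
      proof -
        obtain q where q: "q \<in> P" "gap \<phi> P (g x) = \<phi> (g x - q)" using gap_attained[OF P] .
        then show ?thesis using far[of q] gap_le[OF q(1), of x] by simp
      qed
      moreover have "gap \<phi> P (g x) \<le> gap \<phi> P x / k" using gap_le[OF pP[OF i], of "g x"] gp by simp
      ultimately have gg: "gap \<phi> P (g x) = gap \<phi> P x / k" by simp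
      have "g x \<in> V i"
        unfolding V_def
      proof (intro CollectI conjI allI impI)
        show "gap \<phi> P (g x) = \<phi> (g x - p i)" using gg gp by simp
        fix j assume "j < i"
        then have "gap \<phi> P x < \<phi> (x - p j)" using x unfolding V_def by blast
        then show "gap \<phi> P (g x) < \<phi> (g x - p j)" using far[of "p j"] gg by simp
      qed
      moreover have "g x \<in> shell P a b"
        using x l by (simp add: shell_def gg field_simps)
      ultimately show "g x \<in> shell P a b \<inter> V i" by blast
    qed
    then have "emeasure lebesgue (g ` ?T) \<le> emeasure lebesgue (shell P a b \<inter> V i)"
      using shell_borel[OF P] V_borel by (intro emeasure_mono) auto
    moreover have "emeasure lebesgue (g ` ?T) = ennreal ((1 / k)\<^sup>2) * emeasure lebesgue ?T"
      unfolding g_def using l by (subst emeasure_lebesgue_affine) (simp add: power2_eq_square)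
    ultimately have "ennreal (k\<^sup>2) * (ennreal ((1 / k)\<^sup>2) * emeasure lebesgue ?T)
        \<le> ennreal (k\<^sup>2) * emeasure lebesgue (shell P a b \<inter> V i)"
      by (intro mult_left_mono) auto
    moreover have "ennreal (k\<^sup>2) * (ennreal ((1 / k)\<^sup>2) * emeasure lebesgue ?T) = emeasure lebesgue ?T"
    proof -
      have "ennreal (k\<^sup>2) * ennreal ((1 / k)\<^sup>2) = 1"
        using l by (simp add: power_one_over flip: ennreal_mult)
      then show ?thesis by (simp flip: mult.assoc)
    qed
    ultimately show ?thesis by simp
  qed
  show ?thesis
    unfolding split[of "k * a"] split[of a] sum_distrib_left
    by (rule sum_mono) (use piece in simp)
qed

lemma measure_shell_scale:
  assumes P: "finite P" "P \<noteq> {}" and l: "1 \<le> k"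
  shows "measure lebesgue (shell P (k * a) (k * b)) \<le> k\<^sup>2 * measure lebesgue (shell P a b)"
proof -
  have "ennreal (measure lebesgue (shell P (k * a) (k * b))) \<le> ennreal (k\<^sup>2) * ennreal (measure
      lebesgue (shell P a b))"
    using emeasure_shell_scale[OF assms, of a b]
    unfolding emeasure_eq_measure2[OF shell_lmeasurable[OF P]] .
  then have "ennreal (measure lebesgue (shell P (k * a) (k * b))) \<le> ennreal (k\<^sup>2 * measure
      lebesgue (shell P a b))"
    by (subst ennreal_mult) auto
  then show ?thesis by (subst (asm) ennreal_le_iff) auto
qed

text \<open>Contracting the shell by the factors \<open>s ^ (2 * m)\<close>, \<open>1 \<le> m \<le> M\<close>, gives disjoint shells
  with distances in \<open>(r / 8, r / s]\<close>, each with at least \<open>1 / 16\<close> of the original area.\<close>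

lemma measure_shell_small:
  assumes P: "finite P" "P \<noteq> {}" and r: "0 < r" and s: "1 < s" "s ^ (2 * M) \<le> 4" and M: "1 \<le> M"
  shows "M * measure lebesgue (shell P (r / s) (r * s)) \<le> 16 * measure lebesgue (shell P (r / 8)
      (r / s))"
proof -
  define A where "A m = shell P (r / s / s ^ (2 * m)) (r * s / s ^ (2 * m))" for m
  have s0: "0 < s" using s by simp
  have le4: "s ^ (2 * m) \<le> 4" if "m \<le> M" for m
    by (rule order_trans[OF power_increasing s(2)]) (use that s in auto)
  have s2: "s \<le> 2"
  proof -
    have "s ^ 2 \<le> 2 ^ 2" using le4[OF M] by simp
    then show ?thesis by (rule power2_le_imp_le) simp
  qed
  have le: "measure lebesgue (shell P (r / s) (r * s)) \<le> 16 * measure lebesgue (A m)" if m: "m \<in>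
      {1..M}" for m
  proof -
    have "measure lebesgue (shell P (r / s) (r * s)) \<le> (s ^ (2 * m))\<^sup>2 * measure lebesgue (A m)"
      using measure_shell_scale[OF P, of "s ^ (2 * m)" "r / s / s ^ (2 * m)" "r * s / s ^ (2 * m)"] s
      by (simp add: A_def one_le_power)
    also have "\<dots> \<le> 4\<^sup>2 * measure lebesgue (A m)"
      using m s0 by (intro mult_right_mono power_mono le4) auto
    finally show ?thesis by simp
  qed
  have "M * measure lebesgue (shell P (r / s) (r * s)) = (\<Sum>m\<in>{1..M}. measure lebesgue (shell P (r
      / s) (r * s)))"
    by simp
  also have "\<dots> \<le> (\<Sum>m\<in>{1..M}. 16 * measure lebesgue (A m))" by (rule sum_mono[OF le])
  also have "\<dots> = 16 * (\<Sum>m\<in>{1..M}. measure lebesgue (A m))" by (simp add: sum_distrib_left)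
  also have "(\<Sum>m\<in>{1..M}. measure lebesgue (A m)) = measure lebesgue (\<Union>m\<in>{1..M}. A m)"
  proof (rule measure_finite_Union[symmetric])
    show "disjoint_family_on A {1..M}"
      unfolding disjoint_family_on_def
    proof (intro ballI impI)
      have less: "A m \<inter> A n = {}" if "m < n" for m n
      proof -
        have "s ^ (2 * m) * s ^ 2 \<le> s ^ (2 * n)"
          using that s power_increasing[of "2 * m + 2" "2 * n" s] by (simp add: power_add
              power2_eq_square mult.commute mult.left_commute)
        then have "r * s / s ^ (2 * n) \<le> r * s / (s ^ (2 * m) * s ^ 2)"
          using r s0 by (intro divide_left_mono) auto
        also have "\<dots> = r / s / s ^ (2 * m)" using s0 by (simp add: power2_eq_square field_simps)
        finally show ?thesis by (auto simp: A_def shell_def)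
      qed
      fix m n :: nat assume "m \<noteq> n"
      then show "A m \<inter> A n = {}" using less[of m n] less[of n m] by (cases m n rule:
          linorder_cases) auto
    qed
    show "emeasure lebesgue (A m) \<noteq> \<infinity>" for m
      unfolding A_def infinity_ennreal_def by (rule fmeasurableD2[OF shell_lmeasurable[OF P]])
  qed (use shell_borel[OF P] in \<open>auto simp: A_def\<close>)
  also have "\<dots> \<le> measure lebesgue (shell P (r / 8) (r / s))"
  proof (rule measure_mono_fmeasurable)
    show "(\<Union>m\<in>{1..M}. A m) \<subseteq> shell P (r / 8) (r / s)"
    proof clarify
      fix x m assume m: "m \<in> {1..M}" and x: "x \<in> A m"
      have "s * s ^ (2 * m) \<le> 2 * 4" using s2 le4 m s0 by (intro mult_mono) auto
      then have "r / 8 \<le> r / (s * s ^ (2 * m))" using r s0 by (intro divide_left_mono) auto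
      then have 1: "r / 8 \<le> r / s / s ^ (2 * m)" by simp
      have "s * s \<le> s ^ (2 * m)" using power_increasing[of 2 "2 * m" s] m s by (simp add:
          power2_eq_square)
      then have "r * s / s ^ (2 * m) \<le> r * s / (s * s)" using r s0 by (intro divide_left_mono) auto
      then have 2: "r * s / s ^ (2 * m) \<le> r / s" using s0 by simp
      have "r / s / s ^ (2 * m) < gap \<phi> P x" "gap \<phi> P x \<le> r * s / s ^ (2 * m)"
        using x unfolding A_def shell_def by blast+
      then show "x \<in> shell P (r / 8) (r / s)"
        unfolding shell_def mem_Collect_eq using le_less_trans[OF 1] order_trans[OF _ 2] by blast
    qed
    show "(\<Union>m\<in>{1..M}. A m) \<in> sets lebesgue" using shell_borel[OF P] by (auto simp: A_def)
  qed (rule shell_lmeasurable[OF P])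
  finally show ?thesis by simp
qed

end

section \<open>Minimizers are almost checkerboards inside large squares\<close>

text \<open>For the \<open>2 \<times> 2\<close> square of lattice points with lower left corner \<open>q\<close>: exactly the two
  points of one of the diagonals belong to \<open>I\<close>.\<close>

definition diag :: "index set \<Rightarrow> index \<Rightarrow> bool" where
  "diag I q \<longleftrightarrow> (q \<in> I \<longleftrightarrow> q + (1, 1) \<in> I) \<and> (q + (1, 0) \<in> I \<longleftrightarrow> q + (0, 1) \<in> I) \<and> (q \<in> I \<longleftrightarrow> q + (1, 0) \<notin> I)"

text \<open>The number of pairs of adjacent points of the square of which exactly one belongs to \<open>I\<close>.\<close>

definition sides :: "index set \<Rightarrow> index \<Rightarrow> real" where
  "sides I q = of_bool ((q \<in> I) \<noteq> (q + (1, 0) \<in> I)) + of_bool ((q + (0, 1) \<in> I) \<noteq> (q + (1, 1) \<in> I))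
     + of_bool ((q \<in> I) \<noteq> (q + (0, 1) \<in> I)) + of_bool ((q + (1, 0) \<in> I) \<noteq> (q + (1, 1) \<in> I))"

text \<open>The number of points of the square that belong to \<open>I\<close>.\<close>

definition corners :: "index set \<Rightarrow> index \<Rightarrow> real" where
  "corners I q = of_bool (q \<in> I) + of_bool (q + (1, 0) \<in> I) + of_bool (q + (0, 1) \<in> I) + of_bool
      (q + (1, 1) \<in> I)"

text \<open>The squares that contain a point of \<open>I\<close>.\<close>

definition touch :: "index set \<Rightarrow> index set" where
  "touch I = {q. q \<in> I \<or> q + (1, 0) \<in> I \<or> q + (0, 1) \<in> I \<or> q + (1, 1) \<in> I}"

lemma Collect_shift: "{q. q + s \<in> A} = (\<lambda>a. a - s) ` A" for s :: index
  by (rule set_eqI) (simp only: image_iff mem_Collect_eq eq_diff_eq bex_triv_one_point2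
      bex_triv_one_point1)

lemma finite_touch:
  assumes "finite I"
  shows "finite (touch I)"
proof -
  have "touch I = I \<union> {q. q + (1, 0) \<in> I} \<union> {q. q + (0, 1) \<in> I} \<union> {q. q + (1, 1) \<in> I}"
    unfolding touch_def by blast
  then show ?thesis using assms by (simp add: Collect_shift)
qed

lemma sum_of_bool_shift:
  fixes A :: "index set"
  assumes "finite \<Lambda>" "\<And>q. q + s \<in> A \<Longrightarrow> q \<in> \<Lambda>"
  shows "(\<Sum>q\<in>\<Lambda>. of_bool (q + s \<in> A) :: real) = card A"
proof -
  have "(\<Sum>q\<in>\<Lambda>. of_bool (q + s \<in> A) :: real) = card (\<Lambda> \<inter> {q. q + s \<in> A})"
    using assms(1) by (simp add: sum_of_bool_eq)
  also have "\<Lambda> \<inter> {q. q + s \<in> A} = (\<lambda>a. a - s) ` A"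
    unfolding Collect_shift[symmetric] using assms(2) by blast
  also have "card \<dots> = card A" by (rule card_image) (simp add: inj_on_def)
  finally show ?thesis .
qed

lemma sum_corners:
  assumes "finite \<Lambda>" "touch I \<subseteq> \<Lambda>"
  shows "(\<Sum>q\<in>\<Lambda>. corners I q) = 4 * card I"
proof -
  have *: "(\<Sum>q\<in>\<Lambda>. of_bool (q + s \<in> I) :: real) = card I" if "s \<in> {0, (1,0), (0,1), (1,1)}" for s
    using assms(2) that by (intro sum_of_bool_shift[OF assms(1)]) (auto simp: touch_def)
  show ?thesis
    using *[of 0] *[of "(1,0)"] *[of "(0,1)"] *[of "(1,1)"] by (simp add: corners_def sum.distrib)
qed

lemma card_bdry_eq:
  assumes "finite I"
  shows "card (bdry I) = card {q. (q \<in> I) \<noteq> (q + (1, 0) \<in> I)} + card {q. (q \<in> I) \<noteq> (q + (0, 1) \<in> I)}"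
proof -
  define f where "f s q = (if q \<in> I then (q, q + s) else (q + s, q))" for s q :: index
  define D where "D s = {q. (q \<in> I) \<noteq> (q + s \<in> I)}" for s :: index
  have fin: "finite (D s)" for s
  proof (rule finite_subset)
    show "D s \<subseteq> I \<union> (\<lambda>i. i - s) ` I" unfolding Collect_shift[symmetric] D_def by blast
  qed (use assms in simp)
  have inj: "inj_on (f s) (D s)" if "s \<in> {(1, 0), (0, 1)}" for s
    using that by (auto simp: inj_on_def f_def D_def prod_eq_iff split: if_splits)
  have "bdry I = f (1, 0) ` D (1, 0) \<union> f (0, 1) ` D (0, 1)"
  proof (intro equalityI subsetI)
    fix p assume "p \<in> bdry I"
    then obtain i j where p: "p = (i, j)" "i \<in> I" "j \<notin> I" "adj i j" by (auto simp: bdry_def)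
    then have "j \<in> {i + (1, 0), i - (1, 0), i + (0, 1), i - (0, 1)}"
      unfolding adj_iff by (auto simp: prod_eq_iff)
    then consider "j = i + (1, 0)" | "i = j + (1, 0)" | "j = i + (0, 1)" | "i = j + (0, 1)" by fastforce
    then show "p \<in> f (1, 0) ` D (1, 0) \<union> f (0, 1) ` D (0, 1)"
    proof cases
      case 1
      then have "p = f (1, 0) i" "i \<in> D (1, 0)" using p by (auto simp: f_def D_def)
      then show ?thesis by blast
    next
      case 2
      then have "p = f (1, 0) j" "j \<in> D (1, 0)" using p by (auto simp: f_def D_def)
      then show ?thesis by blast
    next
      case 3
      then have "p = f (0, 1) i" "i \<in> D (0, 1)" using p by (auto simp: f_def D_def)
      then show ?thesis by blast
    next
      case 4
      then have "p = f (0, 1) j" "j \<in> D (0, 1)" using p by (auto simp: f_def D_def)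
      then show ?thesis by blast
    qed
  next
    fix p assume "p \<in> f (1, 0) ` D (1, 0) \<union> f (0, 1) ` D (0, 1)"
    then obtain s q where sq: "s \<in> {(1, 0), (0, 1)}" "q \<in> D s" "p = f s q" by blast
    have "adj q (q + s)" "adj (q + s) q" using sq(1) by (auto simp: adj_def)
    then show "p \<in> bdry I" using sq(2) unfolding sq(3) f_def D_def bdry_def by simp
  qed
  moreover have "f (1, 0) ` D (1, 0) \<inter> f (0, 1) ` D (0, 1) = {}"
  proof -
    have "snd (fst (f (1, 0) q)) = snd (snd (f (1, 0) q))" "snd (fst (f (0, 1) q)) \<noteq> snd (snd (f
        (0, 1) q))" for q
      by (simp_all add: f_def)
    note ne = this
    show ?thesis
    proof (rule equals0I, elim IntE imageE)
      fix p q q' assume "p = f (1, 0) q" "p = f (0, 1) q'"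
      then show False using ne(1)[of q] ne(2)[of q'] by simp
    qed
  qed
  ultimately have "card (bdry I) = card (D (1, 0)) + card (D (0, 1))"
    using fin by (simp add: card_Un_disjoint card_image inj)
  then show ?thesis by (simp add: D_def)
qed

text \<open>Each pair of adjacent lattice points belongs to exactly two squares.\<close>

lemma sum_sides:
  assumes "finite I" "finite \<Lambda>" "touch I \<subseteq> \<Lambda>"
  shows "(\<Sum>q\<in>\<Lambda>. sides I q) = 2 * card (bdry I)"
proof -
  define D where "D s = {q. (q \<in> I) \<noteq> (q + s \<in> I)}" for s :: index
  have *: "(\<Sum>q\<in>\<Lambda>. of_bool (q + t \<in> D s) :: real) = card (D s)"
    if "(s, t) \<in> {((1,0), 0), ((1,0), (0,1)), ((0,1), 0), ((0,1), (1,0))}" for s t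
  proof (rule sum_of_bool_shift[OF assms(2)])
    fix q assume "q + t \<in> D s"
    then have "q + t \<in> I \<or> q + (t + s) \<in> I" by (auto simp: D_def add.assoc)
    then have "q \<in> touch I" using that by (auto simp: touch_def)
    then show "q \<in> \<Lambda>" using assms(3) by blast
  qed
  have "sides I q = of_bool (q + 0 \<in> D (1,0)) + of_bool (q + (0,1) \<in> D (1,0))
      + of_bool (q + 0 \<in> D (0,1)) + of_bool (q + (1,0) \<in> D (0,1))" for q
    by (simp add: sides_def D_def add.assoc)
  then have "(\<Sum>q\<in>\<Lambda>. sides I q) = 2 * card (D (1,0)) + 2 * card (D (0,1))"
    using *[of "(1,0)" 0] *[of "(1,0)" "(0,1)"] *[of "(0,1)" 0] *[of "(0,1)" "(1,0)"]
    by (simp only: sum.distrib) simp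
  then show ?thesis using card_bdry_eq[OF assms(1)] by (simp add: D_def)
qed

text \<open>The contribution of a square to \<open>card (bdry I) - \<theta> * card I\<close>: a side belongs to two
  squares and a point to four. Here \<open>\<theta> \<in> [0, 4]\<close> stands for the approximate cost of a cell.\<close>

definition profit :: "real \<Rightarrow> index set \<Rightarrow> index \<Rightarrow> real" where
  "profit \<theta> I q = sides I q / 2 - \<theta> / 4 * corners I q"

lemma profit_diag: "diag I q \<Longrightarrow> profit \<theta> I q = 2 - \<theta> / 2"
  unfolding diag_def profit_def sides_def corners_def
  by (cases "q \<in> I"; cases "q + (1, 0) \<in> I"; cases "q + (0, 1) \<in> I"; cases "q + (1, 1) \<in> I"; simp)

lemma profit_not_diag:
  assumes "0 \<le> \<theta>" "\<theta> \<le> 4" "\<not> diag I q"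
  shows "profit \<theta> I q \<le> 1 - \<theta> / 4"
  using assms unfolding diag_def profit_def sides_def corners_def
  by (cases "q \<in> I"; cases "q + (1, 0) \<in> I"; cases "q + (0, 1) \<in> I"; cases "q + (1, 1) \<in> I"; simp)

lemma profit_bounds:
  assumes "0 \<le> \<theta>"
  shows "- \<theta> \<le> profit \<theta> I q" "profit \<theta> I q \<le> 2"
  using assms unfolding profit_def sides_def corners_def
  by (cases "q \<in> I"; cases "q + (1, 0) \<in> I"; cases "q + (0, 1) \<in> I"; cases "q + (1, 1) \<in> I"; simp)+

text \<open>A square of \<open>L \<times> L\<close> lattice points with lower left corner \<open>(a, b)\<close>.\<close>

definition grid_box :: "int \<Rightarrow> int \<Rightarrow> int \<Rightarrow> index set" where
  "grid_box a b L = {a..<a + L} \<times> {b..<b + L}"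

lemma finite_grid_box [simp]: "finite (grid_box a b L)" by (simp add: grid_box_def)

lemma card_grid_box: "0 \<le> L \<Longrightarrow> real (card (grid_box a b L)) = of_int L ^ 2"
  by (simp add: grid_box_def card_cartesian_product power2_eq_square)

text \<open>Comparison of the minimizer \<open>I\<close> with the set \<open>I'\<close>, in which the inside of the box is
  replaced by a checkerboard and its rim by nothing. Each square that is not diagonal loses at
  least \<open>1 - \<theta> / 4\<close>, which has to be compensated by the \<open>O(L)\<close> squares at the rim and by the
  oscillation \<open>h\<close> of the cost.\<close>

lemma (in plane_norm) box_not_diag_count:
  assumes e: "0 < \<epsilon>" "0 < \<tau>" and F: "finite F" "F \<noteq> {}" and st: "step \<epsilon> \<tau> F I"
    and L: "4 \<le> L" and XF: "grid_box a b L \<inter> F = {}" and \<theta>: "0 \<le> \<theta>" "\<theta> \<le> 4"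
    and osc: "\<And>i. i \<in> grid_box a b L \<Longrightarrow> \<bar>gap \<phi> (pt \<epsilon> ` F) (pt \<epsilon> i) / \<tau> - \<theta>\<bar> \<le> h"
  shows "(1 - \<theta> / 4) * card {q \<in> grid_box a b L. \<not> diag I q} \<le> 54 * L + 2 * h * L\<^sup>2"
proof -
  define X where "X = grid_box a b L"
  define C where "C = {i \<in> grid_box (a + 1) (b + 1) (L - 2). even (fst i + snd i)}"
  define Q where "Q = grid_box (a + 1) (b + 1) (L - 3)"
  define Y where "Y = grid_box (a - 1) (b - 1) (L + 1)"
  define J where "J = I \<inter> X"
  define I' where "I' = (I - X) \<union> C"
  have fI: "finite I" and FI: "F \<subseteq> I" using st by (auto simp: step_def)
  have CX: "C \<subseteq> X" by (auto simp: C_def X_def grid_box_def)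
  have fC: "finite C" by (simp add: C_def)
  have fI': "finite I'" using fI fC by (simp add: I'_def)
  have FI': "F \<subseteq> I'" using FI XF by (auto simp: I'_def X_def)
  have XF': "X \<inter> F = {}" using XF by (simp add: X_def)
  have QX: "Q \<subseteq> X" and XY: "X \<subseteq> Y" using L by (auto simp: Q_def X_def Y_def grid_box_def)
  define \<Lambda> where "\<Lambda> = Y \<union> touch I \<union> touch I'"
  have fL: "finite \<Lambda>" using finite_touch fI fI' by (simp add: \<Lambda>_def Y_def)
  let ?B = "{q \<in> Q. \<not> diag I q}"
  let ?d = "\<lambda>q. profit \<theta> I' q - profit \<theta> I q"
  \<comment> \<open>Lower bound: squares outside \<open>Y\<close> agree, the \<open>8 L - 8\<close> squares of \<open>Y - Q\<close> meet the rim of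
      the box, and inside \<open>Q\<close> the competitor \<open>I'\<close> is a checkerboard.\<close>
  have "(\<Sum>q\<in>\<Lambda>. ?d q) = (\<Sum>q\<in>\<Lambda> - Y. ?d q) + (\<Sum>q\<in>Y - Q. ?d q) + (\<Sum>q\<in>Q. ?d q)"
  proof -
    have "(\<Sum>q\<in>\<Lambda>. ?d q) = (\<Sum>q\<in>\<Lambda> - Y. ?d q) + (\<Sum>q\<in>Y. ?d q)"
      by (rule sum.subset_diff[OF _ fL]) (auto simp: \<Lambda>_def)
    also have "(\<Sum>q\<in>Y. ?d q) = (\<Sum>q\<in>Y - Q. ?d q) + (\<Sum>q\<in>Q. ?d q)"
      by (rule sum.subset_diff) (use QX XY in \<open>auto simp: Y_def\<close>)
    finally show ?thesis by simp
  qed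
  moreover have "(\<Sum>q\<in>\<Lambda> - Y. ?d q) = 0"
  proof (rule sum.neutral, rule ballI)
    fix q assume "q \<in> \<Lambda> - Y"
    then have "q \<notin> X" "q + (1, 0) \<notin> X" "q + (0, 1) \<notin> X" "q + (1, 1) \<notin> X"
      by (auto simp: Y_def X_def grid_box_def mem_Times_iff)
    then have "q \<in> I' \<longleftrightarrow> q \<in> I" "q + (1, 0) \<in> I' \<longleftrightarrow> q + (1, 0) \<in> I"
      "q + (0, 1) \<in> I' \<longleftrightarrow> q + (0, 1) \<in> I" "q + (1, 1) \<in> I' \<longleftrightarrow> q + (1, 1) \<in> I"
      using CX by (auto simp: I'_def)
    then show "?d q = 0" by (simp add: profit_def sides_def corners_def)
  qed
  moreover have "-6 * (8 * L - 8) \<le> (\<Sum>q\<in>Y - Q. ?d q)"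
  proof -
    have "real (card (Y - Q)) = 8 * L - 8"
    proof -
      have "card (Y - Q) + card Q = card Y"
        using QX XY card_mono[of Y Q] by (subst card_Diff_subset) (auto simp: Q_def Y_def)
      then have "real (card (Y - Q)) = real (card Y) - real (card Q)" by linarith
      also have "\<dots> = of_int (L + 1) ^ 2 - of_int (L - 3) ^ 2"
        using L by (simp only: Y_def Q_def card_grid_box)
      finally show ?thesis by (simp add: power2_eq_square algebra_simps)
    qed
    then have "-6 * (8 * L - 8) = (\<Sum>q\<in>Y - Q. -6 :: real)" by simp
    also have "\<dots> \<le> (\<Sum>q\<in>Y - Q. ?d q)"
    proof (rule sum_mono)
      fix q
      show "-6 \<le> ?d q" using profit_bounds[OF \<theta>(1), of I' q] profit_bounds[OF \<theta>(1), of I q] \<theta> by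
          linarith
    qed
    finally show ?thesis .
  qed
  moreover have "(1 - \<theta> / 4) * card ?B \<le> (\<Sum>q\<in>Q. ?d q)"
  proof -
    have "(1 - \<theta> / 4) * card ?B = (\<Sum>q\<in>Q. (1 - \<theta> / 4) * of_bool (\<not> diag I q))"
    proof -
      have "Q \<inter> {q. \<not> diag I q} = ?B" by blast
      then show ?thesis by (simp add: Q_def sum_of_bool_eq flip: sum_distrib_left)
    qed
    also have "\<dots> \<le> (\<Sum>q\<in>Q. ?d q)"
    proof (rule sum_mono)
      fix q assume q: "q \<in> Q"
      define a' b' where "a' = fst q" and "b' = snd q"
      have qq: "q = (a', b')" by (simp add: a'_def b'_def)
      have "a + 1 \<le> a'" "a' + 1 < a + L - 1" "b + 1 \<le> b'" "b' + 1 < b + L - 1"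
        using q by (auto simp: Q_def grid_box_def a'_def b'_def)
      then have mem: "(c, d) \<in> I' \<longleftrightarrow> even (c + d)" if "c \<in> {a', a' + 1}" "d \<in> {b', b' + 1}" for c d
        using that by (auto simp: I'_def C_def X_def grid_box_def)
      have "diag I' q" unfolding qq diag_def by (cases "even a'"; cases "even b'"; simp add: mem)
      then have "profit \<theta> I' q = 2 - \<theta> / 2" by (rule profit_diag)
      then show "(1 - \<theta> / 4) * of_bool (\<not> diag I q) \<le> ?d q"
        using profit_diag[of I q \<theta>] profit_not_diag[OF \<theta>, of I q] by (cases "diag I q") auto
    qed
    finally show ?thesis .
  qed
  ultimately have lower: "(1 - \<theta> / 4) * card ?B - 6 * (8 * L - 8) \<le> (\<Sum>q\<in>\<Lambda>. ?d q)" by linarith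
  \<comment> \<open>upper bound, because \<open>I\<close> is minimal\<close>
  have total: "(\<Sum>q\<in>\<Lambda>. profit \<theta> K q) = card (bdry K) - \<theta> * card K" if "finite K" "touch K \<subseteq> \<Lambda>" for K
    using sum_sides[OF that(1) fL that(2)] sum_corners[OF fL that(2)]
    by (simp add: profit_def sum_subtractf flip: sum_divide_distrib sum_distrib_left)
  have "(\<Sum>q\<in>\<Lambda>. ?d q) = (card (bdry I') - \<theta> * card I') - (card (bdry I) - \<theta> * card I)"
    using total[OF fI'] total[OF fI] by (simp add: sum_subtractf \<Lambda>_def sup.coboundedI2 sup.coboundedI1)
  moreover have "real (card I') - card I = real (card C) - card J"
  proof -
    have "card I = card (I - X) + card J"
      unfolding J_def using fI by (subst card_Un_disjoint[symmetric]) (auto intro: arg_cong[where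
          f = card])
    moreover have "card I' = card (I - X) + card C"
      unfolding I'_def using CX fI fC by (intro card_Un_disjoint) auto
    ultimately show ?thesis by simp
  qed
  moreover have "real (card (bdry I')) - card (bdry I) \<le> \<theta> * (real (card C) - card J) + 2 * h * L\<^sup>2"
  proof -
    let ?g = "\<lambda>i. gap \<phi> (pt \<epsilon> ` F) (pt \<epsilon> i)"
    have "reduced_energy \<epsilon> \<tau> F I \<le> reduced_energy \<epsilon> \<tau> F I'" using st fI' FI' by (simp add: step_def)
    moreover have "(\<Sum>i\<in>I - F. ?g i) = (\<Sum>i\<in>I - X - F. ?g i) + (\<Sum>i\<in>J. ?g i)"
      using fI XF' by (subst sum.union_disjoint[symmetric]) (auto intro!: sum.cong simp: J_def)
    moreover have "(\<Sum>i\<in>I' - F. ?g i) = (\<Sum>i\<in>I - X - F. ?g i) + (\<Sum>i\<in>C. ?g i)"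
      using fI fC XF' CX by (subst sum.union_disjoint[symmetric]) (auto intro!: sum.cong simp: I'_def)
    ultimately have "real (card (bdry I')) - card (bdry I) \<le> (\<Sum>i\<in>C. ?g i) / \<tau> - (\<Sum>i\<in>J. ?g i) / \<tau>"
      unfolding reduced_energy_def by (simp add: add_divide_distrib)
    moreover have "(\<Sum>i\<in>C. ?g i) / \<tau> \<le> (\<theta> + h) * card C"
    proof -
      have "(\<Sum>i\<in>C. ?g i / \<tau>) \<le> (\<Sum>i\<in>C. \<theta> + h)"
      proof (rule sum_mono)
        fix i assume "i \<in> C"
        then show "?g i / \<tau> \<le> \<theta> + h" using osc[of i] CX by (auto simp: X_def abs_le_iff)
      qed
      then show ?thesis by (simp add: sum_divide_distrib mult.commute)
    qed
    moreover have "(\<theta> - h) * card J \<le> (\<Sum>i\<in>J. ?g i) / \<tau>"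
    proof -
      have "(\<Sum>i\<in>J. \<theta> - h) \<le> (\<Sum>i\<in>J. ?g i / \<tau>)"
      proof (rule sum_mono)
        fix i assume "i \<in> J"
        then have "\<bar>?g i / \<tau> - \<theta>\<bar> \<le> h" by (intro osc) (simp add: X_def J_def)
        then show "\<theta> - h \<le> ?g i / \<tau>" by linarith
      qed
      then show ?thesis by (simp add: sum_divide_distrib mult.commute)
    qed
    moreover have "h * card C \<le> h * L\<^sup>2" "h * card J \<le> h * L\<^sup>2"
    proof -
      have "(a, b) \<in> grid_box a b L" using L by (simp add: grid_box_def)
      then have "0 \<le> h" using osc abs_ge_zero order_trans by blast
      moreover have "real (card C) \<le> card X" "real (card J) \<le> card X"
        using CX by (auto simp: J_def X_def intro!: card_mono)
      moreover have "real (card X) = of_int L ^ 2" using L by (simp add: X_def card_grid_box)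
      ultimately show "h * card C \<le> h * L\<^sup>2" "h * card J \<le> h * L\<^sup>2"
        by (auto intro!: mult_left_mono)
    qed
    ultimately show ?thesis by (simp add: algebra_simps)
  qed
  ultimately have upper: "(\<Sum>q\<in>\<Lambda>. ?d q) \<le> 2 * h * L\<^sup>2"
  proof -
    assume tot: "(\<Sum>q\<in>\<Lambda>. ?d q) = (card (bdry I') - \<theta> * card I') - (card (bdry I) - \<theta> * card I)"
      and cards: "real (card I') - card I = real (card C) - card J"
      and le: "real (card (bdry I')) - card (bdry I) \<le> \<theta> * (real (card C) - card J) + 2 * h * L\<^sup>2"
    have "\<theta> * card I' - \<theta> * card I = \<theta> * (real (card C) - card J)"
      unfolding cards[symmetric] by (simp add: right_diff_distrib)
    then show ?thesis using tot le by linarith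
  qed
  have "card {q \<in> X. \<not> diag I q} \<le> card ?B + card (X - Q)"
  proof -
    have "{q \<in> X. \<not> diag I q} \<subseteq> ?B \<union> (X - Q)" by blast
    then have "card {q \<in> X. \<not> diag I q} \<le> card (?B \<union> (X - Q))"
      by (intro card_mono) (auto simp: Q_def X_def)
    then show ?thesis using card_Un_le[of ?B "X - Q"] by linarith
  qed
  moreover have "real (card (X - Q)) = 6 * L - 9"
  proof -
    have "card (X - Q) + card Q = card X"
      using QX card_mono[of X Q] by (subst card_Diff_subset) (auto simp: Q_def X_def)
    then have "real (card (X - Q)) = real (card X) - real (card Q)" by linarith
    also have "\<dots> = of_int L ^ 2 - of_int (L - 3) ^ 2"
      using L by (simp only: X_def Q_def card_grid_box)
    finally show ?thesis by (simp add: power2_eq_square algebra_simps)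
  qed
  ultimately have c: "real (card {q \<in> X. \<not> diag I q}) \<le> card ?B + (6 * L - 9)" by linarith
  have "(1 - \<theta> / 4) * card {q \<in> X. \<not> diag I q} \<le> (1 - \<theta> / 4) * (card ?B + (6 * L - 9))"
    using c \<theta> by (intro mult_left_mono) auto
  also have "\<dots> = (1 - \<theta> / 4) * card ?B + (1 - \<theta> / 4) * (6 * L - 9)" by (simp add: distrib_left)
  also have "(1 - \<theta> / 4) * real_of_int (6 * L - 9) \<le> 1 * real_of_int (6 * L - 9)"
    using \<theta> L by (intro mult_right_mono) auto
  finally show ?thesis using lower upper by (simp add: X_def)
qed

section \<open>Weak* convergence and areas of unions of cells\<close>

text \<open>For uniformly bounded functions, convergence of the integrals over open sets of finite
  measure extends to measurable sets by outer regularity, and to integrable functions by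
  density.\<close>

lemma integral_tendsto_0_of_open:
  fixes h :: "nat \<Rightarrow> 'a::euclidean_space \<Rightarrow> real"
  assumes h: "\<And>n. h n \<in> borel_measurable lebesgue" "\<And>n x. \<bar>h n x\<bar> \<le> 1"
    and op: "\<And>U. open U \<Longrightarrow> emeasure lebesgue U < \<infinity> \<Longrightarrow> (\<lambda>n. LINT x|lebesgue. h n x * indicat_real U x) \<longlonglongrightarrow> 0"
    and g: "integrable lebesgue g"
  shows "(\<lambda>n. LINT x|lebesgue. h n x * g x) \<longlonglongrightarrow> 0"
proof -
  have int: "integrable lebesgue (\<lambda>x. h n x * f x)" if "integrable lebesgue f" for f n
  proof (rule Bochner_Integration.integrable_bound[OF that])
    show "(\<lambda>x. h n x * f x) \<in> borel_measurable lebesgue"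
      using h(1) borel_measurable_integrable[OF that] by (rule borel_measurable_times)
    show "AE x in lebesgue. norm (h n x * f x) \<le> norm (f x)"
    proof (rule AE_I2)
      fix x
      show "norm (h n x * f x) \<le> norm (f x)"
        using mult_right_mono[OF h(2)[of n x], of "\<bar>f x\<bar>"] by (simp add: abs_mult)
    qed
  qed
  have bound: "\<bar>LINT x|lebesgue. h n x * f x\<bar> \<le> (LINT x|lebesgue. \<bar>f x\<bar>)" if f: "integrable
      lebesgue f" for f n
  proof -
    have "norm (LINT x|lebesgue. h n x * f x) \<le> (LINT x|lebesgue. \<bar>f x\<bar>)"
    proof (rule Bochner_Integration.integral_norm_bound_integral[OF int[OF f]])
      show "integrable lebesgue (\<lambda>x. \<bar>f x\<bar>)" using f by (rule integrable_abs)
      fix x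
      show "norm (h n x * f x) \<le> \<bar>f x\<bar>"
        using mult_right_mono[OF h(2)[of n x], of "\<bar>f x\<bar>"] by (simp add: abs_mult)
    qed
    then show ?thesis by simp
  qed
  have approx: "(\<lambda>n. LINT x|lebesgue. h n x * f x) \<longlonglongrightarrow> 0"
    if f: "integrable lebesgue f"
      and ex: "\<And>e. 0 < e \<Longrightarrow> \<exists>f'. integrable lebesgue f' \<and> (\<lambda>n. LINT x|lebesgue. h n x * f' x) \<longlonglongrightarrow> 0
        \<and> (LINT x|lebesgue. \<bar>f x - f' x\<bar>) < e" for f
  proof (rule tendstoI)
    fix e :: real assume "0 < e"
    then obtain f' where f': "integrable lebesgue f'" "(\<lambda>n. LINT x|lebesgue. h n x * f' x) \<longlonglongrightarrow> 0"
      "(LINT x|lebesgue. \<bar>f x - f' x\<bar>) < e / 2"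
      using ex[of "e / 2"] by auto
    have "\<forall>\<^sub>F n in sequentially. dist (LINT x|lebesgue. h n x * f' x) 0 < e / 2"
      by (rule tendstoD[OF f'(2)]) (use \<open>0 < e\<close> in simp)
    then show "\<forall>\<^sub>F n in sequentially. dist (LINT x|lebesgue. h n x * f x) 0 < e"
    proof eventually_elim
      case (elim n)
      have "(LINT x|lebesgue. h n x * f x) = (LINT x|lebesgue. h n x * f' x) + (LINT x|lebesgue. h
          n x * (f x - f' x))"
        using int[OF f'(1)] int[OF Bochner_Integration.integrable_diff[OF f f'(1)]]
        by (subst Bochner_Integration.integral_add[symmetric]) (auto simp: algebra_simps)
      moreover have "\<bar>LINT x|lebesgue. h n x * (f x - f' x)\<bar> < e / 2"
        using bound[OF Bochner_Integration.integrable_diff[OF f f'(1)], of n] f'(3) by linarith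
      ultimately show ?case using elim by (simp add: dist_real_def)
    qed
  qed
  show ?thesis
    using g
  proof (induction rule: integrable_induct)
    case (base A c)
    have int_ind: "integrable lebesgue (\<lambda>x. indicat_real B x * c)" if "B \<in> sets lebesgue"
        "emeasure lebesgue B < \<infinity>" for B
      using that by (intro integrable_mult_left integrable_real_indicator) auto
    show ?case
      unfolding real_scaleR_def
    proof (rule approx)
      show "integrable lebesgue (\<lambda>x. indicat_real A x * c)" using base by (rule int_ind)
      fix e :: real assume e: "0 < e"
      define e' where "e' = e / (\<bar>c\<bar> + 1)"
      have e': "0 < e'" "\<bar>c\<bar> * e' < e" using e by (auto simp: e'_def field_simps add_pos_nonneg)
      obtain U where U: "open U" "A \<subseteq> U" "U - A \<in> lmeasurable" "emeasure lebesgue (U - A) < ennreal e'"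
        using sets_lebesgue_outer_open[OF base(1) e'(1)] by metis
      have "emeasure lebesgue U \<le> emeasure lebesgue A + emeasure lebesgue (U - A)"
        using emeasure_subadditive[of A lebesgue "U - A"] base(1) U by (simp add: Un_absorb1
            fmeasurableD)
      also have "\<dots> < \<infinity>" using base(2) fmeasurableD2[OF U(3)] by (simp add: less_top)
      finally have Ufin: "emeasure lebesgue U < \<infinity>" .
      have Us: "U \<in> sets lebesgue" using U(1) by simp
      show "\<exists>f'. integrable lebesgue f' \<and> (\<lambda>n. LINT x|lebesgue. h n x * f' x) \<longlonglongrightarrow> 0
        \<and> (LINT x|lebesgue. \<bar>indicat_real A x * c - f' x\<bar>) < e"
      proof (intro exI conjI)
        show "integrable lebesgue (\<lambda>x. indicat_real U x * c)" by (rule int_ind[OF Us Ufin])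
        have "(\<lambda>n. (LINT x|lebesgue. h n x * indicat_real U x) * c) \<longlonglongrightarrow> 0 * c"
          by (intro tendsto_mult_right op U(1) Ufin)
        then show "(\<lambda>n. LINT x|lebesgue. h n x * (indicat_real U x * c)) \<longlonglongrightarrow> 0"
          by (simp flip: mult.assoc)
        have "(\<lambda>x. \<bar>indicat_real A x * c - indicat_real U x * c\<bar>) = (\<lambda>x. indicat_real (U - A) x * \<bar>c\<bar>)"
        proof
          fix x
          show "\<bar>indicat_real A x * c - indicat_real U x * c\<bar> = indicat_real (U - A) x * \<bar>c\<bar>"
            using U(2) by (cases "x \<in> A"; cases "x \<in> U") auto
        qed
        then have "(LINT x|lebesgue. \<bar>indicat_real A x * c - indicat_real U x * c\<bar>) = measure
            lebesgue (U - A) * \<bar>c\<bar>"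
          by simp
        also have "\<dots> \<le> e' * \<bar>c\<bar>"
        proof (rule mult_right_mono)
          have "ennreal (measure lebesgue (U - A)) < ennreal e'"
            using U(4) unfolding emeasure_eq_measure2[OF U(3)] .
          then show "measure lebesgue (U - A) \<le> e'" by (simp add: ennreal_less_iff)
        qed simp
        also have "\<dots> < e" using e'(2) by (simp add: mult.commute)
        finally show "(LINT x|lebesgue. \<bar>indicat_real A x * c - indicat_real U x * c\<bar>) < e" .
      qed
    qed
  next
    case (add f1 f2)
    have "(\<lambda>n. (LINT x|lebesgue. h n x * f1 x) + (LINT x|lebesgue. h n x * f2 x)) \<longlonglongrightarrow> 0 + 0"
      by (intro tendsto_add add)
    moreover have "(LINT x|lebesgue. h n x * (f1 x + f2 x)) = (LINT x|lebesgue. h n x * f1 x) +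
        (LINT x|lebesgue. h n x * f2 x)" for n
      using int[OF \<open>integrable lebesgue f1\<close>] int[OF \<open>integrable lebesgue f2\<close>] by (simp add:
          distrib_left)
    ultimately show ?case by simp
  next
    case (lim f s)
    show ?case
    proof (rule approx[OF lim.hyps(4)])
      fix e :: real assume e: "0 < e"
      have "(\<lambda>i. LINT x|lebesgue. \<bar>f x - s i x\<bar>) \<longlonglongrightarrow> integral\<^sup>L lebesgue (\<lambda>x::'a. 0 :: real)"
      proof (rule integral_dominated_convergence[where w = "\<lambda>x. 3 * norm (f x)"])
        show "integrable lebesgue (\<lambda>x. 3 * norm (f x))"
          using lim.hyps(4) by (intro integrable_mult_right integrable_norm)
        show "AE x in lebesgue. (\<lambda>i. \<bar>f x - s i x\<bar>) \<longlonglongrightarrow> 0"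
        proof (rule AE_I2)
          fix x :: 'a assume "x \<in> space lebesgue"
          then have "(\<lambda>i. \<bar>f x - s i x\<bar>) \<longlonglongrightarrow> \<bar>f x - f x\<bar>" by (intro tendsto_intros lim.hyps(2))
          then show "(\<lambda>i. \<bar>f x - s i x\<bar>) \<longlonglongrightarrow> 0" by simp
        qed
        show "AE x in lebesgue. norm \<bar>f x - s i x\<bar> \<le> 3 * norm (f x)" for i
        proof (rule AE_I2)
          fix x :: 'a assume "x \<in> space lebesgue"
          from lim.hyps(3)[OF this, of i] show "norm \<bar>f x - s i x\<bar> \<le> 3 * norm (f x)"
            using abs_triangle_ineq4[of "f x" "s i x"] by simp
        qed
        show "(\<lambda>x. \<bar>f x - s i x\<bar>) \<in> borel_measurable lebesgue" for i
          using borel_measurable_integrable[OF lim.hyps(4)] borel_measurable_integrable[OF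
              lim.hyps(1)[of i]] by measurable
      qed simp
      then have "\<forall>\<^sub>F i in sequentially. (LINT x|lebesgue. \<bar>f x - s i x\<bar>) < e"
        using e by (intro order_tendstoD(2)) auto
      then obtain i where i: "(LINT x|lebesgue. \<bar>f x - s i x\<bar>) < e" by (auto dest: eventually_happens)
      show "\<exists>f'. integrable lebesgue f' \<and> (\<lambda>n. LINT x|lebesgue. h n x * f' x) \<longlonglongrightarrow> 0 \<and> (LINT
          x|lebesgue. \<bar>f x - f' x\<bar>) < e"
        using lim.hyps(1)[of i] lim.IH[of i] i by blast
    qed
  qed
qed

lemma idx_eq_iff:
  assumes "0 < \<epsilon>"
  shows "idx \<epsilon> x = i \<longleftrightarrow> x \<in> {\<epsilon> * (of_int (fst i) - 1/2)..<\<epsilon> * (of_int (fst i) + 1/2)} \<times>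
    {\<epsilon> * (of_int (snd i) - 1/2)..<\<epsilon> * (of_int (snd i) + 1/2)}"
proof -
  have "round (u / \<epsilon>) = a \<longleftrightarrow> \<epsilon> * (of_int a - 1/2) \<le> u \<and> u < \<epsilon> * (of_int a + 1/2)" for u :: real and
      a :: int
  proof -
    have "round (u / \<epsilon>) = a \<longleftrightarrow> of_int a - 1/2 \<le> u / \<epsilon> \<and> u / \<epsilon> < of_int a + 1/2"
      unfolding round_def floor_eq_iff by linarith
    then show ?thesis using assms by (simp add: pos_le_divide_eq pos_divide_less_eq mult.commute)
  qed
  then show ?thesis by (auto simp: idx_def prod_eq_iff mem_Times_iff)
qed

lemma idx_vimage:
  assumes "0 < \<epsilon>" "finite S"
  shows "{x. idx \<epsilon> x \<in> S} \<in> sets borel" "{x. idx \<epsilon> x \<in> S} \<in> lmeasurable"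
    "measure lebesgue {x. idx \<epsilon> x \<in> S} = \<epsilon>\<^sup>2 * card S"
proof -
  let ?A = "\<lambda>i. {x. idx \<epsilon> x = i}"
  have A: "?A i \<in> sets borel" "emeasure lborel (?A i) = ennreal (\<epsilon>\<^sup>2)" for i
  proof -
    have eq: "?A i = {\<epsilon> * (of_int (fst i) - 1/2)..<\<epsilon> * (of_int (fst i) + 1/2)} \<times>
      {\<epsilon> * (of_int (snd i) - 1/2)..<\<epsilon> * (of_int (snd i) + 1/2)}"
      using idx_eq_iff[OF assms(1)] by blast
    show "?A i \<in> sets borel" unfolding eq by (intro borel_Times) auto
    have len: "\<epsilon> * (a + 1/2) - \<epsilon> * (a - 1/2) = \<epsilon>" "\<epsilon> * (a - 1/2) \<le> \<epsilon> * (a + 1/2)" for a :: real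
      using assms(1) by (auto simp: algebra_simps)
    have "emeasure (lborel \<Otimes>\<^sub>M lborel) ({\<epsilon> * (of_int (fst i) - 1/2)..<\<epsilon> * (of_int (fst i) + 1/2)} \<times>
      {\<epsilon> * (of_int (snd i) - 1/2)..<\<epsilon> * (of_int (snd i) + 1/2)}) = ennreal \<epsilon> * ennreal \<epsilon>"
      by (subst lborel.emeasure_pair_measure_Times) (simp_all add: emeasure_lborel_Ico[OF len(2)]
          len(1))
    then show "emeasure lborel (?A i) = ennreal (\<epsilon>\<^sup>2)"
      unfolding eq lborel_prod using assms(1) by (simp add: power2_eq_square ennreal_mult)
  qed
  have un: "{x. idx \<epsilon> x \<in> S} = (\<Union>i\<in>S. ?A i)" by blast
  show b: "{x. idx \<epsilon> x \<in> S} \<in> sets borel" unfolding un using assms(2) A(1) by (intro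
      sets.finite_UN) auto
  have "emeasure lborel (\<Union>i\<in>S. ?A i) = (\<Sum>i\<in>S. emeasure lborel (?A i))"
    using A(1) assms(2) by (intro sum_emeasure[symmetric]) (auto simp: disjoint_family_on_def)
  also have "\<dots> = ennreal (\<epsilon>\<^sup>2 * card S)"
    by (simp add: A(2) ennreal_mult ennreal_of_nat_eq_real_of_nat mult.commute)
  finally have em: "emeasure lebesgue {x. idx \<epsilon> x \<in> S} = ennreal (\<epsilon>\<^sup>2 * card S)"
    unfolding un using b un by simp
  then show "{x. idx \<epsilon> x \<in> S} \<in> lmeasurable" using b by (intro fmeasurableI) auto
  show "measure lebesgue {x. idx \<epsilon> x \<in> S} = \<epsilon>\<^sup>2 * card S"
    using em by (simp add: measure_def)
qed

text \<open>Closed and half-open cells differ by a null set.\<close>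

lemma cells_idx:
  assumes "0 < \<epsilon>"
  shows "{x. idx \<epsilon> x \<in> I} \<subseteq> cells \<epsilon> I" "negligible (cells \<epsilon> I - {x. idx \<epsilon> x \<in> I})"
proof -
  show "{x. idx \<epsilon> x \<in> I} \<subseteq> cells \<epsilon> I"
    unfolding cells_def using mem_cell_idx[OF assms] by blast
  define N where "N = (\<Union>(i, j)\<in>{(i, j). i \<noteq> j}. cell \<epsilon> (pt \<epsilon> i) \<inter> cell \<epsilon> (pt \<epsilon> j))"
  have "negligible N"
    unfolding N_def
  proof (rule negligible_countable_Union)
    show "countable ((\<lambda>(i, j). cell \<epsilon> (pt \<epsilon> i) \<inter> cell \<epsilon> (pt \<epsilon> j)) ` {(i, j). i \<noteq> j})" by simp
    show "negligible S" if "S \<in> (\<lambda>(i, j). cell \<epsilon> (pt \<epsilon> i) \<inter> cell \<epsilon> (pt \<epsilon> j)) ` {(i, j). i \<noteq> j}" for S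
      using that cell_Int_null[OF assms] by (auto simp: negligible_iff_null_sets)
  qed
  moreover have "cells \<epsilon> I - {x. idx \<epsilon> x \<in> I} \<subseteq> N"
  proof
    fix x assume "x \<in> cells \<epsilon> I - {x. idx \<epsilon> x \<in> I}"
    then obtain i where i: "i \<in> I" "x \<in> cell \<epsilon> (pt \<epsilon> i)" "idx \<epsilon> x \<notin> I" unfolding cells_def by blast
    then have "(i, idx \<epsilon> x) \<in> {(i, j). i \<noteq> j}" by blast
    moreover have "x \<in> cell \<epsilon> (pt \<epsilon> i) \<inter> cell \<epsilon> (pt \<epsilon> (idx \<epsilon> x))" using i mem_cell_idx[OF assms]
        by blast
    ultimately show "x \<in> N" unfolding N_def by blast
  qed
  ultimately show "negligible (cells \<epsilon> I - {x. idx \<epsilon> x \<in> I})" by (rule negligible_subset)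
qed

context plane_norm
begin

text \<open>The area of the closed ball of \<open>\<phi>\<close>.\<close>

definition vol :: "real \<Rightarrow> real" where
  "vol r = measure lebesgue {x. \<phi> x \<le> r}"

lemma bounded_phi: "bounded {x. \<phi> x \<le> r}"
  unfolding bounded_iff
proof (intro exI ballI)
  fix x assume "x \<in> {x. \<phi> x \<le> r}"
  then have "kap * \<phi> x \<le> kap * r" using kap_ge1 by (intro mult_left_mono) auto
  then show "norm x \<le> kap * r" using norm_le_kap[of x] by linarith
qed

lemma phi_borel [measurable]: "\<phi> \<in> borel_measurable borel"
  by (rule borel_measurable_continuous_onI[OF continuous])

lemma phi_lmeasurable: "{x. \<phi> x \<le> r} \<in> lmeasurable"
  by (rule bounded_set_imp_lmeasurable[OF bounded_phi]) simp

lemma phi_subset_lmeasurable: "A \<in> sets lebesgue \<Longrightarrow> A \<subseteq> {x. \<phi> x \<le> r} \<Longrightarrow> A \<in> lmeasurable"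
  using bounded_set_imp_lmeasurable[OF bounded_subset[OF bounded_phi]] by blast

lemma measure_le_vol: "A \<in> sets lebesgue \<Longrightarrow> A \<subseteq> {x. \<phi> x \<le> r} \<Longrightarrow> measure lebesgue A \<le> vol r"
  unfolding vol_def by (rule measure_mono_fmeasurable[OF _ _ phi_lmeasurable])

lemma vol_scale: "0 \<le> r \<Longrightarrow> vol r = r\<^sup>2 * vol 1"
proof (cases "r = 0")
  case True
  have "\<phi> x \<le> 0 \<longleftrightarrow> x = 0" for x using nonneg[of x] zero_iff[of x] by linarith
  then have "{x. \<phi> x \<le> r} = {0}" using True by simp
  then show ?thesis using True by (simp add: vol_def)
next
  case False
  assume "0 \<le> r"
  then have r: "0 < r" using False by simp
  have "{x. \<phi> x \<le> r} = (\<lambda>x. r *\<^sub>R x + 0) ` {x. \<phi> x \<le> 1}"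
  proof (intro equalityI subsetI)
    fix x assume x: "x \<in> {x. \<phi> x \<le> r}"
    have "x = r *\<^sub>R ((1 / r) *\<^sub>R x) + 0" using r by simp
    moreover have "(1 / r) *\<^sub>R x \<in> {x. \<phi> x \<le> 1}" using x r by (simp add: scale)
    ultimately show "x \<in> (\<lambda>x. r *\<^sub>R x + 0) ` {x. \<phi> x \<le> 1}" by (rule image_eqI)
  next
    fix x assume "x \<in> (\<lambda>x. r *\<^sub>R x + 0) ` {x. \<phi> x \<le> 1}"
    then obtain y where y: "\<phi> y \<le> 1" "x = r *\<^sub>R y + 0" by blast
    then have "\<phi> x = r * \<phi> y" using r by (simp add: scale)
    then show "x \<in> {x. \<phi> x \<le> r}" using r mult_left_mono[OF y(1), of r] by simp
  qed
  then have "vol r = measure lebesgue ((\<lambda>x. r *\<^sub>R x + 0) ` {x. \<phi> x \<le> 1})" by (simp only: vol_def)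
  also have "\<dots> = \<bar>r\<bar> ^ DIM(plane) * vol 1" unfolding vol_def by (rule measure_lebesgue_affine)
  finally show ?thesis using r by (simp add: power2_eq_square)
qed

lemma vol_nonneg: "0 \<le> vol r" by (simp add: vol_def)

end

section \<open>Area not covered by checkerboard tiles\<close>

text \<open>The plane is partitioned into \<open>2 \<times> 2\<close> blocks of cells with even lower left corner; this is
  the corner of the block of \<open>i\<close>.\<close>

definition tile :: "index \<Rightarrow> index" where
  "tile i = (2 * (fst i div 2), 2 * (snd i div 2))"

lemma int_div_eq_iff:
  fixes L x a :: int
  assumes "0 < L"
  shows "x div L = a \<longleftrightarrow> L * a \<le> x \<and> x < L * a + L"
proof
  assume "x div L = a"
  then have "x = L * a + x mod L" using mult_div_mod_eq[of L x] by simp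
  then show "L * a \<le> x \<and> x < L * a + L" using pos_mod_bound[OF assms, of x] pos_mod_sign[OF assms,
      of x] by linarith
next
  assume x: "L * a \<le> x \<and> x < L * a + L"
  then show "x div L = a" by (intro int_div_pos_eq[of x L a "x - L * a"]) auto
qed

lemma mem_box_mult:
  "0 < L \<Longrightarrow> i \<in> grid_box (L * a) (L * b) L \<longleftrightarrow> fst i div L = a \<and> snd i div L = b"
  by (auto simp: grid_box_def mem_Times_iff int_div_eq_iff)

lemma tile_div:
  assumes "0 < L" "even L"
  shows "fst (tile i) div L = fst i div L" "snd (tile i) div L = snd i div L"
proof -
  obtain m where m: "L = 2 * m" using assms(2) by blast
  have "2 * (x div 2) div L = x div L" for x
    using assms(1) unfolding m by (simp add: zdiv_zmult2_eq)
  then show "fst (tile i) div L = fst i div L" "snd (tile i) div L = snd i div L" by (simp_all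
      add: tile_def)
qed

lemma mem_tile: "i \<in> {tile i, tile i + (1, 0), tile i + (0, 1), tile i + (1, 1)}"
proof -
  have "x = 2 * (x div 2) \<or> x = 2 * (x div 2) + 1" for x :: int by presburger
  then have "fst i = 2 * (fst i div 2) \<or> fst i = 2 * (fst i div 2) + 1"
    "snd i = 2 * (snd i div 2) \<or> snd i = 2 * (snd i div 2) + 1" by blast+
  then show ?thesis by (auto simp: tile_def prod_eq_iff)
qed

lemma card_bad_tiles_le:
  assumes L: "0 < L" "even L"
  shows "card {i \<in> grid_box (L * a) (L * b) L. \<not> diag I (tile i)} \<le> 4 * card {q \<in> grid_box (L * a)
      (L * b) L. \<not> diag I q}"
proof -
  let ?B = "{q \<in> grid_box (L * a) (L * b) L. \<not> diag I q}"
  have "{i \<in> grid_box (L * a) (L * b) L. \<not> diag I (tile i)} \<subseteq> (\<Union>q\<in>?B. {q, q + (1, 0), q + (0, 1),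
      q + (1, 1)})"
  proof
    fix i assume "i \<in> {i \<in> grid_box (L * a) (L * b) L. \<not> diag I (tile i)}"
    then have "tile i \<in> ?B" using tile_div[OF L] by (simp add: mem_box_mult[OF L(1)])
    then show "i \<in> (\<Union>q\<in>?B. {q, q + (1, 0), q + (0, 1), q + (1, 1)})" using mem_tile[of i] by blast
  qed
  then have "card {i \<in> grid_box (L * a) (L * b) L. \<not> diag I (tile i)} \<le> card (\<Union>q\<in>?B. {q, q + (1,
      0), q + (0, 1), q + (1, 1)})"
    by (intro card_mono finite_UN_I) auto
  also have "\<dots> \<le> (\<Sum>q\<in>?B. card {q, q + (1, 0), q + (0, 1), q + (1, 1)})" by (rule card_UN_le) simp
  also have "\<dots> \<le> (\<Sum>q\<in>?B. 4)"
  proof (rule sum_mono)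
    fix q :: index
    have "card {q, q + (1, 0), q + (0, 1), q + (1, 1)} \<le> length [q, q + (1, 0), q + (0, 1), q + (1, 1)]"
      using card_length[of "[q, q + (1, 0), q + (0, 1), q + (1, 1)]"] by simp
    then show "card {q, q + (1, 0), q + (0, 1), q + (1, 1)} \<le> 4" by simp
  qed
  finally show ?thesis by simp
qed

context step_sequence
begin

text \<open>Each of the two empty points of a diagonal square has two neighbours in the set, so that
  it stays empty.\<close>

lemma diag_Suc:
  assumes "diag (I k) q"
  shows "diag (I (Suc k)) q"
proof -
  have hole: "i \<notin> I (Suc k)" if "i \<notin> I k" "adj i j" "adj i l" "j \<noteq> l" "j \<in> I k" "l \<in> I k" for i j l
    using step_hole[OF eps tau I_fin I_ne step, of i k j l] that I_mono[of k "Suc k"] by auto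
  have keep: "i \<in> I (Suc k)" if "i \<in> I k" for i using that I_mono[of k "Suc k"] by auto
  have a: "adj q (q + (1, 0))" "adj q (q + (0, 1))" "adj (q + (1, 1)) (q + (1, 0))" "adj (q + (1,
      1)) (q + (0, 1))"
    "adj (q + (1, 0)) q" "adj (q + (0, 1)) q" "adj (q + (1, 0)) (q + (1, 1))" "adj (q + (0, 1)) (q
        + (1, 1))"
    by (auto simp: adj_def)
  have n: "q + (1, 0) \<noteq> q + (0, 1)" "q \<noteq> q + (1, 1)" by (auto simp: prod_eq_iff)
  show ?thesis
  proof (cases "q \<in> I k")
    case True
    then have "q + (1, 1) \<in> I k" "q + (1, 0) \<notin> I k" "q + (0, 1) \<notin> I k" using assms by (auto simp:
        diag_def)
    then show ?thesis
      using True keep hole[OF _ a(5,7) n(2)] hole[OF _ a(6,8) n(2)] unfolding diag_def by simp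
  next
    case False
    then have "q + (1, 1) \<notin> I k" "q + (1, 0) \<in> I k" "q + (0, 1) \<in> I k" using assms by (auto simp:
        diag_def)
    then show ?thesis
      using False keep hole[OF _ a(1,2) n(1)] hole[OF _ a(3,4) n(1)] unfolding diag_def by simp
  qed
qed

lemma diag_mono: "j \<le> k \<Longrightarrow> diag (I j) q \<Longrightarrow> diag (I k) q"
  by (induction k rule: dec_induct) (auto intro: diag_Suc)

text \<open>The points that are, before one of the first \<open>K\<close> steps, at a distance close to the radius
  \<open>4 \<tau>\<close> that the step fills.\<close>

definition fringe :: "nat \<Rightarrow> real \<Rightarrow> plane set" where
  "fringe K s = (\<Union>k<K. shell (pt \<epsilon> ` I k) (4 * \<tau> / s) (4 * \<tau> * s))"

text \<open>Each piece of the fringe is small compared with the region that is filled in the same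
  step. These regions are disjoint, since after the step their points are at distance \<open>O(\<epsilon>)\<close>.\<close>

lemma measure_fringe:
  assumes M: "1 \<le> M" and s: "1 < s" "s ^ (2 * M) \<le> 4"
    and small: "4 * \<tau> / s < 4 * \<tau> - kap * \<epsilon>" "2 * kap * \<epsilon> \<le> \<tau> / 2" and R: "4 * \<tau> * K \<le> R"
  shows "measure lebesgue (fringe K s) \<le> 16 / M * vol R"
proof -
  let ?A = "\<lambda>k. shell (pt \<epsilon> ` I k) (4 * \<tau> / 8) (4 * \<tau> / s)"
  let ?B = "\<lambda>k. shell (pt \<epsilon> ` I k) (4 * \<tau> / s) (4 * \<tau> * s)"
  have B: "measure lebesgue (?B k) \<le> 16 / M * measure lebesgue (?A k)" for k
  proof -
    have "M * measure lebesgue (?B k) \<le> 16 * measure lebesgue (?A k)"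
      by (rule measure_shell_small[OF pts_fin pts_ne _ s M]) (use tau in simp)
    then show ?thesis using M by (simp add: field_simps)
  qed
  have "measure lebesgue (fringe K s) \<le> (\<Sum>k<K. measure lebesgue (?B k))"
    unfolding fringe_def by (intro measure_UNION_le) (auto intro: shell_lmeasurable[OF pts_fin
        pts_ne] fmeasurableD)
  also have "\<dots> \<le> (\<Sum>k<K. 16 / M * measure lebesgue (?A k))" by (rule sum_mono) (rule B)
  also have "\<dots> = 16 / M * (\<Sum>k<K. measure lebesgue (?A k))" by (simp add: sum_distrib_left)
  also have "(\<Sum>k<K. measure lebesgue (?A k)) = measure lebesgue (\<Union>k<K. ?A k)"
  proof (rule measure_finite_Union[symmetric])
    show "disjoint_family_on ?A {..<K}"
      unfolding disjoint_family_on_def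
    proof (intro ballI impI)
      have less: "?A j \<inter> ?A k = {}" if "j < k" for j k
      proof (rule equals0I)
        fix x assume x: "x \<in> ?A j \<inter> ?A k"
        then have "d j x \<le> 4 * \<tau> / s" "4 * \<tau> / 8 < d k x" by (auto simp: shell_def d_def)
        then have "d (Suc j) x \<le> 2 * kap * \<epsilon>" using small(1) by (intro d_Suc_small) simp
        moreover have "d k x \<le> d (Suc j) x" using that by (intro d_antimono) simp
        ultimately show False using \<open>4 * \<tau> / 8 < d k x\<close> small(2) by simp
      qed
      fix j k :: nat assume "j \<noteq> k"
      then show "?A j \<inter> ?A k = {}" using less[of j k] less[of k j] by (cases j k rule:
          linorder_cases) auto
    qed
    show "emeasure lebesgue (?A k) \<noteq> \<infinity>" for k
      unfolding infinity_ennreal_def by (rule fmeasurableD2[OF shell_lmeasurable[OF pts_fin pts_ne]])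
  qed (auto intro: shell_lmeasurable[OF pts_fin pts_ne] fmeasurableD)
  also have "16 / M * measure lebesgue (\<Union>k<K. ?A k) \<le> 16 / M * vol R"
  proof (intro mult_left_mono measure_le_vol)
    show "(\<Union>k<K. ?A k) \<in> sets lebesgue"
      by (intro sets.finite_UN) (auto intro: shell_lmeasurable[OF pts_fin pts_ne] fmeasurableD)
    show "(\<Union>k<K. ?A k) \<subseteq> {x. \<phi> x \<le> R}"
    proof clarify
      fix a b k assume k: "k < K" and x: "(a, b) \<in> ?A k"
      have "d k (a, b) \<le> 4 * \<tau> / s" using x by (auto simp: shell_def d_def)
      also have "\<dots> \<le> 4 * \<tau>" using s(1) tau by (simp add: field_simps)
      finally have "d k (a, b) \<le> 4 * \<tau>" .
      moreover have "4 * \<tau> * (real k + 1) \<le> 4 * \<tau> * K" using k tau by (intro mult_left_mono) auto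
      ultimately show "\<phi> (a, b) \<le> R" using phi_le_d[of "(a, b)" k] R by (simp add: distrib_left)
    qed
  qed simp
  finally show ?thesis .
qed

text \<open>Take the first \<open>k\<close> with \<open>d k x \<le> 4 * \<tau> / s\<close>. One step earlier \<open>x\<close> was farther than
  \<open>4 * \<tau> * s\<close>, because it is not in the fringe, and a step reduces the distance by at most
  \<open>4 * \<tau>\<close>.\<close>

lemma exists_front_ahead:
  assumes s: "1 < s" and small: "2 * kap * \<epsilon> \<le> \<tau> / 2" "2 * kap * \<epsilon> \<le> 4 * \<tau> / s"
    and x: "x \<notin> fringe K s" "4 * \<tau> < \<phi> x" "\<phi> x \<le> (real K - 1) * (4 * \<tau> - 4 * kap * \<epsilon>)"
  shows "\<exists>k<K. 4 * \<tau> * (s - 1) \<le> d k x \<and> d k x \<le> 4 * \<tau> / s"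
proof -
  have K: "1 < real K"
  proof (rule ccontr)
    assume "\<not> 1 < real K"
    then have "(real K - 1) * (4 * \<tau> - 4 * kap * \<epsilon>) \<le> 0"
      using small(1) tau by (intro mult_nonpos_nonneg) auto
    then show False using x(2,3) tau by simp
  qed
  have "d (K - 1) x \<le> 2 * kap * \<epsilon>"
    using x(3) K small(1) tau by (intro d_small) (auto simp: of_nat_diff)
  then have late: "d (K - 1) x \<le> 4 * \<tau> / s" using small(2) by simp
  define k where "k = (LEAST k. d k x \<le> 4 * \<tau> / s)"
  have k: "d k x \<le> 4 * \<tau> / s" unfolding k_def by (rule LeastI) (rule late)
  have kK: "k \<le> K - 1" unfolding k_def by (rule Least_le) (rule late)
  have "4 * \<tau> / s \<le> 4 * \<tau>" using s tau by (simp add: field_simps)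
  then have "k \<noteq> 0" using k x(2) by (auto simp: d_0 intro: ccontr)
  then obtain j where j: "k = Suc j" by (cases k) auto
  have "\<not> d j x \<le> 4 * \<tau> / s" using not_less_Least[of j "\<lambda>k. d k x \<le> 4 * \<tau> / s", folded k_def] j by simp
  moreover have "x \<notin> shell (pt \<epsilon> ` I j) (4 * \<tau> / s) (4 * \<tau> * s)"
    using x(1) kK j K unfolding fringe_def by auto
  ultimately have "4 * \<tau> * s < d j x" by (auto simp: shell_def d_def)
  then have "4 * \<tau> * (s - 1) \<le> d k x" using d_Suc_ge[of j x] j by (simp add: right_diff_distrib)
  then show ?thesis using k kK K by (intro exI[of _ k]) auto
qed

lemma box_bad_tiles:
  assumes s: "1 < s" and L: "4 \<le> L" "even L"
    and small: "3 * kap * L * \<epsilon> < 4 * \<tau> * (s - 1)"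
    and k: "k < K" "4 * \<tau> * (s - 1) \<le> d k x" "d k x \<le> 4 * \<tau> / s" and x: "idx \<epsilon> x \<in> grid_box (L *
        a) (L * b) L"
  shows "real (card {i \<in> grid_box (L * a) (L * b) L. \<not> diag (I K) (tile i)})
      \<le> 4 * (54 / L + 2 * (3 * kap * L * \<epsilon> / \<tau>)) / (1 - 1 / s) * (real_of_int L)\<^sup>2"
    and "\<And>j. j \<in> grid_box (L * a) (L * b) L \<Longrightarrow> \<phi> (pt \<epsilon> j - x) \<le> 3 * kap * L * \<epsilon>"
proof -
  let ?X = "grid_box (L * a) (L * b) L"
  define h where "h = 3 * kap * L * \<epsilon> / \<tau>"
  have L0: "0 < real_of_int L" using L by simp
  show near: "\<phi> (pt \<epsilon> j - x) \<le> 3 * kap * L * \<epsilon>" if j: "j \<in> ?X" for j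
  proof -
    have "\<bar>fst j - fst (idx \<epsilon> x)\<bar> \<le> L - 1" "\<bar>snd j - snd (idx \<epsilon> x)\<bar> \<le> L - 1"
      using j x by (auto simp: grid_box_def mem_Times_iff)
    then have "real_of_int (\<bar>fst j - fst (idx \<epsilon> x)\<bar> + \<bar>snd j - snd (idx \<epsilon> x)\<bar>) \<le> real_of_int (2 *
        L - 2)"
      by (intro of_int_le_iff[THEN iffD2]) simp
    then have "\<epsilon> * of_int (\<bar>fst j - fst (idx \<epsilon> x)\<bar> + \<bar>snd j - snd (idx \<epsilon> x)\<bar>) \<le> \<epsilon> * real_of_int (2
        * L - 2)"
      using eps by (intro mult_left_mono) auto
    then have "norm (pt \<epsilon> j - pt \<epsilon> (idx \<epsilon> x)) \<le> \<epsilon> * real_of_int (2 * L - 2)"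
      using norm_pt_diff_le[of \<epsilon> j "idx \<epsilon> x"] eps by linarith
    then have "norm (pt \<epsilon> j - x) \<le> \<epsilon> * real_of_int (2 * L - 2) + \<epsilon>"
      using norm_diff_pt_le[OF mem_cell_idx[OF eps, of x]] norm_triangle_ineq[of "pt \<epsilon> j - pt \<epsilon>
          (idx \<epsilon> x)" "pt \<epsilon> (idx \<epsilon> x) - x"]
      by (simp add: norm_minus_commute)
    also have "\<dots> \<le> 3 * L * \<epsilon>" using eps L by (simp add: algebra_simps)
    finally have "kap * norm (pt \<epsilon> j - x) \<le> kap * (3 * L * \<epsilon>)" using kap_ge1 by (intro
        mult_left_mono) auto
    then show ?thesis using le_kap[of "pt \<epsilon> j - x"] by (simp add: mult.assoc mult.left_commute)
  qed
  have dj: "\<bar>d k (pt \<epsilon> j) - d k x\<bar> \<le> 3 * kap * L * \<epsilon>" if "j \<in> ?X" for j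
    using near[OF that] d_lipschitz[of k "pt \<epsilon> j" x] d_lipschitz[of k x "pt \<epsilon> j"] sym[of x "pt \<epsilon>
        j"] by linarith
  have disj: "?X \<inter> I k = {}"
  proof (rule equals0I)
    fix j assume j: "j \<in> ?X \<inter> I k"
    then have "d k (pt \<epsilon> j) = 0" using d_pt_eq_0_iff by blast
    then show False using dj[of j] j small k(2) by auto
  qed
  define \<theta> where "\<theta> = d k x / \<tau>"
  have \<theta>: "0 \<le> \<theta>" "\<theta> \<le> 4 / s" "\<theta> \<le> 4"
  proof -
    show "0 \<le> \<theta>" using d_nonneg tau by (simp add: \<theta>_def)
    show 1: "\<theta> \<le> 4 / s" using k(3) tau s by (simp add: \<theta>_def field_simps)
    have "4 / s \<le> 4" using s by (simp add: field_simps)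
    then show "\<theta> \<le> 4" using 1 by simp
  qed
  have osc: "\<bar>gap \<phi> (pt \<epsilon> ` I k) (pt \<epsilon> j) / \<tau> - \<theta>\<bar> \<le> h" if "j \<in> ?X" for j
  proof -
    have "\<bar>gap \<phi> (pt \<epsilon> ` I k) (pt \<epsilon> j) / \<tau> - \<theta>\<bar> = \<bar>d k (pt \<epsilon> j) - d k x\<bar> / \<tau>"
      using tau by (simp add: \<theta>_def d_def flip: diff_divide_distrib)
    also have "\<dots> \<le> h" unfolding h_def using dj[OF that] tau by (intro divide_right_mono) auto
    finally show ?thesis .
  qed
  have count: "(1 - \<theta> / 4) * card {q \<in> ?X. \<not> diag (I (Suc k)) q} \<le> 54 * L + 2 * h * L\<^sup>2"
    using box_not_diag_count[OF eps tau I_fin I_ne step L(1) disj \<theta>(1,3) osc] by simp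
  have s1: "0 < 1 - 1 / s" using s by simp
  have "(1 - 1 / s) * card {q \<in> ?X. \<not> diag (I (Suc k)) q} \<le> (1 - \<theta> / 4) * card {q \<in> ?X. \<not> diag (I
      (Suc k)) q}"
    using \<theta>(2) by (intro mult_right_mono) auto
  also note count
  also have "54 * L + 2 * h * L\<^sup>2 = (54 / L + 2 * h) * (real_of_int L)\<^sup>2"
    using L0 by (simp add: power2_eq_square field_simps)
  finally have c: "real (card {q \<in> ?X. \<not> diag (I (Suc k)) q}) \<le> (54 / L + 2 * h) / (1 - 1 / s) *
      (real_of_int L)\<^sup>2"
    using s1 by (simp add: pos_le_divide_eq mult.commute)
  have "{q \<in> ?X. \<not> diag (I K) q} \<subseteq> {q \<in> ?X. \<not> diag (I (Suc k)) q}"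
    using diag_mono[of "Suc k" K] k(1) by auto
  then have "card {q \<in> ?X. \<not> diag (I K) q} \<le> card {q \<in> ?X. \<not> diag (I (Suc k)) q}"
    by (intro card_mono) auto
  moreover have "card {i \<in> ?X. \<not> diag (I K) (tile i)} \<le> 4 * card {q \<in> ?X. \<not> diag (I K) q}"
    by (rule card_bad_tiles_le) (use L in auto)
  ultimately have "real (card {i \<in> ?X. \<not> diag (I K) (tile i)}) \<le> 4 * real (card {q \<in> ?X. \<not> diag (I
      (Suc k)) q})"
    by linarith
  also have "\<dots> \<le> 4 * ((54 / L + 2 * h) / (1 - 1 / s) * (real_of_int L)\<^sup>2)" using c by simp
  finally show "real (card {i \<in> ?X. \<not> diag (I K) (tile i)}) \<le> 4 * (54 / L + 2 * (3 * kap * L * \<epsilon> /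
      \<tau>)) / (1 - 1 / s) * (real_of_int L)\<^sup>2"
  proof -
    assume le: "real (card {i \<in> ?X. \<not> diag (I K) (tile i)}) \<le> 4 * ((54 / L + 2 * h) / (1 - 1 / s)
        * (real_of_int L)\<^sup>2)"
    have eq: "4 * (x / y * z) = 4 * x / y * z" for x y z :: real by simp
    show ?thesis using le unfolding eq h_def .
  qed
qed

lemma idx_borel: "{x. P (idx \<epsilon> x)} \<in> sets borel"
proof -
  have "{x. P (idx \<epsilon> x)} = (\<Union>i\<in>{i. P i}. {x. idx \<epsilon> x \<in> {i}})" by blast
  also have "\<dots> \<in> sets borel" by (intro sets.countable_UN') (auto intro: idx_vimage(1)[OF eps, of
      "{_}", simplified])
  finally show ?thesis .
qed

text \<open>The four terms bound the area of the fringe, of a neighbourhood of the origin, of the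
  annulus between the radius certainly reached one step before and \<open>R\<close>, and of the bad tiles in
  the boxes to which the comparison applies.\<close>

lemma measure_bad_tiles:
  assumes M: "1 \<le> M" and s: "1 < s" "s ^ (2 * M) \<le> 4" and L: "4 \<le> L" "even L"
    and small: "4 * \<tau> / s < 4 * \<tau> - kap * \<epsilon>" "2 * kap * \<epsilon> \<le> \<tau> / 2" "2 * kap * \<epsilon> \<le> 4 * \<tau> / s"
      "3 * kap * L * \<epsilon> < 4 * \<tau> * (s - 1)"
    and R: "4 * \<tau> * K \<le> R"
  shows "measure lebesgue {x. \<phi> x < R \<and> \<not> diag (I K) (tile (idx \<epsilon> x))}
    \<le> 16 / M * vol R + vol (4 * \<tau>) + (vol R - vol (max 0 ((real K - 1) * (4 * \<tau> - 4 * kap * \<epsilon>))))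
      + 4 * (54 / L + 2 * (3 * kap * L * \<epsilon> / \<tau>)) / (1 - 1 / s) * vol (R + 4 * kap * L * \<epsilon>)"
proof -
  define r where "r = (real K - 1) * (4 * \<tau> - 4 * kap * \<epsilon>)"
  define c where "c = 4 * (54 / L + 2 * (3 * kap * L * \<epsilon> / \<tau>)) / (1 - 1 / s)"
  let ?W = "{x. \<phi> x < R \<and> \<not> diag (I K) (tile (idx \<epsilon> x))}"
  have L0: "0 < L" using L by simp
  have c0: "0 \<le> c" unfolding c_def using s(1) L kap_ge1 eps tau by (intro divide_nonneg_nonneg
      mult_nonneg_nonneg add_nonneg_nonneg) auto
  have R0: "0 \<le> R" using R tau by (meson mult_nonneg_nonneg of_nat_0_le_iff order_trans
      less_imp_le zero_le_numeral)
  have rR: "max 0 r \<le> R"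
  proof -
    have "r \<le> real K * (4 * \<tau>)"
    proof (cases "1 \<le> real K")
      case True
      then show ?thesis unfolding r_def using tau kap_ge1 eps small(2) by (intro mult_mono) auto
    next
      case False
      then have "r \<le> 0" unfolding r_def using small(2) tau by (intro mult_nonpos_nonneg) auto
      then show ?thesis using tau by (meson mult_nonneg_nonneg of_nat_0_le_iff order_trans
          less_imp_le zero_le_numeral)
    qed
    then show ?thesis using R R0 by (simp add: mult.commute mult.left_commute)
  qed
  \<comment> \<open>the good points, and the boxes that contain one of them\<close>
  define G where "G = {x. 4 * \<tau> < \<phi> x \<and> \<phi> x \<le> r \<and> x \<notin> fringe K s}"
  define blk where "blk i = (fst i div L, snd i div L)" for i :: index
  define OK where "OK = (\<lambda>x. blk (idx \<epsilon> x)) ` G"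
  have OK: "real (card {i \<in> grid_box (L * a) (L * b) L. \<not> diag (I K) (tile i)}) \<le> c * (real_of_int L)\<^sup>2"
    "\<And>j. j \<in> grid_box (L * a) (L * b) L \<Longrightarrow> \<phi> (pt \<epsilon> j) \<le> R + 3 * kap * L * \<epsilon>"
    if ab: "(a, b) \<in> OK" for a b
  proof -
    obtain x where x: "x \<in> G" "blk (idx \<epsilon> x) = (a, b)" using ab unfolding OK_def by force
    then have xb: "idx \<epsilon> x \<in> grid_box (L * a) (L * b) L" by (simp add: mem_box_mult[OF L0] blk_def)
    have "\<exists>k<K. 4 * \<tau> * (s - 1) \<le> d k x \<and> d k x \<le> 4 * \<tau> / s"
      using x(1) by (intro exists_front_ahead[OF s(1) small(2,3)]) (auto simp: G_def r_def)
    then obtain k where k: "k < K" "4 * \<tau> * (s - 1) \<le> d k x" "d k x \<le> 4 * \<tau> / s" by blast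
    note bb = box_bad_tiles[OF s(1) L small(4) k xb]
    show "real (card {i \<in> grid_box (L * a) (L * b) L. \<not> diag (I K) (tile i)}) \<le> c * (real_of_int L)\<^sup>2"
      unfolding c_def by (rule bb(1))
    fix j assume "j \<in> grid_box (L * a) (L * b) L"
    then have "\<phi> (pt \<epsilon> j - x) \<le> 3 * kap * L * \<epsilon>" by (rule bb(2))
    moreover have "\<phi> x \<le> R" using x(1) rR by (simp add: G_def)
    ultimately show "\<phi> (pt \<epsilon> j) \<le> R + 3 * kap * L * \<epsilon>" using triangle[of "pt \<epsilon> j - x" x] by simp
  qed
  define S where "S = {i. blk i \<in> OK}"
  have mem_blk: "i \<in> grid_box (L * a) (L * b) L \<longleftrightarrow> blk i = (a, b)" for i a b
    by (simp add: mem_box_mult[OF L0] blk_def)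
  have S_phi: "\<phi> (pt \<epsilon> i) \<le> R + 3 * kap * L * \<epsilon>" if "i \<in> S" for i
    using OK(2)[of "fst (blk i)" "snd (blk i)" i] that mem_blk[of i "fst (blk i)" "snd (blk i)"]
        by (simp add: S_def)
  have "pt \<epsilon> (0, 0) = 0" by (simp add: pt_def zero_prod_def)
  then have "gap \<phi> (pt \<epsilon> ` {(0, 0)}) x = \<phi> x" for x by (simp add: gap_def)
  then have "finite {i. \<phi> (pt \<epsilon> i) \<le> R + 3 * kap * L * \<epsilon>}"
    using finite_gap_le[OF eps, of "{(0, 0)}" "R + 3 * kap * L * \<epsilon>"] by simp
  then have finS: "finite S" by (rule finite_subset[rotated]) (use S_phi in blast)
  have "OK \<subseteq> blk ` S"
  proof
    fix p assume "p \<in> OK"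
    then show "p \<in> blk ` S" unfolding OK_def S_def by blast
  qed
  then have finOK: "finite OK" using finS finite_subset by blast
  have S_un: "S = (\<Union>(a, b)\<in>OK. grid_box (L * a) (L * b) L)" using mem_blk by (auto simp: S_def)
  have disj: "grid_box (L * fst p) (L * snd p) L \<inter> grid_box (L * fst q) (L * snd q) L = {}" if "p
      \<noteq> q" for p q
    using that mem_blk by (auto simp: prod_eq_iff disjoint_iff)
  have cardS: "real (card S) = card OK * (real_of_int L)\<^sup>2"
  proof -
    have "card S = (\<Sum>p\<in>OK. card (grid_box (L * fst p) (L * snd p) L))"
      unfolding S_un case_prod_unfold by (rule card_UN_disjoint) (use finOK disj in auto)
    then have "real (card S) = (\<Sum>p\<in>OK. real (card (grid_box (L * fst p) (L * snd p) L)))" by simp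
    then show ?thesis using L by (simp add: card_grid_box)
  qed
  define B where "B = {i \<in> S. \<not> diag (I K) (tile i)}"
  have cardB: "real (card B) \<le> c * card S"
  proof -
    have "B = (\<Union>p\<in>OK. {i \<in> grid_box (L * fst p) (L * snd p) L. \<not> diag (I K) (tile i)})"
      unfolding B_def S_un case_prod_unfold by blast
    then have "card B \<le> (\<Sum>p\<in>OK. card {i \<in> grid_box (L * fst p) (L * snd p) L. \<not> diag (I K) (tile i)})"
      using card_UN_le[OF finOK] by simp
    then have "real (card B) \<le> (\<Sum>p\<in>OK. real (card {i \<in> grid_box (L * fst p) (L * snd p) L. \<not> diag
        (I K) (tile i)}))"
      by (simp flip: of_nat_sum)
    also have "\<dots> \<le> (\<Sum>p\<in>OK. c * (real_of_int L)\<^sup>2)" by (rule sum_mono) (rule OK(1), simp)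
    finally show ?thesis by (simp add: cardS algebra_simps)
  qed
  have mS: "\<epsilon>\<^sup>2 * card S \<le> vol (R + 4 * kap * L * \<epsilon>)"
  proof -
    have "{x. idx \<epsilon> x \<in> S} \<subseteq> {x. \<phi> x \<le> R + 4 * kap * L * \<epsilon>}"
    proof clarify
      fix a b assume "idx \<epsilon> (a, b) \<in> S"
      then have "\<phi> (pt \<epsilon> (idx \<epsilon> (a, b))) \<le> R + 3 * kap * L * \<epsilon>" by (rule S_phi)
      moreover have "kap * \<epsilon> * 1 \<le> kap * \<epsilon> * L" using L kap_ge1 eps by (intro mult_left_mono) auto
      ultimately show "\<phi> (a, b) \<le> R + 4 * kap * L * \<epsilon>"
        using triangle[of "(a, b) - pt \<epsilon> (idx \<epsilon> (a, b))" "pt \<epsilon> (idx \<epsilon> (a, b))"] phi_idx[of "(a, b)"]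
        by (simp add: mult.commute mult.left_commute)
    qed
    then have "measure lebesgue {x. idx \<epsilon> x \<in> S} \<le> vol (R + 4 * kap * L * \<epsilon>)"
      using idx_vimage(1)[OF eps finS] by (intro measure_le_vol) auto
    then show ?thesis using idx_vimage(3)[OF eps finS] by simp
  qed
  have finB: "finite B" using finS by (simp add: B_def)
  define A1 where "A1 = {x. \<phi> x \<le> 4 * \<tau>}"
  define A2 where "A2 = {x. \<phi> x \<le> R} - {x. \<phi> x \<le> max 0 r}"
  define A3 where "A3 = {x. idx \<epsilon> x \<in> B}"
  have cover: "?W \<subseteq> fringe K s \<union> A1 \<union> A2 \<union> A3"
  proof
    fix x assume x: "x \<in> ?W"
    show "x \<in> fringe K s \<union> A1 \<union> A2 \<union> A3"
    proof (cases "x \<in> fringe K s \<or> x \<in> A1 \<or> x \<in> A2")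
      case False
      then have "4 * \<tau> < \<phi> x" "\<phi> x \<le> max 0 r" "x \<notin> fringe K s" using x by (auto simp: A1_def A2_def)
      then have "x \<in> G" using tau by (auto simp: G_def)
      then have "idx \<epsilon> x \<in> S" by (auto simp: S_def OK_def)
      then show ?thesis using x by (auto simp: A3_def B_def)
    qed blast
  qed
  have meas: "fringe K s \<in> lmeasurable" "A1 \<in> lmeasurable" "A2 \<in> lmeasurable" "A3 \<in> lmeasurable"
  proof -
    show "fringe K s \<in> lmeasurable"
      unfolding fringe_def by (intro fmeasurable.finite_UN) (auto intro: shell_lmeasurable[OF
          pts_fin pts_ne])
    show "A1 \<in> lmeasurable" "A2 \<in> lmeasurable"
      unfolding A1_def A2_def by (intro phi_lmeasurable fmeasurable.Diff)+
    show "A3 \<in> lmeasurable" unfolding A3_def by (rule idx_vimage(2)[OF eps finB])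
  qed
  have W_meas: "?W \<in> sets lebesgue"
  proof -
    have "?W = {x. \<phi> x < R} \<inter> {x. \<not> diag (I K) (tile (idx \<epsilon> x))}" by blast
    also have "\<dots> \<in> sets borel" by (intro sets.Int idx_borel[of "\<lambda>i. \<not> diag (I K) (tile i)"]) measurable
    finally show ?thesis by simp
  qed
  have "measure lebesgue ?W \<le> measure lebesgue (fringe K s \<union> A1 \<union> A2 \<union> A3)"
    using meas by (intro measure_mono_fmeasurable[OF cover W_meas] fmeasurable.Un)
  also have "\<dots> \<le> measure lebesgue (fringe K s) + measure lebesgue A1 + measure lebesgue A2 +
      measure lebesgue A3"
  proof -
    have "measure lebesgue (fringe K s \<union> A1 \<union> A2 \<union> A3) \<le> measure lebesgue (fringe K s \<union> A1 \<union> A2) +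
        measure lebesgue A3"
      "measure lebesgue (fringe K s \<union> A1 \<union> A2) \<le> measure lebesgue (fringe K s \<union> A1) + measure
          lebesgue A2"
      "measure lebesgue (fringe K s \<union> A1) \<le> measure lebesgue (fringe K s) + measure lebesgue A1"
      using meas by (intro measure_Un_le; simp add: fmeasurableD)+
    then show ?thesis by linarith
  qed
  also have "measure lebesgue (fringe K s) \<le> 16 / M * vol R"
    by (rule measure_fringe[OF M s small(1,2) R])
  also have "measure lebesgue A1 = vol (4 * \<tau>)" by (simp add: A1_def vol_def)
  also have "measure lebesgue A2 = vol R - vol (max 0 r)"
    unfolding A2_def vol_def using rR by (intro measurable_measure_Diff phi_lmeasurable) (auto
        intro: fmeasurableD phi_lmeasurable)
  also have "measure lebesgue A3 \<le> c * vol (R + 4 * kap * L * \<epsilon>)"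
  proof -
    have "measure lebesgue A3 = \<epsilon>\<^sup>2 * card B" unfolding A3_def by (rule idx_vimage(3)[OF eps finB])
    also have "\<dots> \<le> \<epsilon>\<^sup>2 * (c * card S)" by (intro mult_left_mono cardB) simp
    also have "\<dots> = c * (\<epsilon>\<^sup>2 * card S)" by simp
    also have "\<dots> \<le> c * vol (R + 4 * kap * L * \<epsilon>)" by (intro mult_left_mono mS c0)
    finally show ?thesis .
  qed
  finally show ?thesis unfolding c_def r_def by linarith
qed

end

section \<open>Density one half\<close>

lemma idx_pt: "0 < \<epsilon> \<Longrightarrow> idx \<epsilon> (pt \<epsilon> i) = i"
  by (simp add: idx_def pt_def)

text \<open>Exchange of the two horizontally adjacent cells of a tile.\<close>

definition flip :: "index \<Rightarrow> index" where
  "flip i = (if even (fst i) then fst i + 1 else fst i - 1, snd i)"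

lemma flip_flip: "flip (flip i) = i"
  by (simp add: flip_def prod_eq_iff)

lemma tile_flip: "tile (flip i) = tile i"
proof -
  have "(if even x then x + 1 else x - 1) div 2 = x div 2" for x :: int by presburger
  then show ?thesis by (simp add: tile_def flip_def)
qed

lemma flip_diag:
  assumes "diag I (tile i)"
  shows "flip i \<in> I \<longleftrightarrow> i \<notin> I"
proof -
  define q where "q = tile i"
  have ev: "even (fst q)" by (simp add: q_def tile_def)
  have f: "flip q = q + (1, 0)" "flip (q + (1, 0)) = q" "flip (q + (0, 1)) = q + (1, 1)" "flip (q
      + (1, 1)) = q + (0, 1)"
    using ev by (simp_all add: flip_def prod_eq_iff)
  have "diag I q" using assms by (simp add: q_def)
  then have d: "q + (1, 1) \<in> I \<longleftrightarrow> q \<in> I" "q + (0, 1) \<in> I \<longleftrightarrow> q \<notin> I" "q + (1, 0) \<in> I \<longleftrightarrow> q \<notin> I"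
    by (auto simp: diag_def)
  have "i \<in> {q, q + (1, 0), q + (0, 1), q + (1, 1)}" unfolding q_def by (rule mem_tile)
  then show ?thesis by (elim insertE emptyE) (simp_all only: f d not_not)
qed

lemma tile_eq_imp_near:
  assumes "tile i = tile j"
  shows "\<bar>fst i - fst j\<bar> + \<bar>snd i - snd j\<bar> \<le> 2"
proof -
  have "fst i div 2 = fst j div 2" "snd i div 2 = snd j div 2" using assms by (simp_all add: tile_def)
  then have "\<bar>fst i - fst j\<bar> \<le> 1" "\<bar>snd i - snd j\<bar> \<le> 1" by presburger+
  then show ?thesis by linarith
qed

lemma measure_near_complement_tendsto_0:
  fixes V :: "'a::euclidean_space set"
  assumes V: "open V" "bounded V" and c: "c \<longlonglongrightarrow> 0"
  shows "(\<lambda>n. measure lebesgue {x \<in> V. infdist x (- V) < c n}) \<longlonglongrightarrow> 0"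
proof -
  let ?A = "\<lambda>n. {x \<in> V. infdist x (- V) < c n}"
  have Vm: "V \<in> lmeasurable" by (rule bounded_set_imp_lmeasurable) (use V in auto)
  have A: "?A n \<in> sets borel" for n
  proof -
    have "?A n = V \<inter> {x. infdist x (- V) < c n}" by blast
    moreover have "open {x. infdist x (- V) < c n}" by (intro open_Collect_less continuous_intros)
    ultimately show ?thesis using V by auto
  qed
  have "(\<lambda>n. integral\<^sup>L lebesgue (indicat_real (?A n))) \<longlonglongrightarrow> integral\<^sup>L lebesgue (\<lambda>x::'a. 0 :: real)"
  proof (rule integral_dominated_convergence[where w = "indicat_real V"])
    show "integrable lebesgue (indicat_real V)" using Vm by (auto simp: fmeasurable_def intro:
        integrable_real_indicator)
    show "AE x in lebesgue. (\<lambda>n. indicat_real (?A n) x) \<longlonglongrightarrow> 0"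
    proof (rule AE_I2)
      fix x :: 'a
      show "(\<lambda>n. indicat_real (?A n) x) \<longlonglongrightarrow> 0"
      proof (cases "x \<in> V")
        case True
        have "- V \<noteq> {}" using V(2) not_bounded_UNIV by (metis Compl_empty_eq double_compl)
        then have "infdist x (- V) \<noteq> 0"
          using True V(1) in_closed_iff_infdist_zero[of "- V" x] by (auto simp: closed_Compl)
        then have "0 < infdist x (- V)" using infdist_nonneg[of x "- V"] by simp
        then have "\<forall>\<^sub>F n in sequentially. c n < infdist x (- V)" by (rule order_tendstoD(2)[OF c])
        then have "\<forall>\<^sub>F n in sequentially. indicat_real (?A n) x = 0"
          by eventually_elim (auto simp: indicator_def)
        then show ?thesis by (rule tendsto_eventually)
      qed simp
    qed
    show "AE x in lebesgue. norm (indicat_real (?A n) x) \<le> indicat_real V x" for n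
      by (rule AE_I2) (auto simp: indicator_def)
    show "indicat_real (?A n) \<in> borel_measurable lebesgue" for n
      by (rule borel_measurable_indicator) (use A[of n] in simp)
  qed simp
  then show ?thesis using A by simp
qed

text \<open>In a good tile that is contained in \<open>V\<close> half of the area is filled. The rest of \<open>V\<close> lies
  in bad tiles or within distance \<open>5 \<epsilon>\<close> of the complement of \<open>V\<close>.\<close>

lemma (in step_sequence) half_density:
  fixes R :: real and K :: nat
  assumes U: "open U" "emeasure lebesgue U < \<infinity>"
  defines "V \<equiv> U \<inter> {x. \<phi> x < R}" and "E \<equiv> {x. idx \<epsilon> x \<in> I K}"
  shows "\<bar>measure lebesgue (U \<inter> E) - 1 / 2 * measure lebesgue V\<bar>
    \<le> measure lebesgue {x. \<phi> x < R \<and> \<not> diag (I K) (tile (idx \<epsilon> x))}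
      + measure lebesgue {x \<in> V. infdist x (- V) < 5 * \<epsilon>} + measure lebesgue (E - {x. \<phi> x < R})"
proof -
  let ?W = "{x. \<phi> x < R \<and> \<not> diag (I K) (tile (idx \<epsilon> x))}"
  let ?N = "{x \<in> V. infdist x (- V) < 5 * \<epsilon>}"
  define S where "S = {i. diag (I K) (tile i) \<and> {x. tile (idx \<epsilon> x) = tile i} \<subseteq> V}"
  define G where "G = {x. idx \<epsilon> x \<in> S}"
  have openB: "open {x. \<phi> x < R}" by (intro open_Collect_less continuous continuous_on_const)
  have openV: "open V" unfolding V_def using U(1) openB by (rule open_Int)
  have S_V: "pt \<epsilon> i \<in> V" if "i \<in> S" for i using that by (auto simp: S_def idx_pt[OF eps])
  have finS: "finite S"
  proof (rule finite_subset)
    show "S \<subseteq> {i. gap \<phi> (pt \<epsilon> ` {(0, 0)}) (pt \<epsilon> i) \<le> R}"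
    proof
      fix i assume "i \<in> S"
      moreover have "pt \<epsilon> (0, 0) = 0" by (simp add: pt_def zero_prod_def)
      ultimately show "i \<in> {i. gap \<phi> (pt \<epsilon> ` {(0, 0)}) (pt \<epsilon> i) \<le> R}"
        using S_V[of i] by (simp add: gap_def V_def)
    qed
  qed (rule finite_gap_le[OF eps], auto)
  have GV: "G \<subseteq> V" unfolding G_def S_def by blast
  \<comment> \<open>\<open>flip\<close> exchanges the filled and the empty cells of the good tiles\<close>
  have "card (S \<inter> I K) = card (S - I K)"
  proof (rule card_bij_eq)
    have S_flip: "flip i \<in> S" if "i \<in> S" for i using that by (simp add: S_def tile_flip)
    have mem: "flip i \<in> I K \<longleftrightarrow> i \<notin> I K" if "i \<in> S" for i
      using that by (intro flip_diag) (simp add: S_def)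
    show "flip ` (S \<inter> I K) \<subseteq> S - I K" "flip ` (S - I K) \<subseteq> S \<inter> I K"
      using S_flip mem by auto
    show "inj_on flip (S \<inter> I K)" "inj_on flip (S - I K)" by (metis flip_flip inj_onI)+
  qed (use finS in auto)
  moreover have "card S = card (S \<inter> I K) + card (S - I K)"
    using finS by (subst card_Un_disjoint[symmetric]) (auto intro: arg_cong[where f = card])
  ultimately have cardS: "real (card (S \<inter> I K)) = 1 / 2 * card S" by simp
  have GE: "measure lebesgue (G \<inter> E) = 1 / 2 * measure lebesgue G"
  proof -
    have "G \<inter> E = {x. idx \<epsilon> x \<in> S \<inter> I K}" by (auto simp: G_def E_def)
    then have "measure lebesgue (G \<inter> E) = \<epsilon>\<^sup>2 * card (S \<inter> I K)"
      using idx_vimage(3)[OF eps, of "S \<inter> I K"] finS by simp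
    also have "\<dots> = 1 / 2 * (\<epsilon>\<^sup>2 * card S)" by (simp add: cardS)
    also have "\<epsilon>\<^sup>2 * card S = measure lebesgue G" unfolding G_def by (rule idx_vimage(3)[OF eps
        finS, symmetric])
    finally show ?thesis .
  qed
  have Um: "U \<in> lmeasurable" using U by (intro fmeasurableI) auto
  have Em: "E \<in> sets lebesgue" unfolding E_def using idx_vimage(1)[OF eps I_fin] by auto
  have EB: "E - {x. \<phi> x < R} \<in> lmeasurable"
    using idx_vimage(2)[OF eps I_fin, of K] openB unfolding E_def by (intro fmeasurable_Diff) auto
  have Vm: "V \<in> lmeasurable" unfolding V_def using Um openB by (intro fmeasurable_Int_fmeasurable) auto
  have Gm: "G \<in> lmeasurable" unfolding G_def by (rule idx_vimage(2)[OF eps finS])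
  have Wm: "?W \<in> lmeasurable"
  proof (rule phi_subset_lmeasurable)
    have "?W = {x. \<phi> x < R} \<inter> {x. \<not> diag (I K) (tile (idx \<epsilon> x))}" by blast
    also have "\<dots> \<in> sets borel" using openB by (intro sets.Int idx_borel[of "\<lambda>i. \<not> diag (I K) (tile
        i)"]) auto
    finally show "?W \<in> sets lebesgue" by simp
    show "?W \<subseteq> {x. \<phi> x \<le> R}" by auto
  qed
  have Nm: "?N \<in> lmeasurable"
  proof -
    have "?N = V \<inter> {x. infdist x (- V) < 5 * \<epsilon>}" by blast
    moreover have "open {x. infdist x (- V) < 5 * \<epsilon>}" by (intro open_Collect_less continuous_intros)
    ultimately show ?thesis using Vm by (simp add: fmeasurable_Int_fmeasurable)
  qed
  have VG: "measure lebesgue (V - G) \<le> measure lebesgue ?W + measure lebesgue ?N"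
  proof -
    have "V - G \<subseteq> ?W \<union> ?N"
    proof
      fix x assume x: "x \<in> V - G"
      show "x \<in> ?W \<union> ?N"
      proof (cases "diag (I K) (tile (idx \<epsilon> x))")
        case True
        then obtain y where y: "tile (idx \<epsilon> y) = tile (idx \<epsilon> x)" "y \<notin> V"
          using x by (auto simp: G_def S_def)
        have "norm (pt \<epsilon> (idx \<epsilon> x) - pt \<epsilon> (idx \<epsilon> y)) \<le> \<epsilon> * of_int (\<bar>fst (idx \<epsilon> x) - fst (idx \<epsilon> y)\<bar>
            + \<bar>snd (idx \<epsilon> x) - snd (idx \<epsilon> y)\<bar>)"
          using eps by (intro norm_pt_diff_le) simp
        also have "\<dots> \<le> \<epsilon> * of_int 2"
          using eps tile_eq_imp_near[OF y(1)[symmetric]] by (intro mult_left_mono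
              of_int_le_iff[THEN iffD2]) auto
        finally have "dist (pt \<epsilon> (idx \<epsilon> x)) (pt \<epsilon> (idx \<epsilon> y)) \<le> \<epsilon> * 2" by (simp add: dist_norm)
        moreover have "dist x (pt \<epsilon> (idx \<epsilon> x)) \<le> \<epsilon>" "dist y (pt \<epsilon> (idx \<epsilon> y)) \<le> \<epsilon>"
          using norm_diff_pt_le[OF mem_cell_idx[OF eps]] by (auto simp: dist_norm)
        moreover have "dist x y \<le> dist x (pt \<epsilon> (idx \<epsilon> x)) + dist (pt \<epsilon> (idx \<epsilon> x)) (pt \<epsilon> (idx \<epsilon> y))
            + dist y (pt \<epsilon> (idx \<epsilon> y))"
          using dist_triangle[of x y "pt \<epsilon> (idx \<epsilon> x)"] dist_triangle[of "pt \<epsilon> (idx \<epsilon> x)" y "pt \<epsilon>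
              (idx \<epsilon> y)"]
          by (simp add: dist_commute)
        ultimately have "dist x y < 5 * \<epsilon>" using eps by linarith
        moreover have "infdist x (- V) \<le> dist x y" using y(2) by (intro infdist_le) simp
        ultimately show ?thesis using x by auto
      next
        case False
        then show ?thesis using x by (auto simp: V_def)
      qed
    qed
    then have "measure lebesgue (V - G) \<le> measure lebesgue (?W \<union> ?N)"
      using Vm Gm Wm Nm by (intro measure_mono_fmeasurable fmeasurable.Un) (auto intro: fmeasurableD)
    also have "\<dots> \<le> measure lebesgue ?W + measure lebesgue ?N"
      using Wm Nm by (intro measure_Un_le) (auto intro: fmeasurableD)
    finally show ?thesis .
  qed
  have V_eq: "measure lebesgue V = measure lebesgue G + measure lebesgue (V - G)"
    using measurable_measure_Diff[OF Vm _ GV] Gm by (simp add: fmeasurableD)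
  have UE: "U \<inter> E \<in> lmeasurable" using Um Em by (rule fmeasurable_Int_fmeasurable)
  have GEm: "G \<inter> E \<in> lmeasurable" using Gm Em by (rule fmeasurable_Int_fmeasurable)
  have "G \<inter> E \<subseteq> U \<inter> E" using GV by (auto simp: V_def)
  then have UE_eq: "measure lebesgue (U \<inter> E) = measure lebesgue (G \<inter> E) + measure lebesgue (U \<inter> E
      - G \<inter> E)"
    using measurable_measure_Diff[OF UE _, of "G \<inter> E"] GEm by (simp add: fmeasurableD)
  have rest: "measure lebesgue (U \<inter> E - G \<inter> E) \<le> measure lebesgue (V - G) + measure lebesgue (E -
      {x. \<phi> x < R})"
  proof -
    have "U \<inter> E - G \<inter> E \<subseteq> (V - G) \<union> (E - {x. \<phi> x < R})" by (auto simp: V_def)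
    then have "measure lebesgue (U \<inter> E - G \<inter> E) \<le> measure lebesgue ((V - G) \<union> (E - {x. \<phi> x < R}))"
    proof (rule measure_mono_fmeasurable)
      show "U \<inter> E - G \<inter> E \<in> sets lebesgue" using UE GEm by (auto intro: fmeasurableD)
      show "(V - G) \<union> (E - {x. \<phi> x < R}) \<in> lmeasurable"
        by (intro fmeasurable.Un EB fmeasurable_Diff Vm fmeasurableD[OF Gm])
    qed
    also have "\<dots> \<le> measure lebesgue (V - G) + measure lebesgue (E - {x. \<phi> x < R})"
      using Vm Gm EB by (intro measure_Un_le) (auto intro: fmeasurableD)
    finally show ?thesis .
  qed
  have pos: "0 \<le> measure lebesgue (U \<inter> E - G \<inter> E)" "0 \<le> measure lebesgue (V - G)"
    "0 \<le> measure lebesgue (E - {x. \<phi> x < R})" by simp_all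
  show ?thesis by (rule abs_leI) (use UE_eq V_eq GE rest VG pos in linarith)+
qed

context plane_norm
begin

text \<open>Runs with parameters in the regime, observed at a fixed time \<open>t\<close>.\<close>

context
  fixes \<epsilon> \<tau> :: "nat \<Rightarrow> real" and I :: "nat \<Rightarrow> nat \<Rightarrow> index set" and t :: real
  assumes reg: "regime \<epsilon> \<tau>" and sq: "\<And>n. step_sequence \<phi> (\<epsilon> n) (\<tau> n) (I n)" and t: "0 \<le> t"
begin

lemma regime_lims: "0 < \<epsilon> n" "0 < \<tau> n" "\<epsilon> \<longlonglongrightarrow> 0" "\<tau> \<longlonglongrightarrow> 0" "(\<lambda>n. \<epsilon> n / \<tau> n) \<longlonglongrightarrow> 0"
  using reg by (auto simp: regime_def)

text \<open>The number of steps up to time \<open>t\<close>.\<close>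

definition last_step :: "nat \<Rightarrow> nat" where
  "last_step n = nat \<lfloor>t / \<tau> n\<rfloor>"

lemma last_step_bounds: "\<tau> n * last_step n \<le> t" "t < \<tau> n * last_step n + \<tau> n"
proof -
  have "0 \<le> t / \<tau> n" using t regime_lims(2)[of n] by simp
  then have "real (last_step n) = of_int \<lfloor>t / \<tau> n\<rfloor>" unfolding last_step_def by simp
  then have "real (last_step n) \<le> t / \<tau> n" "t / \<tau> n < real (last_step n) + 1" by linarith+
  then show "\<tau> n * last_step n \<le> t" "t < \<tau> n * last_step n + \<tau> n"
    using regime_lims(2)[of n] by (simp_all add: field_simps)
qed

lemma last_step_tendsto: "(\<lambda>n. \<tau> n * last_step n) \<longlonglongrightarrow> t"
proof (rule tendsto_sandwich)
  show "\<forall>\<^sub>F n in sequentially. t - \<tau> n \<le> \<tau> n * last_step n"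
    by (rule always_eventually) (use last_step_bounds(2) in \<open>auto simp: algebra_simps intro:
        less_imp_le\<close>)
  show "\<forall>\<^sub>F n in sequentially. \<tau> n * last_step n \<le> t"
    by (rule always_eventually) (use last_step_bounds(1) in auto)
  have "(\<lambda>n. t - \<tau> n) \<longlonglongrightarrow> t - 0" by (intro tendsto_intros regime_lims)
  then show "(\<lambda>n. t - \<tau> n) \<longlonglongrightarrow> t" by simp
qed simp

text \<open>First \<open>M\<close> is chosen large, which fixes \<open>s\<close> through \<open>s ^ (2 * M) = 4\<close>, then \<open>L\<close> large
  depending on \<open>s\<close>; the remaining terms vanish as \<open>n\<close> tends to infinity.\<close>

lemma bad_tiles_tendsto_0:
  "(\<lambda>n. measure lebesgue {x. \<phi> x < 4 * t \<and> \<not> diag (I n (last_step n)) (tile (idx (\<epsilon> n) x))}) \<longlonglongrightarrow> 0"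
proof (rule tendstoI)
  fix e :: real assume e: "0 < e"
  define v where "v = vol 1"
  define w where "w = (4 * t)\<^sup>2 * v"
  have v0: "0 \<le> v" by (simp add: v_def vol_nonneg)
  have w0: "0 \<le> w" using v0 by (simp add: w_def)
  have vol: "vol r = r\<^sup>2 * v" if "0 \<le> r" for r unfolding v_def by (rule vol_scale[OF that])
  obtain M :: nat where M: "64 * w / e < M" using reals_Archimedean2 by blast
  have "0 \<le> 64 * w / e" using w0 e by simp
  then have M1: "1 \<le> M" using M by (cases M) auto
  have M2: "16 / M * w < e / 4" using M M1 e by (simp add: field_simps)
  define s where "s = root (2 * M) 4"
  have s: "1 < s" "s ^ (2 * M) \<le> 4" using M1 by (simp_all add: s_def)
  define q where "q = 1 - 1 / s"
  have q: "0 < q" using s by (simp add: q_def)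
  obtain m :: nat where m: "864 * w / (q * e) < m" using reals_Archimedean2 by blast
  define L where "L = 2 * (int m + 2)"
  have L: "4 \<le> L" "even L" by (simp_all add: L_def)
  have L2: "4 * (54 / L) / q * w < e / 4"
  proof -
    have "864 * w / (q * e) < L" using m by (simp add: L_def)
    then have "864 * w < L * (q * e)" using q e by (simp add: pos_divide_less_eq)
    then show ?thesis using q e L by (simp add: field_simps)
  qed
  let ?r = "\<lambda>n. (real (last_step n) - 1) * (4 * \<tau> n - 4 * kap * \<epsilon> n)"
  let ?b = "\<lambda>n. 16 / M * w + (4 * \<tau> n)\<^sup>2 * v + (w - (max 0 (?r n))\<^sup>2 * v)
    + 4 * (54 / L + 2 * (3 * kap * L * (\<epsilon> n / \<tau> n))) / q * ((4 * t + 4 * kap * L * \<epsilon> n)\<^sup>2 * v)"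
  have r_lim: "?r \<longlonglongrightarrow> 4 * t"
  proof -
    have "(\<lambda>n. 4 * (\<tau> n * last_step n) - 4 * kap * ((\<tau> n * last_step n) * (\<epsilon> n / \<tau> n)) - 4 * \<tau> n +
        4 * kap * \<epsilon> n)
        \<longlonglongrightarrow> 4 * t - 4 * kap * (t * 0) - 4 * 0 + 4 * kap * 0"
      by (intro tendsto_intros last_step_tendsto regime_lims)
    moreover have "4 * (\<tau> n * last_step n) - 4 * kap * ((\<tau> n * last_step n) * (\<epsilon> n / \<tau> n)) - 4 * \<tau>
        n + 4 * kap * \<epsilon> n = ?r n" for n
      using regime_lims(2)[of n] by (simp add: field_simps)
    ultimately show ?thesis by simp
  qed
  have "?b \<longlonglongrightarrow> 16 / M * w + (4 * 0)\<^sup>2 * v + (w - (max 0 (4 * t))\<^sup>2 * v)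
    + 4 * (54 / L + 2 * (3 * kap * L * 0)) / q * ((4 * t + 4 * kap * L * 0)\<^sup>2 * v)"
    by (intro tendsto_intros regime_lims r_lim) (use q in auto)
  moreover have "16 / M * w + (4 * 0)\<^sup>2 * v + (w - (max 0 (4 * t))\<^sup>2 * v)
    + 4 * (54 / L + 2 * (3 * kap * L * 0)) / q * ((4 * t + 4 * kap * L * 0)\<^sup>2 * v) < e"
  proof -
    have "16 / M * w + (4 * 0)\<^sup>2 * v + (w - (max 0 (4 * t))\<^sup>2 * v)
      + 4 * (54 / L + 2 * (3 * kap * L * 0)) / q * ((4 * t + 4 * kap * L * 0)\<^sup>2 * v) = 16 / M * w
          + 4 * (54 / L) / q * w"
      using t by (simp add: w_def)
    then show ?thesis using M2 L2 e by linarith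
  qed
  ultimately have ev_b: "\<forall>\<^sub>F n in sequentially. ?b n < e" by (rule order_tendstoD(2))
  have ev1: "\<forall>\<^sub>F n in sequentially. kap * (\<epsilon> n / \<tau> n) < 4 * q"
    using q by (intro order_tendstoD(2)[OF tendsto_mult_right_zero[OF regime_lims(5)]]) auto
  have ev2: "\<forall>\<^sub>F n in sequentially. 2 * kap * (\<epsilon> n / \<tau> n) < min (1 / 2) (4 / s)"
    using s by (intro order_tendstoD(2)[OF tendsto_mult_right_zero[OF regime_lims(5)]]) auto
  have ev3: "\<forall>\<^sub>F n in sequentially. 3 * kap * L * (\<epsilon> n / \<tau> n) < 4 * (s - 1)"
    using s by (intro order_tendstoD(2)[OF tendsto_mult_right_zero[OF regime_lims(5)]]) auto
  show "\<forall>\<^sub>F n in sequentially. dist (measure lebesgue {x. \<phi> x < 4 * t \<and> \<not> diag (I n (last_step n))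
      (tile (idx (\<epsilon> n) x))}) 0 < e"
    using ev_b ev1 ev2 ev3
  proof eventually_elim
    case (elim n)
    have tau: "0 < \<tau> n" and eps: "0 < \<epsilon> n" by (rule regime_lims)+
    have mul: "c * \<epsilon> n < \<tau> n * d" if "c * (\<epsilon> n / \<tau> n) < d" for c d
      using that tau by (simp add: field_simps)
    have small1: "4 * \<tau> n / s < 4 * \<tau> n - kap * \<epsilon> n" using mul[OF elim(2)] by (simp add: q_def
        algebra_simps)
    have "2 * kap * (\<epsilon> n / \<tau> n) < 1 / 2" "2 * kap * (\<epsilon> n / \<tau> n) < 4 / s" using elim(3) by simp_all
    from mul[OF this(1)] mul[OF this(2)]
    have small2: "2 * kap * \<epsilon> n \<le> \<tau> n / 2" and small3: "2 * kap * \<epsilon> n \<le> 4 * \<tau> n / s" by (simp_all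
        add: mult.commute)
    have small4: "3 * kap * L * \<epsilon> n < 4 * \<tau> n * (s - 1)" using mul[OF elim(4)] by (simp add:
        mult.left_commute mult.assoc)
    have R: "4 * \<tau> n * last_step n \<le> 4 * t" using last_step_bounds(1)[of n] by simp
    have kL: "0 \<le> 4 * t + 4 * kap * L * \<epsilon> n" using t kap_ge1 L eps by simp
    have "measure lebesgue {x. \<phi> x < 4 * t \<and> \<not> diag (I n (last_step n)) (tile (idx (\<epsilon> n) x))}
      \<le> 16 / M * vol (4 * t) + vol (4 * \<tau> n) + (vol (4 * t) - vol (max 0 (?r n)))
        + 4 * (54 / L + 2 * (3 * kap * L * \<epsilon> n / \<tau> n)) / (1 - 1 / s) * vol (4 * t + 4 * kap * L * \<epsilon> n)"
      by (rule step_sequence.measure_bad_tiles[OF sq M1 s L small1 small2 small3 small4 R])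
    also have "\<dots> = ?b n"
      using t tau kL by (simp add: vol w_def q_def)
    also have "\<dots> < e" by (rule elim(1))
    finally show ?case by (simp add: dist_real_def)
  qed
qed

text \<open>The discrete solution at time \<open>t\<close>, up to a null set.\<close>

definition filled :: "nat \<Rightarrow> plane set" where
  "filled n = {x. idx (\<epsilon> n) x \<in> I n (last_step n)}"

lemma filled_outside_tendsto_0: "(\<lambda>n. measure lebesgue (filled n - {x. \<phi> x < 4 * t})) \<longlonglongrightarrow> 0"
proof -
  define v where "v = vol 1"
  have vol: "vol r = r\<^sup>2 * v" if "0 \<le> r" for r unfolding v_def by (rule vol_scale[OF that])
  let ?b = "\<lambda>n. (4 * t + kap * \<epsilon> n)\<^sup>2 * v - (max 0 (4 * t - \<epsilon> n))\<^sup>2 * v"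
  have le: "measure lebesgue (filled n - {x. \<phi> x < 4 * t}) \<le> ?b n" for n
  proof -
    interpret s: step_sequence \<phi> "\<epsilon> n" "\<tau> n" "I n" by (rule sq)
    let ?A = "{x. \<phi> x \<le> 4 * t + kap * \<epsilon> n} - {x. \<phi> x \<le> max 0 (4 * t - \<epsilon> n)}"
    have k0: "0 \<le> kap * \<epsilon> n" using kap_ge1 s.eps by simp
    \<comment> \<open>the origin is needed for \<open>t = 0\<close> only\<close>
    have sub: "filled n - {x. \<phi> x < 4 * t} \<subseteq> ?A \<union> {0}"
    proof
      fix x assume x: "x \<in> filled n - {x. \<phi> x < 4 * t}"
      have "\<phi> (pt (\<epsilon> n) (idx (\<epsilon> n) x)) \<le> 4 * \<tau> n * last_step n"
        by (rule s.phi_pt_le) (use x in \<open>simp add: filled_def\<close>)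
      then have "\<phi> x \<le> 4 * t + kap * \<epsilon> n"
        using s.phi_idx[of x] triangle[of "x - pt (\<epsilon> n) (idx (\<epsilon> n) x)" "pt (\<epsilon> n) (idx (\<epsilon> n) x)"]
            last_step_bounds(1)[of n] by simp
      moreover have "x = 0 \<or> max 0 (4 * t - \<epsilon> n) < \<phi> x"
        using x s.eps nonneg[of x] zero_iff[of x] by auto
      ultimately show "x \<in> ?A \<union> {0}" by auto
    qed
    have Am: "?A \<in> lmeasurable" by (intro fmeasurable_Diff phi_lmeasurable fmeasurableD)
    have fm: "filled n \<in> sets lebesgue" unfolding filled_def using idx_vimage(1)[OF s.eps s.I_fin]
        by auto
    have "{x. \<phi> x < 4 * t} \<in> sets borel" by measurable
    then have "measure lebesgue (filled n - {x. \<phi> x < 4 * t}) \<le> measure lebesgue (?A \<union> {0})"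
      using fm Am lmeasurable_compact[of "{0 :: plane}"]
      by (intro measure_mono_fmeasurable[OF sub] fmeasurable.Un) auto
    also have "\<dots> \<le> measure lebesgue ?A + measure lebesgue {0 :: plane}"
      using Am by (intro measure_Un_le) (auto intro: fmeasurableD)
    also have "measure lebesgue {0 :: plane} = 0" by simp
    also have "measure lebesgue ?A = vol (4 * t + kap * \<epsilon> n) - vol (max 0 (4 * t - \<epsilon> n))"
      unfolding vol_def using t k0 s.eps by (intro measurable_measure_Diff phi_lmeasurable
          fmeasurableD) auto
    finally show ?thesis using t k0 by (simp add: vol)
  qed
  have "?b \<longlonglongrightarrow> (4 * t + kap * 0)\<^sup>2 * v - (max 0 (4 * t - 0))\<^sup>2 * v"
    by (intro tendsto_intros regime_lims)
  then have b: "?b \<longlonglongrightarrow> 0" using t by simp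
  show ?thesis
    by (rule tendsto_sandwich[OF _ _ tendsto_const b]) (use le in \<open>auto intro: always_eventually\<close>)
qed

lemma half_density_tendsto:
  assumes U: "open U" "emeasure lebesgue U < \<infinity>"
  shows "(\<lambda>n. measure lebesgue (U \<inter> filled n) - 1 / 2 * measure lebesgue (U \<inter> {x. \<phi> x < 4 * t})) \<longlonglongrightarrow> 0"
proof -
  let ?V = "U \<inter> {x. \<phi> x < 4 * t}"
  let ?b = "\<lambda>n. measure lebesgue {x. \<phi> x < 4 * t \<and> \<not> diag (I n (last_step n)) (tile (idx (\<epsilon> n) x))}
      + measure lebesgue {x \<in> ?V. infdist x (- ?V) < 5 * \<epsilon> n} + measure lebesgue (filled n - {x. \<phi>
          x < 4 * t})"
  have "open ?V" using U(1) by (intro open_Int open_Collect_less continuous continuous_on_const)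
  moreover have "bounded ?V" by (rule bounded_subset[OF bounded_phi[of "4 * t"]]) auto
  moreover have "(\<lambda>n. 5 * \<epsilon> n) \<longlonglongrightarrow> 0" by (rule tendsto_mult_right_zero[OF regime_lims(3)])
  ultimately have "?b \<longlonglongrightarrow> 0 + 0 + 0"
    by (intro tendsto_add bad_tiles_tendsto_0 measure_near_complement_tendsto_0
        filled_outside_tendsto_0)
  then have b: "?b \<longlonglongrightarrow> 0" by simp
  have le: "norm (measure lebesgue (U \<inter> filled n) - 1 / 2 * measure lebesgue ?V) \<le> ?b n" for n
    using step_sequence.half_density[OF sq U, where R = "4 * t" and K = "last_step n"] by (simp
        add: filled_def)
  show ?thesis by (rule tendsto_0_le[OF b, where K = 1]) (use le in \<open>auto intro!:
      always_eventually order_trans[OF _ abs_ge_self]\<close>)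
qed

lemma filled_weak_star:
  assumes g: "integrable lebesgue g"
  shows "(\<lambda>n. LINT x|lebesgue. (indicat_real (filled n) x - 1 / 2 * indicat_real {x. \<phi> x < 4 * t}
      x) * g x) \<longlonglongrightarrow> 0"
proof (rule integral_tendsto_0_of_open[OF _ _ _ g])
  have B: "{x. \<phi> x < 4 * t} \<in> sets lebesgue" by simp
  have F: "filled n \<in> sets lebesgue" for n
    unfolding filled_def using idx_vimage(1)[OF regime_lims(1) step_sequence.I_fin[OF sq]] by auto
  show "(\<lambda>x. indicat_real (filled n) x - 1 / 2 * indicat_real {x. \<phi> x < 4 * t} x) \<in>
      borel_measurable lebesgue" for n
    using B F by (intro borel_measurable_diff borel_measurable_times borel_measurable_indicator) auto
  show "\<bar>indicat_real (filled n) x - 1 / 2 * indicat_real {x. \<phi> x < 4 * t} x\<bar> \<le> 1" for n x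
    by (simp add: indicator_def)
  fix U :: "plane set" assume U: "open U" "emeasure lebesgue U < \<infinity>"
  have Um: "U \<in> lmeasurable" using U by (intro fmeasurableI) auto
  have "(LINT x|lebesgue. (indicat_real (filled n) x - 1 / 2 * indicat_real {x. \<phi> x < 4 * t} x) *
      indicat_real U x)
      = measure lebesgue (U \<inter> filled n) - 1 / 2 * measure lebesgue (U \<inter> {x. \<phi> x < 4 * t})" for n
  proof -
    have "U \<inter> filled n \<in> lmeasurable" "U \<inter> {x. \<phi> x < 4 * t} \<in> lmeasurable"
      using Um B F by (auto intro: fmeasurable_Int_fmeasurable)
    then have i: "integrable lebesgue (indicat_real (U \<inter> filled n))"
      "integrable lebesgue (\<lambda>x. 1 / 2 * indicat_real (U \<inter> {x. \<phi> x < 4 * t}) x)"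
      by (auto simp: fmeasurable_def intro: integrable_real_indicator)
    have "(\<lambda>x. (indicat_real (filled n) x - 1 / 2 * indicat_real {x. \<phi> x < 4 * t} x) * indicat_real U x)
      = (\<lambda>x. indicat_real (U \<inter> filled n) x - 1 / 2 * indicat_real (U \<inter> {x. \<phi> x < 4 * t}) x)"
      by (auto simp: indicator_def)
    then show ?thesis using Bochner_Integration.integral_diff[OF i] Um B F by simp
  qed
  then show "(\<lambda>n. LINT x|lebesgue. (indicat_real (filled n) x - 1 / 2 * indicat_real {x. \<phi> x < 4 *
      t} x) * indicat_real U x) \<longlonglongrightarrow> 0"
    using half_density_tendsto[OF U] by simp
qed

end

end

section \<open>The minimizing movement and the weak* limit\<close>

context plane_norm
begin

lemma norm_ball_borel: "norm_ball \<phi> r \<in> sets borel"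
proof -
  have "{x. \<phi> x < r} \<in> sets borel" by measurable
  then show ?thesis by (simp add: norm_ball_def)
qed

lemma finite_perimeter_norm_ball: "finite_perimeter (norm_ball \<phi> r)"
proof (rule finite_perimeter_convex[OF norm_ball_borel])
  show "convex (norm_ball \<phi> r)"
  proof (cases "r = 0")
    case False
    show ?thesis
    proof (rule convexI)
      fix x y and a b :: real
      assume xy: "x \<in> norm_ball \<phi> r" "y \<in> norm_ball \<phi> r" and ab: "0 \<le> a" "0 \<le> b" "a + b = 1"
      have "\<phi> (a *\<^sub>R x + b *\<^sub>R y) \<le> a * \<phi> x + b * \<phi> y"
        using triangle[of "a *\<^sub>R x" "b *\<^sub>R y"] ab by (simp add: scale)
      also have "\<dots> < r" using convex_bound_lt[of "\<phi> x" r "\<phi> y" a b] xy ab False by (simp add: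
          norm_ball_def)
      finally show "a *\<^sub>R x + b *\<^sub>R y \<in> norm_ball \<phi> r" using False by (simp add: norm_ball_def)
    qed
  qed (simp add: norm_ball_def)
  have "norm_ball \<phi> r \<subseteq> {x. \<phi> x \<le> max r 0}" by (auto simp: norm_ball_def)
  then show "bounded (norm_ball \<phi> r)" using bounded_subset[OF bounded_phi] by blast
qed

lemma discrete_solution_exists:
  assumes "0 < \<epsilon>" "0 < \<tau>"
  shows "\<exists>D. discrete_solution \<phi> \<epsilon> \<tau> D"
proof -
  obtain S where "scheme \<phi> \<epsilon> \<tau> S" using scheme_exists[OF assms] by blast
  then have "discrete_solution \<phi> \<epsilon> \<tau> (\<lambda>t. S (nat \<lfloor>t / \<tau>\<rfloor>))" by (auto simp: discrete_solution_def)
  then show ?thesis by blast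
qed

lemma minimizing_movement_norm_ball: "minimizing_movement \<phi> (\<lambda>t. norm_ball \<phi> (4 * t))"
proof -
  \<comment> \<open>any sequence in the regime will do\<close>
  define \<epsilon> \<tau> :: "nat \<Rightarrow> real" where "\<epsilon> n = inverse (Suc n) ^ 2" and "\<tau> n = inverse (Suc n)" for n
  have tau: "\<tau> \<longlonglongrightarrow> 0" unfolding \<tau>_def by (rule LIMSEQ_inverse_real_of_nat)
  have eps: "\<epsilon> n = \<tau> n ^ 2" for n by (simp add: \<epsilon>_def \<tau>_def)
  have pos: "0 < \<tau> n" for n by (simp add: \<tau>_def)
  have "(\<lambda>n. \<tau> n ^ 2) \<longlonglongrightarrow> 0 ^ 2" by (intro tendsto_power tau)
  moreover have "\<tau> n ^ 2 / \<tau> n = \<tau> n" for n using pos[of n] by (simp add: power2_eq_square)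
  moreover have "0 < \<tau> n ^ 2" for n using pos[of n] by simp
  ultimately have reg: "regime \<epsilon> \<tau>"
    unfolding regime_def eps using tau pos by (simp add: eps[abs_def])
  have "\<forall>n. \<exists>D. discrete_solution \<phi> (\<epsilon> n) (\<tau> n) D"
    using reg by (intro allI discrete_solution_exists) (auto simp: regime_def)
  then obtain D where D: "\<And>n. discrete_solution \<phi> (\<epsilon> n) (\<tau> n) (D n)" by metis
  show ?thesis
    unfolding minimizing_movement_def
  proof (intro conjI allI impI exI)
    show "regime \<epsilon> \<tau>" by (rule reg)
  qed (rule finite_perimeter_norm_ball D hausdorff_discrete_solution_tendsto[OF reg D] | assumption)+
qed

lemma minimizing_movement_unique:
  assumes "minimizing_movement \<phi> E" "0 \<le> t"
  shows "hausdorff_distance (E t) (norm_ball \<phi> (4 * t)) = 0"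
proof -
  obtain \<epsilon> \<tau> D where *: "regime \<epsilon> \<tau>" "\<And>n. discrete_solution \<phi> (\<epsilon> n) (\<tau> n) (D n)"
    "(\<lambda>n. hausdorff_distance (D n t) (E t)) \<longlonglongrightarrow> 0"
    using assms unfolding minimizing_movement_def by blast
  show ?thesis
    by (rule hausdorff_distance_limits_eq_0[OF *(3) hausdorff_discrete_solution_tendsto[OF *(1,2)
        assms(2)]])
qed

lemma weak_star_discrete_solution:
  assumes reg: "regime \<epsilon> \<tau>" and D: "\<And>n. discrete_solution \<phi> (\<epsilon> n) (\<tau> n) (D n)" and t: "0 \<le> t"
  shows "weak_star_tendsto (\<lambda>n. indicat_real (D n t)) (\<lambda>x. 1 / 2 * indicat_real (norm_ball \<phi> (4 *
      t)) x)"
proof -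
  have pos: "0 < \<epsilon> n" "0 < \<tau> n" for n using reg by (auto simp: regime_def)
  have "\<forall>n. \<exists>I. step_sequence \<phi> (\<epsilon> n) (\<tau> n) I \<and> (\<forall>t\<ge>0. D n t = cells (\<epsilon> n) (I (nat \<lfloor>t / \<tau> n\<rfloor>)))"
    using discrete_solution_step_sequence[OF pos D] by metis
  then obtain I where I: "\<And>n. step_sequence \<phi> (\<epsilon> n) (\<tau> n) (I n)"
    "\<And>n t. 0 \<le> t \<Longrightarrow> D n t = cells (\<epsilon> n) (I n (nat \<lfloor>t / \<tau> n\<rfloor>))" by metis
  define K where "K n = nat \<lfloor>t / \<tau> n\<rfloor>" for n
  define F where "F n = {x. idx (\<epsilon> n) x \<in> I n (K n)}" for n
  define B where "B = {x. \<phi> x < 4 * t}"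
  have Dt: "D n t = cells (\<epsilon> n) (I n (K n))" for n using I(2)[OF t] by (simp add: K_def)
  have fin: "finite (I n k)" for n k by (rule step_sequence.I_fin[OF I(1)])
  have Dm: "D n t \<in> sets lebesgue" for n
    unfolding Dt using compact_imp_closed[OF compact_cells[OF fin]] by auto
  have Fm: "F n \<in> sets lebesgue" for n unfolding F_def using idx_vimage(1)[OF pos(1) fin] by auto
  have Nm: "norm_ball \<phi> (4 * t) \<in> sets lebesgue" using norm_ball_borel by auto
  have Bm: "B \<in> sets lebesgue" unfolding B_def by simp
  have D_ae: "AE x in lebesgue. indicat_real (D n t) x = indicat_real (F n) x" for n
  proof -
    have "AE x in lebesgue. x \<notin> D n t - F n"
      using cells_idx(2)[OF pos(1), of n "I n (K n)"] unfolding Dt F_def negligible_iff_null_sets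
          by (rule AE_not_in)
    then show ?thesis
    proof eventually_elim
      case (elim x)
      moreover have "F n \<subseteq> D n t" unfolding Dt F_def by (rule cells_idx(1)[OF pos(1)])
      ultimately show ?case by (auto simp: indicator_def)
    qed
  qed
  have B_ae: "AE x in lebesgue. indicat_real (norm_ball \<phi> (4 * t)) x = indicat_real B x"
  proof -
    have "{0 :: plane} \<in> null_sets lebesgue" using negligible_sing[of "0 :: plane"] by (simp add:
        negligible_iff_null_sets)
    then have "AE x in lebesgue. x \<notin> {0 :: plane}" by (rule AE_not_in)
    then show ?thesis
    proof eventually_elim
      case (elim x)
      then have "\<phi> x \<noteq> 0" by (simp add: zero_iff)
      then show ?case using elim nonneg[of x] by (auto simp: indicator_def norm_ball_def B_def)
    qed
  qed
  have int: "integrable lebesgue (\<lambda>x. indicat_real A x * g x)"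
    if "A \<in> sets lebesgue" "integrable lebesgue g" for A g
    using integrable_mult_indicator[OF that] by simp
  show ?thesis
    unfolding weak_star_tendsto_def
  proof (intro conjI allI impI)
    show "in_Linfty (indicat_real (D n t))" for n
      unfolding in_Linfty_def using Dm[of n]
      by (intro conjI exI[of _ 1]) (auto simp: indicator_def intro: borel_measurable_indicator)
    show "in_Linfty (\<lambda>x. 1 / 2 * indicat_real (norm_ball \<phi> (4 * t)) x)"
      unfolding in_Linfty_def using Nm
      by (intro conjI exI[of _ 1] borel_measurable_times borel_measurable_const
          borel_measurable_indicator)
        (auto simp: indicator_def)
    fix g :: "plane \<Rightarrow> real" assume g: "integrable lebesgue g"
    have gm: "g \<in> borel_measurable lebesgue" using g by (rule borel_measurable_integrable)
    have D_eq: "(LINT x|lebesgue. indicat_real (D n t) x * g x) = (LINT x|lebesgue. indicat_real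
        (F n) x * g x)" for n
    proof (rule integral_cong_AE)
      show "AE x in lebesgue. indicat_real (D n t) x * g x = indicat_real (F n) x * g x"
        using D_ae[of n] by eventually_elim simp
    qed (use Dm Fm gm in \<open>auto intro!: borel_measurable_times borel_measurable_indicator\<close>)
    have B_eq: "(LINT x|lebesgue. 1 / 2 * indicat_real (norm_ball \<phi> (4 * t)) x * g x)
        = (LINT x|lebesgue. 1 / 2 * indicat_real B x * g x)"
    proof (rule integral_cong_AE)
      show "AE x in lebesgue. 1 / 2 * indicat_real (norm_ball \<phi> (4 * t)) x * g x = 1 / 2 *
          indicat_real B x * g x"
        using B_ae by eventually_elim simp
    qed (use Nm Bm gm in \<open>auto intro!: borel_measurable_times borel_measurable_indicator\<close>)
    have diff: "(LINT x|lebesgue. indicat_real (F n) x * g x) - (LINT x|lebesgue. 1 / 2 *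
        indicat_real B x * g x)
        = (LINT x|lebesgue. (indicat_real (F n) x - 1 / 2 * indicat_real B x) * g x)" for n
    proof -
      have i: "integrable lebesgue (\<lambda>x. 1 / 2 * indicat_real B x * g x)"
        using integrable_mult_right[OF int[OF Bm g], of "1 / 2"] by (simp add: mult.assoc)
      show ?thesis
        by (subst Bochner_Integration.integral_diff[symmetric, OF int[OF Fm g] i]) (simp add:
            left_diff_distrib)
    qed
    have conv: "(\<lambda>n. LINT x|lebesgue. (indicat_real (F n) x - 1 / 2 * indicat_real B x) * g x) \<longlonglongrightarrow> 0"
      using filled_weak_star[OF reg I(1) t g]
      unfolding filled_def[OF reg I(1) t] last_step_def[OF reg I(1) t] F_def K_def B_def .
    show "(\<lambda>n. LINT x|lebesgue. indicat_real (D n t) x * g x)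
        \<longlonglongrightarrow> (LINT x|lebesgue. 1 / 2 * indicat_real (norm_ball \<phi> (4 * t)) x * g x)"
      by (rule LIM_zero_cancel) (simp only: D_eq B_eq diff conv)
  qed
qed

end

theorem corollary21:
  fixes \<phi> :: "plane \<Rightarrow> real"
  assumes "is_norm \<phi>"
  shows "(\<exists>E. minimizing_movement \<phi> E \<and>
            (\<forall>E'. minimizing_movement \<phi> E' \<longrightarrow> (\<forall>t\<ge>0. hausdorff_distance (E' t) (E t) = 0)) \<and>
            (\<forall>t\<ge>0. E t = norm_ball \<phi> (4 * t))) \<and>
         (\<forall>\<epsilon> \<tau> D. regime \<epsilon> \<tau> \<longrightarrow> (\<forall>n. discrete_solution \<phi> (\<epsilon> n) (\<tau> n) (D n)) \<longrightarrow>
            (\<forall>t\<ge>0. weak_star_tendsto (\<lambda>n. indicat_real (D n t))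
                     (\<lambda>x. 1 / 2 * indicat_real (norm_ball \<phi> (4 * t)) x)))"
proof -
  interpret plane_norm \<phi> by unfold_locales (rule assms)
  show ?thesis
  proof (intro conjI allI impI exI[of _ "\<lambda>t. norm_ball \<phi> (4 * t)"])
    show "minimizing_movement \<phi> (\<lambda>t. norm_ball \<phi> (4 * t))" by (rule minimizing_movement_norm_ball)
  next
    fix E' t assume "minimizing_movement \<phi> E'" "0 \<le> (t :: real)"
    then show "hausdorff_distance (E' t) (norm_ball \<phi> (4 * t)) = 0" by (rule minimizing_movement_unique)
  next
    fix \<epsilon> \<tau> D t
    assume *: "regime \<epsilon> \<tau>" "\<forall>n. discrete_solution \<phi> (\<epsilon> n) (\<tau> n) (D n)" "0 \<le> (t :: real)"
    show "weak_star_tendsto (\<lambda>n. indicat_real (D n t)) (\<lambda>x. 1 / 2 * indicat_real (norm_ball \<phi> (4 *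
        t)) x)"
      by (rule weak_star_discrete_solution[OF *(1) _ *(3)]) (rule spec[OF *(2)])
  qed (rule refl)
qed

end
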